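(* Let $M$ be a Poisson manifold, let $\star$ be a Hermitian star-product on $M$, $\boldsymbol{\mathcal A}=(C^\infty(M)[[\lambda]],\star)$, and let $(E,h_0)\to M$ be a Hermitian vector bundle of fiber dimension $\ge1$. Then every Hermitian deformation $\boldsymbol{\mathcal E}=(\mathcal E[[\lambda]],\bullet,\boldsymbol h)$ of $\mathcal E=\Gamma^\infty(E)$ corresponding to $\boldsymbol{\mathcal A}$ is a non-degenerate equivalence bimodule for $\mathrm{End}_{\boldsymbol{\mathcal A}}(\boldsymbol{\mathcal E})$ and $\boldsymbol{\mathcal A}$, and therefore $\mathrm{End}_{\boldsymbol{\mathcal A}}(\boldsymbol{\mathcal E})$ and $\boldsymbol{\mathcal A}$ are formally Morita equivalent.
   Context: A Hermitian star-product on $M$ is an associative $\mathbb C[[\lambda]]$-bilinear product $f\star g=\sum_{r\ge0}C_r(f,g)\lambda^r$ on $C^\infty(M)[[\lambda]]$ (complex-valued functions) with $C_r$ $\mathbb C$-bilinear, $C_0(f,g)=fg$, unit $1$, $\frac1{\mathrm i}(C_1(f,g)-C_1(g,f))=\{f,g\}$ and $\overline{f\star g}=\overline g\star\overline f$ ($\lambda$ real). Positivity. $\mathbb R[[\lambda]]$ is ordered by: $\sum_r a_r\lambda^r>0$ iff the first nonvanishing coefficient is positive. For a $^*$-algebra $\mathcal D$ over $\mathbb C[[\lambda]]$, a linear functional $\omega:\mathcal D\to\mathbb C[[\lambda]]$ is positive if $\omega(D^*D)\ge0$ for all $D$, and $\mathcal D^+$ is the set of $D$ with $\omega(D)\ge0$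 for all positive $\omega$. Hermitian deformations. $h_0$ also denotes the induced $C^\infty(M)$-valued inner product on the right $C^\infty(M)$-module $\mathcal E$. A Hermitian deformation of $(\mathcal E,h_0)$ corresponding to $\boldsymbol{\mathcal A}$ is a triple $(\mathcal E[[\lambda]],\bullet,\boldsymbol h)$, where $x\bullet A=\sum_{r\ge0}R_r(x,A)\lambda^r$ ($R_r:\mathcal E\times C^\infty(M)\to\mathcal E$ $\mathbb C$-bilinear, $R_0(x,A)=x\cdot A$) makes $\mathcal E[[\lambda]]$ a right $\boldsymbol{\mathcal A}$-module, and $\boldsymbol h=\sum_{r\ge0}h_r\lambda^r$, $h_r:\mathcal E\times\mathcal E\to C^\infty(M)$, with zeroth order $h_0$, is a positive definite $\boldsymbol{\mathcal A}$-valued inner product: $\mathbb C[[\lambda]]$-linear in the second argument, $\boldsymbol h(x,y)^*=\boldsymbol h(y,x)$, $\boldsymbol h(x,y\bullet A)=\boldsymbol h(x,y)\star A$, $\boldsymbol h(x,x)\in\boldsymbol{\mathcal A}^+$, $\boldsymbol h(x,x)=0\Rightarrow x=0$. $\mathrm{End}_{\boldsymbol{\mathcal A}}(\boldsymbol{\mathcal E})$ is the algebra of right $\boldsymbol{\mathcal A}$-linear endomorphisms, with involution the adjoint with respect to $\boldsymbol h$. Equivalence bimodules. Let $\mathcal C,\mathcal D$ be unital $^*$-algebras over $\mathbb C[[\lambda]]$. An equivalence bimodule is a $(\mathcal D$-$\mathcal C)$-bimodule $\mathcal F$ with a $\mathcal C$-valued inner product $\langle\cdot,\cdot\rangle$ (sesquilinear,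 linear and $\mathcal C$-right linear in the second argument, $\langle x,y\rangle^*=\langle y,x\rangle$, $\langle x,x\rangle\in\mathcal C^+$) and a $\mathcal D$-valued inner product $\Theta_{\cdot,\cdot}$ (sesquilinear, linear and $\mathcal D$-left linear in the first argument, $\Theta_{x,y}^*=\Theta_{y,x}$, $\Theta_{x,x}\in\mathcal D^+$), both full (spans of $\langle\mathcal F,\mathcal F\rangle$ and $\Theta_{\mathcal F,\mathcal F}$ are $\mathcal C$ and $\mathcal D$), such that $\langle x,Dy\rangle=\langle D^*x,y\rangle$, $\Theta_{x,yC}=\Theta_{xC^*,y}$, $\Theta_{x,y}z=x\langle y,z\rangle$, and satisfying (P) and (Q). (P): for every $^*$-representation $\pi$ of $\mathcal C$ on a pre-Hilbert space $\mathfrak H$ over $\mathbb C[[\lambda]]$ (a module with positive definite Hermitian inner product), the inner product on $\mathcal F\otimes_{\mathcal C}\mathfrak H$ given by $\langle x\otimes\psi,y\otimes\phi\rangle=\langle\psi,\pi(\langle x,y\rangle)\phi\rangle$ is positive semi-definite. (Q): the analogous property for the complex-conjugate bimodule, i.e. $\langle\overline x\otimes\psi,\overline y\otimes\phi\rangle=\langle\psi,\pi(\Theta_{x,y})\phi\rangle$ is positive semi-definite on $\overline{\mathcal F}\otimes_{\mathcal D}\mathfrak H$ for all $^*$-representations $(\pi,\mathfrak H)$ of $\mathcal D$. $\mathcal F$ is non-degenerate if both actions are non-degenerate (for unital algebras: the units act as the identity). $\mathcal C$ and $\mathcal D$ are formally Morita equivalent if an equivalence bimodule exists. Here $\boldsymbol{\mathcal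 E}$ is an $(\mathrm{End}_{\boldsymbol{\mathcal A}}(\boldsymbol{\mathcal E})$-$\boldsymbol{\mathcal A})$-bimodule with inner products $\langle x,y\rangle=\boldsymbol h(x,y)$ and $\Theta_{x,y}z=x\bullet\boldsymbol h(y,z)$. *)

theory Defs
  imports
    "HOL-Analysis.Analysis"
    "HOL-Algebra.Module"
    "HOL-Algebra.AbelCoset"
    "HOL-Computational_Algebra.Formal_Power_Series"
    "HOL-Library.Poly_Mapping"
begin

section \<open>Smooth manifolds\<close>

text \<open>The model space of an n-dimensional manifold is \<^term>\<open>span B\<close> for a set \<^term>\<open>B\<close> of n
  elements of the standard basis of a Euclidean space. Types of class \<open>euclidean_space\<close> have
  positive dimension, so working with \<^term>\<open>UNIV\<close> instead would exclude dimension zero.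
  \<^term>\<open>V\<close> below is always relatively open in \<^term>\<open>span B\<close>.\<close>

primrec Ck_on ::
  "nat \<Rightarrow> 'e::euclidean_space set \<Rightarrow> 'e set \<Rightarrow> ('e \<Rightarrow> 'b::real_normed_vector) \<Rightarrow> bool" where
  "Ck_on 0 B V f \<longleftrightarrow> continuous_on V f"
| "Ck_on (Suc k) B V f \<longleftrightarrow> continuous_on V f \<and>
     (\<forall>b\<in>B. \<exists>g. (\<forall>x\<in>V. ((\<lambda>t. f (x + t *\<^sub>R b)) has_vector_derivative g x) (at 0)) \<and> Ck_on k B V g)"

definition smooth_on ::
  "'e::euclidean_space set \<Rightarrow> 'e set \<Rightarrow> ('e \<Rightarrow> 'b::real_normed_vector) \<Rightarrow> bool" where
  "smooth_on B V f \<longleftrightarrow> (\<forall>k. Ck_on k B V f)"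

record ('m, 'e) smooth_structure =
  model_basis :: "'e set"
  charts :: "('m set \<times> ('m \<Rightarrow> 'e)) set"

text \<open>The Hausdorff and second countability axioms are carried by the sort of the point type.
  The atlas need not be maximal.\<close>

definition smooth_manifold ::
  "('m::{t2_space, second_countable_topology}, 'e::euclidean_space) smooth_structure \<Rightarrow> bool" where
  "smooth_manifold M \<longleftrightarrow>
     model_basis M \<subseteq> Basis \<and>
     (\<Union>(U, \<phi>)\<in>charts M. U) = UNIV \<and>
     (\<forall>(U, \<phi>)\<in>charts M. open U \<and>
        openin (top_of_set (span (model_basis M))) (\<phi> ` U) \<and>
        (\<exists>\<psi>. homeomorphism U (\<phi> ` U) \<phi> \<psi>)) \<and>
     (\<forall>(U, \<phi>)\<in>charts M. \<forall>(U', \<phi>')\<in>charts M.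
        smooth_on (model_basis M) (\<phi> ` (U \<inter> U')) (\<phi>' \<circ> inv_into U \<phi>))"

definition smooth_map ::
  "('m, 'e::euclidean_space) smooth_structure \<Rightarrow> 'm set \<Rightarrow> ('m \<Rightarrow> 'b::real_normed_vector) \<Rightarrow> bool" where
  "smooth_map M W f \<longleftrightarrow>
     (\<forall>(U, \<phi>)\<in>charts M. smooth_on (model_basis M) (\<phi> ` (U \<inter> W)) (f \<circ> inv_into U \<phi>))"

section \<open>Modules and formal power series\<close>

definition ring_of_type :: "'a::comm_ring_1 ring" where
  "ring_of_type = \<lparr>carrier = UNIV, mult = (*), one = 1, zero = 0, add = (+)\<rparr>"

abbreviation complex_field :: "complex ring" where
  "complex_field \<equiv> ring_of_type"

abbreviation complex_series :: "complex fps ring" where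
  "complex_series \<equiv> ring_of_type"

definition lin_span :: "('k, 'r) ring_scheme \<Rightarrow> ('k, 'x, 'z) module_scheme \<Rightarrow> 'x set \<Rightarrow> 'x set" where
  "lin_span K V S = \<Inter>{W. submodule W K V \<and> S \<subseteq> W}"

definition linear_map ::
  "('k, 'r) ring_scheme \<Rightarrow> ('k, 'x, 'z1) module_scheme \<Rightarrow> ('k, 'y, 'z2) module_scheme \<Rightarrow>
   ('x \<Rightarrow> 'y) \<Rightarrow> bool" where
  "linear_map K X Y f \<longleftrightarrow>
     (\<forall>x\<in>carrier X. f x \<in> carrier Y) \<and>
     (\<forall>x\<in>carrier X. \<forall>x'\<in>carrier X. f (x \<oplus>\<^bsub>X\<^esub> x') = f x \<oplus>\<^bsub>Y\<^esub> f x') \<and>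
     (\<forall>c\<in>carrier K. \<forall>x\<in>carrier X. f (c \<odot>\<^bsub>X\<^esub> x) = c \<odot>\<^bsub>Y\<^esub> f x)"

definition bilinear_map ::
  "('k, 'r) ring_scheme \<Rightarrow> ('k, 'x, 'z1) module_scheme \<Rightarrow> ('k, 'y, 'z2) module_scheme \<Rightarrow>
   ('k, 'w, 'z3) module_scheme \<Rightarrow> ('x \<Rightarrow> 'y \<Rightarrow> 'w) \<Rightarrow> bool" where
  "bilinear_map K X Y Z b \<longleftrightarrow>
     (\<forall>x\<in>carrier X. linear_map K Y Z (b x)) \<and>
     (\<forall>y\<in>carrier Y. linear_map K X Z (\<lambda>x. b x y))"

text \<open>For a complex vector space X: the module of formal power series in \<open>\<lambda>\<close> with
  coefficients in X. As usual for modules in \<open>HOL-Algebra\<close>, the multiplication of the underlying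
  ring record is unused.\<close>

definition formal_module ::
  "(complex, 'x, 'z) module_scheme \<Rightarrow> (complex fps, 'x fps) module" where
  "formal_module X =
     \<lparr>carrier = {x. \<forall>n. fps_nth x n \<in> carrier X},
      mult = undefined, one = undefined,
      zero = Abs_fps (\<lambda>n. \<zero>\<^bsub>X\<^esub>),
      add = (\<lambda>x y. Abs_fps (\<lambda>n. fps_nth x n \<oplus>\<^bsub>X\<^esub> fps_nth y n)),
      smult = (\<lambda>c x. Abs_fps (\<lambda>n. \<Oplus>\<^bsub>X\<^esub>k\<in>{..n}. fps_nth c k \<odot>\<^bsub>X\<^esub> fps_nth x (n - k)))\<rparr>"

text \<open>The series of maps \<open>\<Sum>\<^sub>r b\<^sub>r \<lambda>\<^sup>r\<close>, evaluated on formal series: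
  the coefficient of \<open>\<lambda>\<^sup>n\<close> is \<open>\<Sum> b\<^sub>r(x\<^sub>s, y\<^sub>t)\<close> over \<open>r + s + t = n\<close>. For sesquilinear
  \<open>b\<^sub>r\<close> this is the right formula as well, since \<open>\<lambda>\<close> is real.\<close>

definition formal_extension ::
  "(complex, 'w, 'z) module_scheme \<Rightarrow> (nat \<Rightarrow> 'x \<Rightarrow> 'y \<Rightarrow> 'w) \<Rightarrow> 'x fps \<Rightarrow> 'y fps \<Rightarrow> 'w fps" where
  "formal_extension Z b x y = Abs_fps (\<lambda>n.
     \<Oplus>\<^bsub>Z\<^esub>r\<in>{..n}. \<Oplus>\<^bsub>Z\<^esub>s\<in>{..n - r}. b r (fps_nth x s) (fps_nth y (n - r - s)))"

definition fps_cnj :: "complex fps \<Rightarrow> complex fps" where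
  "fps_cnj c = Abs_fps (\<lambda>n. cnj (fps_nth c n))"

definition fps_nonneg :: "complex fps \<Rightarrow> bool" where
  "fps_nonneg c \<longleftrightarrow>
     (\<forall>n. fps_nth c n \<in> \<real>) \<and> (c = 0 \<or> Re (fps_nth c (subdegree c)) > 0)"

section \<open>\<open>*\<close>-algebras over the formal power series\<close>

record 'a star_algebra = "(complex fps, 'a) module" +
  involution :: "'a \<Rightarrow> 'a"

definition unital_star_algebra :: "('a, 'z) star_algebra_scheme \<Rightarrow> bool" where
  "unital_star_algebra A \<longleftrightarrow>
     Ring.ring A \<and> Module.module complex_series A \<and>
     bilinear_map complex_series A A A (mult A) \<and>
     (\<forall>a\<in>carrier A. involution A a \<in> carrier A \<and> involution A (involution A a) = a) \<and>
     (\<forall>a\<in>carrier A. \<forall>b\<in>carrier A.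
        involution A (a \<oplus>\<^bsub>A\<^esub> b) = involution A a \<oplus>\<^bsub>A\<^esub> involution A b \<and>
        involution A (a \<otimes>\<^bsub>A\<^esub> b) = involution A b \<otimes>\<^bsub>A\<^esub> involution A a) \<and>
     (\<forall>c. \<forall>a\<in>carrier A. involution A (c \<odot>\<^bsub>A\<^esub> a) = fps_cnj c \<odot>\<^bsub>A\<^esub> involution A a)"

definition positive_functional ::
  "('a, 'z) star_algebra_scheme \<Rightarrow> ('a \<Rightarrow> complex fps) \<Rightarrow> bool" where
  "positive_functional A \<omega> \<longleftrightarrow>
     (\<forall>a\<in>carrier A. \<forall>b\<in>carrier A. \<omega> (a \<oplus>\<^bsub>A\<^esub> b) = \<omega> a + \<omega> b) \<and>
     (\<forall>c. \<forall>a\<in>carrier A. \<omega> (c \<odot>\<^bsub>A\<^esub> a) = c * \<omega> a) \<and>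
     (\<forall>a\<in>carrier A. fps_nonneg (\<omega> (involution A a \<otimes>\<^bsub>A\<^esub> a)))"

definition positive_elements :: "('a, 'z) star_algebra_scheme \<Rightarrow> 'a set" where
  "positive_elements A = {a \<in> carrier A. \<forall>\<omega>. positive_functional A \<omega> \<longrightarrow> fps_nonneg (\<omega> a)}"

record 'h inner_module = "(complex fps, 'h) module" +
  inner_product :: "'h \<Rightarrow> 'h \<Rightarrow> complex fps"

definition pre_hilbert :: "('h, 'z) inner_module_scheme \<Rightarrow> bool" where
  "pre_hilbert H \<longleftrightarrow>
     Module.module complex_series H \<and>
     (\<forall>x\<in>carrier H. \<forall>y\<in>carrier H. \<forall>z\<in>carrier H.
        inner_product H x (y \<oplus>\<^bsub>H\<^esub> z) = inner_product H x y + inner_product H x z) \<and>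
     (\<forall>c. \<forall>x\<in>carrier H. \<forall>y\<in>carrier H. inner_product H x (c \<odot>\<^bsub>H\<^esub> y) = c * inner_product H x y) \<and>
     (\<forall>x\<in>carrier H. \<forall>y\<in>carrier H. inner_product H y x = fps_cnj (inner_product H x y)) \<and>
     (\<forall>x\<in>carrier H. fps_nonneg (inner_product H x x) \<and> (inner_product H x x = 0 \<longrightarrow> x = \<zero>\<^bsub>H\<^esub>))"

text \<open>A \<open>*\<close>-representation is not required to preserve the unit.\<close>

definition star_representation ::
  "('a, 'z1) star_algebra_scheme \<Rightarrow> ('h, 'z2) inner_module_scheme \<Rightarrow> ('a \<Rightarrow> 'h \<Rightarrow> 'h) \<Rightarrow> bool" where
  "star_representation A H \<pi> \<longleftrightarrow>
     bilinear_map complex_series A H H \<pi> \<and>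
     (\<forall>a\<in>carrier A. \<forall>b\<in>carrier A. \<forall>x\<in>carrier H. \<pi> (a \<otimes>\<^bsub>A\<^esub> b) x = \<pi> a (\<pi> b x)) \<and>
     (\<forall>a\<in>carrier A. \<forall>x\<in>carrier H. \<forall>y\<in>carrier H.
        inner_product H x (\<pi> a y) = inner_product H (\<pi> (involution A a) x) y)"

section \<open>Equivalence bimodules\<close>

text \<open>A (D-C)-bimodule with a D-valued and a C-valued inner product; \<open>left_ip\<close> is \<open>\<Theta>\<close>.\<close>

record ('d, 'c, 'f) inner_bimodule = "(complex fps, 'f) module" +
  left_act :: "'d \<Rightarrow> 'f \<Rightarrow> 'f"
  right_act :: "'f \<Rightarrow> 'c \<Rightarrow> 'f"
  left_ip :: "'f \<Rightarrow> 'f \<Rightarrow> 'd"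
  right_ip :: "'f \<Rightarrow> 'f \<Rightarrow> 'c"

definition right_module ::
  "('c, 'z1) star_algebra_scheme \<Rightarrow> (complex fps, 'f, 'z2) module_scheme \<Rightarrow>
   ('f \<Rightarrow> 'c \<Rightarrow> 'f) \<Rightarrow> bool" where
  "right_module C F act \<longleftrightarrow>
     Module.module complex_series F \<and> bilinear_map complex_series F C F act \<and>
     (\<forall>x\<in>carrier F. \<forall>a\<in>carrier C. \<forall>b\<in>carrier C. act x (a \<otimes>\<^bsub>C\<^esub> b) = act (act x a) b)"

definition left_module ::
  "('d, 'z1) star_algebra_scheme \<Rightarrow> (complex fps, 'f, 'z2) module_scheme \<Rightarrow>
   ('d \<Rightarrow> 'f \<Rightarrow> 'f) \<Rightarrow> bool" where
  "left_module D F act \<longleftrightarrow>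
     Module.module complex_series F \<and> bilinear_map complex_series D F F act \<and>
     (\<forall>x\<in>carrier F. \<forall>a\<in>carrier D. \<forall>b\<in>carrier D. act (a \<otimes>\<^bsub>D\<^esub> b) x = act a (act b x))"

definition right_inner_product ::
  "('c, 'z1) star_algebra_scheme \<Rightarrow> (complex fps, 'f, 'z2) module_scheme \<Rightarrow>
   ('f \<Rightarrow> 'c \<Rightarrow> 'f) \<Rightarrow> ('f \<Rightarrow> 'f \<Rightarrow> 'c) \<Rightarrow> bool" where
  "right_inner_product C F act ip \<longleftrightarrow>
     (\<forall>x\<in>carrier F. linear_map complex_series F C (ip x)) \<and>
     (\<forall>x\<in>carrier F. \<forall>y\<in>carrier F. involution C (ip x y) = ip y x) \<and>
     (\<forall>x\<in>carrier F. \<forall>y\<in>carrier F. \<forall>a\<in>carrier C. ip x (act y a) = ip x y \<otimes>\<^bsub>C\<^esub> a) \<and>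
     (\<forall>x\<in>carrier F. ip x x \<in> positive_elements C)"

definition left_inner_product ::
  "('d, 'z1) star_algebra_scheme \<Rightarrow> (complex fps, 'f, 'z2) module_scheme \<Rightarrow>
   ('d \<Rightarrow> 'f \<Rightarrow> 'f) \<Rightarrow> ('f \<Rightarrow> 'f \<Rightarrow> 'd) \<Rightarrow> bool" where
  "left_inner_product D F act ip \<longleftrightarrow>
     (\<forall>y\<in>carrier F. linear_map complex_series F D (\<lambda>x. ip x y)) \<and>
     (\<forall>x\<in>carrier F. \<forall>y\<in>carrier F. involution D (ip x y) = ip y x) \<and>
     (\<forall>x\<in>carrier F. \<forall>y\<in>carrier F. \<forall>a\<in>carrier D. ip (act a x) y = a \<otimes>\<^bsub>D\<^esub> ip x y) \<and>
     (\<forall>x\<in>carrier F. ip x x \<in> positive_elements D)"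

text \<open>The tensor product of F and H over C is the quotient of the free module over the formal
  series on pairs by the submodule generated by the relations below.\<close>

definition free_module :: "'s set \<Rightarrow> (complex fps, 's \<Rightarrow>\<^sub>0 complex fps) module" where
  "free_module X =
     \<lparr>carrier = {u. Poly_Mapping.keys u \<subseteq> X}, mult = undefined, one = undefined,
      zero = 0, add = (+), smult = (\<lambda>c. Poly_Mapping.map ((*) c))\<rparr>"

definition tensor_relations ::
  "('c, 'z1) star_algebra_scheme \<Rightarrow> ('d, 'c, 'f, 'z2) inner_bimodule_scheme \<Rightarrow>
   ('h, 'z3) inner_module_scheme \<Rightarrow> ('c \<Rightarrow> 'h \<Rightarrow> 'h) \<Rightarrow> ('f \<times> 'h \<Rightarrow>\<^sub>0 complex fps) set" where
  "tensor_relations C F H \<pi> =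
     {Poly_Mapping.single (x \<oplus>\<^bsub>F\<^esub> y, v) 1 - Poly_Mapping.single (x, v) 1 - Poly_Mapping.single (y, v) 1
       | x y v. x \<in> carrier F \<and> y \<in> carrier F \<and> v \<in> carrier H} \<union>
     {Poly_Mapping.single (x, v \<oplus>\<^bsub>H\<^esub> w) 1 - Poly_Mapping.single (x, v) 1 - Poly_Mapping.single (x, w) 1
       | x v w. x \<in> carrier F \<and> v \<in> carrier H \<and> w \<in> carrier H} \<union>
     {Poly_Mapping.single (c \<odot>\<^bsub>F\<^esub> x, v) 1 - Poly_Mapping.single (x, v) c
       | c x v. x \<in> carrier F \<and> v \<in> carrier H} \<union>
     {Poly_Mapping.single (x, c \<odot>\<^bsub>H\<^esub> v) 1 - Poly_Mapping.single (x, v) c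
       | c x v. x \<in> carrier F \<and> v \<in> carrier H} \<union>
     {Poly_Mapping.single (right_act F x a, v) 1 - Poly_Mapping.single (x, \<pi> a v) 1
       | x a v. x \<in> carrier F \<and> a \<in> carrier C \<and> v \<in> carrier H}"

definition tensor_class ::
  "('c, 'z1) star_algebra_scheme \<Rightarrow> ('d, 'c, 'f, 'z2) inner_bimodule_scheme \<Rightarrow>
   ('h, 'z3) inner_module_scheme \<Rightarrow> ('c \<Rightarrow> 'h \<Rightarrow> 'h) \<Rightarrow>
   ('f \<times> 'h \<Rightarrow>\<^sub>0 complex fps) \<Rightarrow> ('f \<times> 'h \<Rightarrow>\<^sub>0 complex fps) set" where
  "tensor_class C F H \<pi> u =
     (let V = free_module (carrier F \<times> carrier H)
      in lin_span complex_series V (tensor_relations C F H \<pi>) +>\<^bsub>V\<^esub> u)"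

definition tensor_product ::
  "('c, 'z1) star_algebra_scheme \<Rightarrow> ('d, 'c, 'f, 'z2) inner_bimodule_scheme \<Rightarrow>
   ('h, 'z3) inner_module_scheme \<Rightarrow> ('c \<Rightarrow> 'h \<Rightarrow> 'h) \<Rightarrow>
   ('f \<times> 'h \<Rightarrow>\<^sub>0 complex fps) set set" where
  "tensor_product C F H \<pi> =
     tensor_class C F H \<pi> ` carrier (free_module (carrier F \<times> carrier H))"

text \<open>The sesquilinear extension of \<open>\<langle>x \<otimes> v, y \<otimes> w\<rangle> = \<langle>v, \<pi>(\<langle>x, y\<rangle>) w\<rangle>\<close> to
  finite linear combinations.\<close>

definition tensor_form ::
  "('d, 'c, 'f, 'z2) inner_bimodule_scheme \<Rightarrow> ('h, 'z3) inner_module_scheme \<Rightarrow>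
   ('c \<Rightarrow> 'h \<Rightarrow> 'h) \<Rightarrow> ('f \<times> 'h \<Rightarrow>\<^sub>0 complex fps) \<Rightarrow> ('f \<times> 'h \<Rightarrow>\<^sub>0 complex fps) \<Rightarrow> complex fps" where
  "tensor_form F H \<pi> u u' =
     (\<Sum>(x, v)\<in>Poly_Mapping.keys u. \<Sum>(y, w)\<in>Poly_Mapping.keys u'.
        fps_cnj (Poly_Mapping.lookup u (x, v)) * Poly_Mapping.lookup u' (y, w) *
        inner_product H v (\<pi> (right_ip F x y) w))"

definition psd_on_tensor_product ::
  "('c, 'z1) star_algebra_scheme \<Rightarrow> ('d, 'c, 'f, 'z2) inner_bimodule_scheme \<Rightarrow>
   ('h, 'z3) inner_module_scheme \<Rightarrow> ('c \<Rightarrow> 'h \<Rightarrow> 'h) \<Rightarrow> bool" where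
  "psd_on_tensor_product C F H \<pi> \<longleftrightarrow>
     (\<exists>S. (\<forall>u\<in>carrier (free_module (carrier F \<times> carrier H)).
           \<forall>u'\<in>carrier (free_module (carrier F \<times> carrier H)).
             S (tensor_class C F H \<pi> u) (tensor_class C F H \<pi> u') = tensor_form F H \<pi> u u') \<and>
          (\<forall>t\<in>tensor_product C F H \<pi>. fps_nonneg (S t t)))"

text \<open>Property (P). A definition in HOL cannot quantify over types, so the type containing the
  pre-Hilbert spaces is a parameter. A result stated for an arbitrary type \<^typ>\<open>'h\<close> covers all
  pre-Hilbert spaces.\<close>

definition property_P ::
  "'h itself \<Rightarrow> ('c, 'z1) star_algebra_scheme \<Rightarrow> ('d, 'c, 'f, 'z2) inner_bimodule_scheme \<Rightarrow> bool" where
  "property_P T C F \<longleftrightarrow>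
     (\<forall>(H :: 'h inner_module) \<pi>.
        pre_hilbert H \<and> star_representation C H \<pi> \<longrightarrow> psd_on_tensor_product C F H \<pi>)"

text \<open>The complex-conjugate bimodule has the same underlying set, with \<open>x\<close> standing for its
  conjugate.\<close>

definition conjugate_bimodule ::
  "('d, 'z1) star_algebra_scheme \<Rightarrow> ('c, 'z2) star_algebra_scheme \<Rightarrow>
   ('d, 'c, 'f) inner_bimodule \<Rightarrow> ('c, 'd, 'f) inner_bimodule" where
  "conjugate_bimodule D C F =
     \<lparr>carrier = carrier F, mult = undefined, one = undefined, zero = zero F, add = add F,
      smult = (\<lambda>z x. fps_cnj z \<odot>\<^bsub>F\<^esub> x),
      left_act = (\<lambda>c x. right_act F x (involution C c)),
      right_act = (\<lambda>x d. left_act F (involution D d) x),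
      left_ip = right_ip F, right_ip = left_ip F\<rparr>"

definition equivalence_bimodule ::
  "'h itself \<Rightarrow> ('d, 'z1) star_algebra_scheme \<Rightarrow> ('c, 'z2) star_algebra_scheme \<Rightarrow>
   ('d, 'c, 'f) inner_bimodule \<Rightarrow> bool" where
  "equivalence_bimodule T D C F \<longleftrightarrow>
     unital_star_algebra D \<and> unital_star_algebra C \<and>
     left_module D F (left_act F) \<and> right_module C F (right_act F) \<and>
     (\<forall>d\<in>carrier D. \<forall>x\<in>carrier F. \<forall>c\<in>carrier C.
        right_act F (left_act F d x) c = left_act F d (right_act F x c)) \<and>
     right_inner_product C F (right_act F) (right_ip F) \<and>
     left_inner_product D F (left_act F) (left_ip F) \<and>
     lin_span complex_series C {right_ip F x y | x y. x \<in> carrier F \<and> y \<in> carrier F} = carrier C \<and>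
     lin_span complex_series D {left_ip F x y | x y. x \<in> carrier F \<and> y \<in> carrier F} = carrier D \<and>
     (\<forall>x\<in>carrier F. \<forall>y\<in>carrier F. \<forall>d\<in>carrier D.
        right_ip F x (left_act F d y) = right_ip F (left_act F (involution D d) x) y) \<and>
     (\<forall>x\<in>carrier F. \<forall>y\<in>carrier F. \<forall>c\<in>carrier C.
        left_ip F x (right_act F y c) = left_ip F (right_act F x (involution C c)) y) \<and>
     (\<forall>x\<in>carrier F. \<forall>y\<in>carrier F. \<forall>z\<in>carrier F.
        left_act F (left_ip F x y) z = right_act F x (right_ip F y z)) \<and>
     property_P T C F \<and>
     property_P T D (conjugate_bimodule D C F)"

definition nondegenerate_bimodule ::
  "('d, 'z1) star_algebra_scheme \<Rightarrow> ('c, 'z2) star_algebra_scheme \<Rightarrow>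
   ('d, 'c, 'f) inner_bimodule \<Rightarrow> bool" where
  "nondegenerate_bimodule D C F \<longleftrightarrow>
     (\<forall>x\<in>carrier F. left_act F \<one>\<^bsub>D\<^esub> x = x \<and> right_act F x \<one>\<^bsub>C\<^esub> = x)"

text \<open>The bimodule is sought in the type \<^typ>\<open>'f\<close>; see the remark on \<^const>\<open>property_P\<close>
  for \<^typ>\<open>'h\<close>.\<close>

definition formally_Morita_equivalent ::
  "'f itself \<Rightarrow> 'h itself \<Rightarrow> ('d, 'z1) star_algebra_scheme \<Rightarrow> ('c, 'z2) star_algebra_scheme \<Rightarrow> bool" where
  "formally_Morita_equivalent S T D C \<longleftrightarrow>
     (\<exists>F :: ('d, 'c, 'f) inner_bimodule. equivalence_bimodule T D C F)"

section \<open>Poisson manifolds and Hermitian star-products\<close>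

definition smooth_functions ::
  "('m, 'e::euclidean_space) smooth_structure \<Rightarrow> (complex, 'm \<Rightarrow> complex) module" where
  "smooth_functions M =
     \<lparr>carrier = {f. smooth_map M UNIV f},
      mult = (\<lambda>f g p. f p * g p), one = (\<lambda>p. 1), zero = (\<lambda>p. 0), add = (\<lambda>f g p. f p + g p),
      smult = (\<lambda>c f p. c * f p)\<rparr>"

text \<open>The bracket is given on complex-valued functions; the last condition says that it is the
  complex-bilinear extension of a bracket on real-valued functions.\<close>

definition poisson_manifold ::
  "('m::{t2_space, second_countable_topology}, 'e::euclidean_space) smooth_structure \<Rightarrow>
   (('m \<Rightarrow> complex) \<Rightarrow> ('m \<Rightarrow> complex) \<Rightarrow> 'm \<Rightarrow> complex) \<Rightarrow> bool" where
  "poisson_manifold M P \<longleftrightarrow>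
     smooth_manifold M \<and>
     bilinear_map complex_field (smooth_functions M) (smooth_functions M) (smooth_functions M) P \<and>
     (\<forall>f\<in>carrier (smooth_functions M). \<forall>g\<in>carrier (smooth_functions M).
        P g f = (\<lambda>p. - P f g p)) \<and>
     (\<forall>f\<in>carrier (smooth_functions M). \<forall>g\<in>carrier (smooth_functions M).
      \<forall>k\<in>carrier (smooth_functions M).
        P f (\<lambda>p. g p * k p) = (\<lambda>p. P f g p * k p + g p * P f k p) \<and>
        (\<forall>p. P f (P g k) p + P g (P k f) p + P k (P f g) p = 0)) \<and>
     (\<forall>f\<in>carrier (smooth_functions M). \<forall>g\<in>carrier (smooth_functions M).
        (\<lambda>p. cnj (P f g p)) = P (\<lambda>p. cnj (f p)) (\<lambda>p. cnj (g p)))"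

definition star_product_algebra ::
  "('m, 'e::euclidean_space) smooth_structure \<Rightarrow>
   (nat \<Rightarrow> ('m \<Rightarrow> complex) \<Rightarrow> ('m \<Rightarrow> complex) \<Rightarrow> 'm \<Rightarrow> complex) \<Rightarrow>
   (('m \<Rightarrow> complex) fps) star_algebra" where
  "star_product_algebra M C =
     \<lparr>carrier = carrier (formal_module (smooth_functions M)),
      mult = formal_extension (smooth_functions M) C,
      one = Abs_fps (\<lambda>n. if n = 0 then \<one>\<^bsub>smooth_functions M\<^esub> else \<zero>\<^bsub>smooth_functions M\<^esub>),
      zero = zero (formal_module (smooth_functions M)),
      add = add (formal_module (smooth_functions M)),
      smult = smult (formal_module (smooth_functions M)),
      involution = (\<lambda>f. Abs_fps (\<lambda>n p. cnj (fps_nth f n p)))\<rparr>"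

definition hermitian_star_product ::
  "('m, 'e::euclidean_space) smooth_structure \<Rightarrow>
   (('m \<Rightarrow> complex) \<Rightarrow> ('m \<Rightarrow> complex) \<Rightarrow> 'm \<Rightarrow> complex) \<Rightarrow>
   (nat \<Rightarrow> ('m \<Rightarrow> complex) \<Rightarrow> ('m \<Rightarrow> complex) \<Rightarrow> 'm \<Rightarrow> complex) \<Rightarrow> bool" where
  "hermitian_star_product M P C \<longleftrightarrow>
     (let X = smooth_functions M; A = star_product_algebra M C in
       (\<forall>r. bilinear_map complex_field X X X (C r)) \<and>
       (\<forall>f\<in>carrier A. \<forall>g\<in>carrier A. \<forall>k\<in>carrier A. (f \<otimes>\<^bsub>A\<^esub> g) \<otimes>\<^bsub>A\<^esub> k = f \<otimes>\<^bsub>A\<^esub> (g \<otimes>\<^bsub>A\<^esub> k)) \<and>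
       (\<forall>f\<in>carrier X. \<forall>g\<in>carrier X. C 0 f g = f \<otimes>\<^bsub>X\<^esub> g) \<and>
       (\<forall>f\<in>carrier A. \<one>\<^bsub>A\<^esub> \<otimes>\<^bsub>A\<^esub> f = f \<and> f \<otimes>\<^bsub>A\<^esub> \<one>\<^bsub>A\<^esub> = f) \<and>
       (\<forall>f\<in>carrier X. \<forall>g\<in>carrier X. \<forall>p. (C 1 f g p - C 1 g f p) / \<i> = P f g p) \<and>
       (\<forall>f\<in>carrier A. \<forall>g\<in>carrier A.
          involution A (f \<otimes>\<^bsub>A\<^esub> g) = involution A g \<otimes>\<^bsub>A\<^esub> involution A f))"

section \<open>Hermitian vector bundles and their deformations\<close>

text \<open>A bundle is a family of complex vector spaces \<open>fibre E p\<close> with local trivialisations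
  \<open>(U, \<tau>)\<close>, where \<open>\<tau> p\<close> maps the fibre over \<open>p \<in> U\<close> onto \<open>\<complex>\<^sup>k\<close>; the transition functions
  determine the topology and smooth structure of the total space. The fiber dimension is
  \<open>CARD('k)\<close>, hence at least one.\<close>

record ('m, 'v, 'k) bundle_data =
  fibre :: "'m \<Rightarrow> (complex, 'v) module"
  trivialisations :: "('m set \<times> ('m \<Rightarrow> 'v \<Rightarrow> complex ^ 'k)) set"

definition vector_bundle ::
  "('m::topological_space, 'e::euclidean_space) smooth_structure \<Rightarrow> ('m, 'v, 'k::finite) bundle_data \<Rightarrow> bool" where
  "vector_bundle M E \<longleftrightarrow>
     (\<forall>p. Module.module complex_field (fibre E p)) \<and>
     (\<Union>(U, \<tau>)\<in>trivialisations E. U) = UNIV \<and>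
     (\<forall>(U, \<tau>)\<in>trivialisations E. open U \<and>
        (\<forall>p\<in>U. bij_betw (\<tau> p) (carrier (fibre E p)) UNIV \<and>
           (\<forall>v\<in>carrier (fibre E p). \<forall>w\<in>carrier (fibre E p).
              \<tau> p (v \<oplus>\<^bsub>fibre E p\<^esub> w) = \<tau> p v + \<tau> p w) \<and>
           (\<forall>c. \<forall>v\<in>carrier (fibre E p). \<tau> p (c \<odot>\<^bsub>fibre E p\<^esub> v) = c *s \<tau> p v))) \<and>
     (\<forall>(U, \<tau>)\<in>trivialisations E. \<forall>(U', \<tau>')\<in>trivialisations E. \<forall>z.
        smooth_map M (U \<inter> U') (\<lambda>p. \<tau>' p (inv_into (carrier (fibre E p)) (\<tau> p) z)))"

definition hermitian_vector_bundle ::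
  "('m::topological_space, 'e::euclidean_space) smooth_structure \<Rightarrow> ('m, 'v, 'k::finite) bundle_data \<Rightarrow>
   ('m \<Rightarrow> 'v \<Rightarrow> 'v \<Rightarrow> complex) \<Rightarrow> bool" where
  "hermitian_vector_bundle M E h0 \<longleftrightarrow>
     vector_bundle M E \<and>
     (\<forall>p. \<forall>v\<in>carrier (fibre E p). \<forall>w\<in>carrier (fibre E p).
        h0 p w v = cnj (h0 p v w) \<and>
        (\<forall>u\<in>carrier (fibre E p). h0 p v (w \<oplus>\<^bsub>fibre E p\<^esub> u) = h0 p v w + h0 p v u) \<and>
        (\<forall>c. h0 p v (c \<odot>\<^bsub>fibre E p\<^esub> w) = c * h0 p v w)) \<and>
     (\<forall>p. \<forall>v\<in>carrier (fibre E p). v \<noteq> \<zero>\<^bsub>fibre E p\<^esub> \<longrightarrow> h0 p v v \<in> \<real> \<and> Re (h0 p v v) > 0) \<and>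
     (\<forall>(U, \<tau>)\<in>trivialisations E. \<forall>z z'.
        smooth_map M U (\<lambda>p. h0 p (inv_into (carrier (fibre E p)) (\<tau> p) z)
                                (inv_into (carrier (fibre E p)) (\<tau> p) z')))"

definition smooth_sections ::
  "('m, 'e::euclidean_space) smooth_structure \<Rightarrow> ('m, 'v, 'k::finite) bundle_data \<Rightarrow>
   (complex, 'm \<Rightarrow> 'v) module" where
  "smooth_sections M E =
     \<lparr>carrier = {s. (\<forall>p. s p \<in> carrier (fibre E p)) \<and>
                    (\<forall>(U, \<tau>)\<in>trivialisations E. smooth_map M U (\<lambda>p. \<tau> p (s p)))},
      mult = undefined, one = undefined,
      zero = (\<lambda>p. \<zero>\<^bsub>fibre E p\<^esub>),
      add = (\<lambda>s t p. s p \<oplus>\<^bsub>fibre E p\<^esub> t p),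
      smult = (\<lambda>c s p. c \<odot>\<^bsub>fibre E p\<^esub> s p)\<rparr>"

definition formal_sections ::
  "('m, 'e::euclidean_space) smooth_structure \<Rightarrow> ('m, 'v, 'k::finite) bundle_data \<Rightarrow>
   (complex fps, ('m \<Rightarrow> 'v) fps) module" where
  "formal_sections M E = formal_module (smooth_sections M E)"

definition deformed_act ::
  "('m, 'e::euclidean_space) smooth_structure \<Rightarrow> ('m, 'v, 'k::finite) bundle_data \<Rightarrow>
   (nat \<Rightarrow> ('m \<Rightarrow> 'v) \<Rightarrow> ('m \<Rightarrow> complex) \<Rightarrow> 'm \<Rightarrow> 'v) \<Rightarrow>
   ('m \<Rightarrow> 'v) fps \<Rightarrow> ('m \<Rightarrow> complex) fps \<Rightarrow> ('m \<Rightarrow> 'v) fps" where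
  "deformed_act M E R = formal_extension (smooth_sections M E) R"

definition deformed_ip ::
  "('m, 'e::euclidean_space) smooth_structure \<Rightarrow>
   (nat \<Rightarrow> ('m \<Rightarrow> 'v) \<Rightarrow> ('m \<Rightarrow> 'v) \<Rightarrow> 'm \<Rightarrow> complex) \<Rightarrow>
   ('m \<Rightarrow> 'v) fps \<Rightarrow> ('m \<Rightarrow> 'v) fps \<Rightarrow> ('m \<Rightarrow> complex) fps" where
  "deformed_ip M h = formal_extension (smooth_functions M) h"

definition hermitian_deformation ::
  "('m, 'e::euclidean_space) smooth_structure \<Rightarrow>
   (nat \<Rightarrow> ('m \<Rightarrow> complex) \<Rightarrow> ('m \<Rightarrow> complex) \<Rightarrow> 'm \<Rightarrow> complex) \<Rightarrow>
   ('m, 'v, 'k::finite) bundle_data \<Rightarrow> ('m \<Rightarrow> 'v \<Rightarrow> 'v \<Rightarrow> complex) \<Rightarrow>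
   (nat \<Rightarrow> ('m \<Rightarrow> 'v) \<Rightarrow> ('m \<Rightarrow> complex) \<Rightarrow> 'm \<Rightarrow> 'v) \<Rightarrow>
   (nat \<Rightarrow> ('m \<Rightarrow> 'v) \<Rightarrow> ('m \<Rightarrow> 'v) \<Rightarrow> 'm \<Rightarrow> complex) \<Rightarrow> bool" where
  "hermitian_deformation M C E h0 R h \<longleftrightarrow>
     (let X = smooth_functions M; \<Gamma> = smooth_sections M E;
          A = star_product_algebra M C; \<Gamma>\<Lambda> = formal_sections M E in
       (\<forall>r. bilinear_map complex_field \<Gamma> X \<Gamma> (R r)) \<and>
       (\<forall>s\<in>carrier \<Gamma>. \<forall>f\<in>carrier X. R 0 s f = (\<lambda>p. f p \<odot>\<^bsub>fibre E p\<^esub> s p)) \<and>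
       right_module A \<Gamma>\<Lambda> (deformed_act M E R) \<and>
       (\<forall>r. \<forall>s\<in>carrier \<Gamma>. \<forall>t\<in>carrier \<Gamma>.
          linear_map complex_field \<Gamma> X (h r s) \<and>
          (\<forall>s'\<in>carrier \<Gamma>. h r (s \<oplus>\<^bsub>\<Gamma>\<^esub> s') t = h r s t \<oplus>\<^bsub>X\<^esub> h r s' t) \<and>
          (\<forall>c. h r (c \<odot>\<^bsub>\<Gamma>\<^esub> s) t = cnj c \<odot>\<^bsub>X\<^esub> h r s t)) \<and>
       (\<forall>s\<in>carrier \<Gamma>. \<forall>t\<in>carrier \<Gamma>. h 0 s t = (\<lambda>p. h0 p (s p) (t p))) \<and>
       right_inner_product A \<Gamma>\<Lambda> (deformed_act M E R) (deformed_ip M h) \<and>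
       (\<forall>x\<in>carrier \<Gamma>\<Lambda>. deformed_ip M h x x = \<zero>\<^bsub>A\<^esub> \<longrightarrow> x = \<zero>\<^bsub>\<Gamma>\<Lambda>\<^esub>))"

text \<open>The right-linear endomorphisms, as functions extensional on the carrier. That the
  adjoint exists is part of what \<^const>\<open>equivalence_bimodule\<close> asserts; it is unique
  for positive definite \<^term>\<open>ip\<close>.\<close>

definition endomorphism_algebra ::
  "('a, 'z1) star_algebra_scheme \<Rightarrow> (complex fps, 'x, 'z2) module_scheme \<Rightarrow>
   ('x \<Rightarrow> 'a \<Rightarrow> 'x) \<Rightarrow> ('x \<Rightarrow> 'x \<Rightarrow> 'a) \<Rightarrow> ('x \<Rightarrow> 'x) star_algebra" where
  "endomorphism_algebra A X act ip =
     (let L = {T \<in> carrier X \<rightarrow>\<^sub>E carrier X.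
                 (\<forall>x\<in>carrier X. \<forall>y\<in>carrier X. T (x \<oplus>\<^bsub>X\<^esub> y) = T x \<oplus>\<^bsub>X\<^esub> T y) \<and>
                 (\<forall>x\<in>carrier X. \<forall>a\<in>carrier A. T (act x a) = act (T x) a)}
      in \<lparr>carrier = L,
          mult = compose (carrier X),
          one = (\<lambda>x\<in>carrier X. x),
          zero = (\<lambda>x\<in>carrier X. \<zero>\<^bsub>X\<^esub>),
          add = (\<lambda>S T. \<lambda>x\<in>carrier X. S x \<oplus>\<^bsub>X\<^esub> T x),
          smult = (\<lambda>c T. \<lambda>x\<in>carrier X. c \<odot>\<^bsub>X\<^esub> T x),
          involution = (\<lambda>T. THE S. S \<in> L \<and>
             (\<forall>x\<in>carrier X. \<forall>y\<in>carrier X. ip x (T y) = ip (S x) y))\<rparr>)"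

definition deformed_endomorphisms ::
  "('m, 'e::euclidean_space) smooth_structure \<Rightarrow>
   (nat \<Rightarrow> ('m \<Rightarrow> complex) \<Rightarrow> ('m \<Rightarrow> complex) \<Rightarrow> 'm \<Rightarrow> complex) \<Rightarrow>
   ('m, 'v, 'k::finite) bundle_data \<Rightarrow>
   (nat \<Rightarrow> ('m \<Rightarrow> 'v) \<Rightarrow> ('m \<Rightarrow> complex) \<Rightarrow> 'm \<Rightarrow> 'v) \<Rightarrow>
   (nat \<Rightarrow> ('m \<Rightarrow> 'v) \<Rightarrow> ('m \<Rightarrow> 'v) \<Rightarrow> 'm \<Rightarrow> complex) \<Rightarrow>
   (('m \<Rightarrow> 'v) fps \<Rightarrow> ('m \<Rightarrow> 'v) fps) star_algebra" where
  "deformed_endomorphisms M C E R h =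
     endomorphism_algebra (star_product_algebra M C) (formal_sections M E)
       (deformed_act M E R) (deformed_ip M h)"

definition deformed_bimodule ::
  "('m, 'e::euclidean_space) smooth_structure \<Rightarrow> ('m, 'v, 'k::finite) bundle_data \<Rightarrow>
   (nat \<Rightarrow> ('m \<Rightarrow> 'v) \<Rightarrow> ('m \<Rightarrow> complex) \<Rightarrow> 'm \<Rightarrow> 'v) \<Rightarrow>
   (nat \<Rightarrow> ('m \<Rightarrow> 'v) \<Rightarrow> ('m \<Rightarrow> 'v) \<Rightarrow> 'm \<Rightarrow> complex) \<Rightarrow>
   (('m \<Rightarrow> 'v) fps \<Rightarrow> ('m \<Rightarrow> 'v) fps, ('m \<Rightarrow> complex) fps, ('m \<Rightarrow> 'v) fps) inner_bimodule" where
  "deformed_bimodule M E R h =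
     (let X = formal_sections M E in
      \<lparr>carrier = carrier X, mult = undefined, one = undefined, zero = zero X, add = add X,
       smult = smult X,
       left_act = (\<lambda>T x. T x),
       right_act = deformed_act M E R,
       left_ip = (\<lambda>x y. \<lambda>z\<in>carrier X. deformed_act M E R x (deformed_ip M h y z)),
       right_ip = deformed_ip M h\<rparr>)"

end

theory Submission
  imports Defs
begin

text \<open>Everything follows from two finite families in the deformed module: \<open>x\<^sub>i\<close> with
  \<open>\<Sum>\<^sub>i x\<^sub>i \<bullet> h(x\<^sub>i, z) = z\<close> for all \<open>z\<close> (a Parseval frame), and \<open>y\<^sub>k\<close> with
  \<open>\<Sum>\<^sub>k h(y\<^sub>k, y\<^sub>k) = 1\<close>. The first one provides adjoints and the fullness of \<open>\<Theta>\<close>, the second one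
  the fullness of \<open>h\<close>, and the identities \<open>h(x, y) = \<Sum>\<^sub>i h(x\<^sub>i, x)\<^sup>* \<star> h(x\<^sub>i, y)\<close> and
  \<open>\<Theta>(x, y) = \<Sum>\<^sub>k \<Theta>(y\<^sub>k, x)\<^sup>* \<Theta>(y\<^sub>k, y)\<close> turn the forms in (P) and (Q) into sums of squares.

  A classical frame is \<open>\<lambda>\<close>-adically close to a deformed one: if \<open>L = \<Sum>\<^sub>i x\<^sub>i \<bullet> h(x\<^sub>i, \<cdot>)\<close> is
  \<open>1\<close> up to order \<open>n\<close>, then the family \<open>(3 - L) x\<^sub>i / 2\<close> is a Parseval frame up to order \<open>2n\<close>, and
  the iteration converges. The \<open>y\<^sub>k\<close> are treated in the same way.

  A classical Parseval frame exists on every, possibly non-compact, manifold: a generic choice of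
  coefficients, made chart after chart along a locally finite family of bump functions, yields
  finitely many sections that span every fibre. Choosing bases among them gives a finite cover by
  open sets with frames, which are orthonormalised and glued with a partition of unity.\<close>

section \<open>Smooth functions on relatively open sets\<close>

text \<open>Positivity of h(x, x) concerns single elements, whereas (P) and (Q) concern all finite
  combinations in every representation, over an ordered ring without spectral calculus. Hence exact
  identities are needed: a family that is a frame only modulo a power of \<lambda> leaves error
  terms of unknown sign.

  Repairing a family is a search for L^(-1/2). It succeeds because L commutes with the right action
  and is self-adjoint for h. The same then holds for Q = (3 - L) / 2, and replacing every x_i by Q
  x_i turns L into Q L Q.

  In order zero the difficulty is to keep the number of sections finite while infinitely many charts
  are treated. The number is fixed beforehand as d + 2k + 1, where d is \<open>DIM('e)\<close> and k
  the fibre dimension: a point and a real covector of the fibre have d + 2k parameters in all, one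
  fewer than the vectors chosen generically have coordinates. The dimension k returns as the
  constant value of the sum of h0(x_i, x_i) over the classical frame; dividing by its root, possible
  as k is at least one, gives the zeroth order of the y_k.\<close>

lemma eventually_line_in_openin:
  fixes V :: "'e::euclidean_space set"
  assumes "openin (top_of_set (span B)) V" "b \<in> B" "x \<in> V"
  shows "\<forall>\<^sub>F t in nhds (0::real). x + t *\<^sub>R b \<in> V"
proof -
  obtain T where T: "open T" "V = span B \<inter> T"
    using assms(1) by (auto simp: openin_open)
  have "((\<lambda>t::real. x + t *\<^sub>R b) \<longlongrightarrow> x + 0 *\<^sub>R b) (nhds 0)"
    using tendsto_at_iff_tendsto_nhds[of "\<lambda>t::real. x + t *\<^sub>R b" 0]
    by (auto intro!: tendsto_eq_intros)
  then have "\<forall>\<^sub>F t::real in nhds 0. x + t *\<^sub>R b \<in> T"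
    using T assms(3) by (auto intro: topological_tendstoD)
  then show ?thesis
    by (rule eventually_mono) (use T assms in \<open>auto intro: span_add span_mul span_base\<close>)
qed

lemma Ck_on_SucD: "Ck_on (Suc k) B V f \<Longrightarrow> Ck_on k B V f"
proof (induction k arbitrary: f)
  case (Suc k)
  have "\<exists>g. (\<forall>x\<in>V. ((\<lambda>t. f (x + t *\<^sub>R b)) has_vector_derivative g x) (at 0)) \<and> Ck_on k B V g"
    if "b \<in> B" for b
    using Suc.prems that Suc.IH unfolding Ck_on.simps(2)[of "Suc k"] by blast
  then show ?case using Suc.prems by simp
qed simp

lemma Ck_on_continuous: "Ck_on k B V f \<Longrightarrow> continuous_on V f"
  by (cases k) auto

lemma Ck_on_subset: "Ck_on k B V f \<Longrightarrow> V' \<subseteq> V \<Longrightarrow> Ck_on k B V' f"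
proof (induction k arbitrary: f)
  case (Suc k)
  then show ?case
    by (simp, meson continuous_on_subset subset_iff)
qed (auto intro: continuous_on_subset)

text \<open>Derivatives in \<open>Ck_on\<close> are full limits along a line, not limits within V,
  and V is open only relative to \<open>span B\<close>. Since b lies in that span, the line stays in
  V for small t, so values off V do not matter.\<close>

lemma has_vector_derivative_line_cong:
  fixes V :: "'e::euclidean_space set"
  assumes "openin (top_of_set (span B)) V" "b \<in> B" "x \<in> V" "\<And>y. y \<in> V \<Longrightarrow> f y = g y"
  shows "((\<lambda>t. f (x + t *\<^sub>R b)) has_vector_derivative d) (at 0) \<longleftrightarrow>
         ((\<lambda>t. g (x + t *\<^sub>R b)) has_vector_derivative d) (at 0)"
  using eventually_line_in_openin[OF assms(1-3)] assms(3,4)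
  by (intro has_vector_derivative_cong_ev) (auto elim!: eventually_mono)

lemma Ck_on_cong:
  assumes "openin (top_of_set (span B)) V" "\<And>x. x \<in> V \<Longrightarrow> f x = g x"
  shows "Ck_on k B V f \<longleftrightarrow> Ck_on k B V g"
proof -
  have "continuous_on V f = continuous_on V g"
    using assms(2) by (rule continuous_on_cong[OF refl])
  moreover have "(\<forall>x\<in>V. ((\<lambda>t. f (x + t *\<^sub>R b)) has_vector_derivative d x) (at 0)) \<longleftrightarrow>
      (\<forall>x\<in>V. ((\<lambda>t. g (x + t *\<^sub>R b)) has_vector_derivative d x) (at 0))" if "b \<in> B" for b d
    by (intro ball_cong refl has_vector_derivative_line_cong[OF assms(1) that] assms(2))
  ultimately show ?thesis by (cases k) simp_all
qed

lemma Ck_on_const: "Ck_on k B V (\<lambda>x. c)"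
proof (induction k arbitrary: c)
  case (Suc k)
  then show ?case by (auto intro!: exI[of _ "\<lambda>_. 0"] derivative_eq_intros)
qed auto

lemma Ck_on_add:
  "Ck_on k B V f \<Longrightarrow> Ck_on k B V g \<Longrightarrow> Ck_on k B V (\<lambda>x. f x + g x)"
proof (induction k arbitrary: f g)
  case (Suc k)
  show ?case
    unfolding Ck_on.simps
  proof (intro conjI ballI)
    show "continuous_on V (\<lambda>x. f x + g x)" using Suc.prems by (auto intro: continuous_intros)
    fix b assume "b \<in> B"
    with Suc.prems obtain f' g' where
      "\<forall>x\<in>V. ((\<lambda>t. f (x + t *\<^sub>R b)) has_vector_derivative f' x) (at 0)" "Ck_on k B V f'"
      "\<forall>x\<in>V. ((\<lambda>t. g (x + t *\<^sub>R b)) has_vector_derivative g' x) (at 0)" "Ck_on k B V g'"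
      by (metis Ck_on.simps(2))
    then show "\<exists>h. (\<forall>x\<in>V. ((\<lambda>t. f (x + t *\<^sub>R b) + g (x + t *\<^sub>R b)) has_vector_derivative h x) (at 0))
                 \<and> Ck_on k B V h"
      by (intro exI[of _ "\<lambda>x. f' x + g' x"]) (auto intro: has_vector_derivative_add Suc.IH)
  qed
qed (auto intro: continuous_intros)

text \<open>One Leibniz rule for all products that occur later: multiplication in an algebra, real
  and complex scaling, inner products.\<close>

lemma Ck_on_bilinear:
  assumes "bounded_bilinear pr"
  shows "Ck_on k B V f \<Longrightarrow> Ck_on k B V g \<Longrightarrow> Ck_on k B V (\<lambda>x. pr (f x) (g x))"
proof (induction k arbitrary: f g)
  case 0
  then show ?case using bounded_bilinear.continuous_on[OF assms] by auto
next
  case (Suc k)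
  interpret bounded_bilinear pr by fact
  show ?case
    unfolding Ck_on.simps
  proof (intro conjI ballI)
    show "continuous_on V (\<lambda>x. pr (f x) (g x))" using Suc.prems by (auto intro: continuous_on)
    fix b assume "b \<in> B"
    with Suc.prems obtain f' g' where *:
      "\<forall>x\<in>V. ((\<lambda>t. f (x + t *\<^sub>R b)) has_vector_derivative f' x) (at 0)" "Ck_on k B V f'"
      "\<forall>x\<in>V. ((\<lambda>t. g (x + t *\<^sub>R b)) has_vector_derivative g' x) (at 0)" "Ck_on k B V g'"
      by (metis Ck_on.simps(2))
    have "\<forall>x\<in>V. ((\<lambda>t. pr (f (x + t *\<^sub>R b)) (g (x + t *\<^sub>R b)))
        has_vector_derivative (pr (f x) (g' x) + pr (f' x) (g x))) (at 0)"
    proof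
      fix x assume "x \<in> V"
      then show "((\<lambda>t. pr (f (x + t *\<^sub>R b)) (g (x + t *\<^sub>R b)))
        has_vector_derivative (pr (f x) (g' x) + pr (f' x) (g x))) (at 0)"
        using has_vector_derivative[of "\<lambda>t. f (x + t *\<^sub>R b)" "f' x" 0 UNIV "\<lambda>t. g (x + t *\<^sub>R b)" "g' x"] *
        by simp
    qed
    moreover have "Ck_on k B V (\<lambda>x. pr (f x) (g' x) + pr (f' x) (g x))"
      using Ck_on_SucD[OF Suc.prems(1)] Ck_on_SucD[OF Suc.prems(2)] * by (intro Ck_on_add Suc.IH)
    ultimately show "\<exists>h. (\<forall>x\<in>V. ((\<lambda>t. pr (f (x + t *\<^sub>R b)) (g (x + t *\<^sub>R b)))
        has_vector_derivative h x) (at 0)) \<and> Ck_on k B V h"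
      by (intro exI conjI)
  qed
qed

text \<open>A bounded linear map is a scaled one with the constant scalar 1, so the bilinear case
  applies.\<close>

lemma Ck_on_linear:
  assumes "bounded_linear L" "Ck_on k B V f"
  shows "Ck_on k B V (\<lambda>x. L (f x))"
proof -
  have "bounded_bilinear (\<lambda>(c::real) x. c *\<^sub>R L x)"
    using bounded_bilinear.comp[OF bounded_bilinear_scaleR bounded_linear_ident assms(1)] .
  from Ck_on_bilinear[OF this Ck_on_const[of k B V 1] assms(2)] show ?thesis by simp
qed

text \<open>Each neighbourhood supplies its own partial derivatives. Derivatives along a line are
  unique, so all of them are restrictions of \<open>vector_derivative\<close>, and the induction
  hypothesis applies to that one function.\<close>

lemma Ck_on_local:
  assumes "openin (top_of_set (span B)) V"
    and "\<And>x. x \<in> V \<Longrightarrow> \<exists>T. open T \<and> x \<in> T \<and> Ck_on k B (V \<inter> T) f"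
  shows "Ck_on k B V f"
  using assms(2)
proof (induction k arbitrary: f)
  case 0
  show ?case
    unfolding Ck_on.simps continuous_on_eq_continuous_within
  proof
    fix x assume "x \<in> V"
    then obtain T where T: "open T" "x \<in> T" "continuous_on (V \<inter> T) f" using 0 by auto
    then have "continuous (at x within (V \<inter> T)) f"
      using \<open>x \<in> V\<close> by (auto simp: continuous_on_eq_continuous_within)
    moreover have "at x within (V \<inter> T) = at x within V"
      by (rule at_within_nhd[OF T(2,1)]) auto
    ultimately show "continuous (at x within V) f" by simp
  qed
next
  case (Suc k)
  have cont: "continuous_on V f"
    unfolding continuous_on_eq_continuous_within
  proof
    fix x assume "x \<in> V"
    from Suc.prems[OF this] obtain T where T: "open T" "x \<in> T" "Ck_on (Suc k) B (V \<inter> T) f"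
      by blast
    then have "continuous (at x within (V \<inter> T)) f"
      using \<open>x \<in> V\<close> Ck_on_continuous[OF T(3)] by (auto simp: continuous_on_eq_continuous_within)
    moreover have "at x within (V \<inter> T) = at x within V"
      by (rule at_within_nhd[OF T(2,1)]) auto
    ultimately show "continuous (at x within V) f" by simp
  qed
  show ?case
    unfolding Ck_on.simps
  proof (intro conjI ballI cont)
    fix b assume b: "b \<in> B"
    define D where "D x = vector_derivative (\<lambda>t. f (x + t *\<^sub>R b)) (at 0)" for x
    have loc: "\<exists>T. open T \<and> x \<in> T \<and> Ck_on k B (V \<inter> T) D \<and>
        ((\<lambda>t. f (x + t *\<^sub>R b)) has_vector_derivative D x) (at 0)" if x: "x \<in> V" for x
    proof -
      obtain T where T: "open T" "x \<in> T" "Ck_on (Suc k) B (V \<inter> T) f" using Suc.prems x by blast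
      with b obtain g where g: "\<forall>x\<in>V \<inter> T. ((\<lambda>t. f (x + t *\<^sub>R b)) has_vector_derivative g x) (at 0)"
          "Ck_on k B (V \<inter> T) g" by auto
      have gD: "g y = D y" if "y \<in> V \<inter> T" for y
        unfolding D_def using g(1) that by (metis vector_derivative_at)
      have "openin (top_of_set (span B)) (V \<inter> T)"
        using assms(1) T(1) by (metis openin_Int_open)
      then have "Ck_on k B (V \<inter> T) D" using Ck_on_cong[of B "V \<inter> T" g D k] gD g(2) by simp
      then show ?thesis using T x g(1) gD by (metis IntI)
    qed
    then have "Ck_on k B V D" by (intro Suc.IH) blast
    then show "\<exists>g. (\<forall>x\<in>V. ((\<lambda>t. f (x + t *\<^sub>R b)) has_vector_derivative g x) (at 0)) \<and> Ck_on k B V g"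
      using loc by blast
  qed
qed

text \<open>The outer function comes with the whole sequence of its derivatives. The chain rule
  turns \<open>d n\<close> into \<open>d (Suc n)\<close>, so the induction on k needs n arbitrary.
  The instances are exp(-1/x) and x^(-1/2).\<close>

lemma Ck_on_compose_real:
  fixes d :: "nat \<Rightarrow> real \<Rightarrow> real"
  assumes d: "\<And>n x. x \<in> S \<Longrightarrow> (d n has_real_derivative d (Suc n) x) (at x)" and S: "f ` V \<subseteq> S"
  shows "Ck_on k B V f \<Longrightarrow> Ck_on k B V (\<lambda>x. d n (f x))"
proof (induction k arbitrary: n)
  case 0
  have "continuous_on S (d n)"
    by (meson DERIV_isCont continuous_at_imp_continuous_on d)
  then show ?case using 0 S by (auto intro: continuous_on_compose2)
next
  case (Suc k)
  have cont: "continuous_on S (d n)"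
    by (meson DERIV_isCont continuous_at_imp_continuous_on d)
  show ?case
    unfolding Ck_on.simps
  proof (intro conjI ballI)
    show "continuous_on V (\<lambda>x. d n (f x))"
      using Suc.prems S cont by (auto intro: continuous_on_compose2)
    fix b assume "b \<in> B"
    with Suc.prems obtain f' where *:
      "\<forall>x\<in>V. ((\<lambda>t. f (x + t *\<^sub>R b)) has_vector_derivative f' x) (at 0)" "Ck_on k B V f'"
      by (metis Ck_on.simps(2))
    have "((\<lambda>t. d n (f (x + t *\<^sub>R b))) has_vector_derivative (d (Suc n) (f x) * f' x)) (at 0)"
      if "x \<in> V" for x
    proof -
      have 1: "((\<lambda>t. f (x + t *\<^sub>R b)) has_real_derivative f' x) (at 0)"
        using * that by (simp add: has_real_derivative_iff_has_vector_derivative)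
      have 2: "(d n has_real_derivative d (Suc n) (f x)) (at (f (x + 0 *\<^sub>R b)))"
        using d[of "f x" n] S that by auto
      show ?thesis
        using DERIV_chain2[OF 2 1] by (simp add: has_real_derivative_iff_has_vector_derivative)
    qed
    moreover have "Ck_on k B V (\<lambda>x. d (Suc n) (f x) * f' x)"
      using Suc.IH[OF Ck_on_SucD[OF Suc.prems], of "Suc n"] *
      by (intro Ck_on_bilinear[OF bounded_bilinear_mult])
    ultimately show "\<exists>h. (\<forall>x\<in>V. ((\<lambda>t. d n (f (x + t *\<^sub>R b))) has_vector_derivative h x) (at 0))
        \<and> Ck_on k B V h" by (intro exI[of _ "\<lambda>x. d (Suc n) (f x) * f' x"]) simp
  qed
qed

text \<open>Moving along one coordinate at a time.\<close>

lemma telescope_bound: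
  fixes g :: "'e::euclidean_space \<Rightarrow> 'b::real_normed_vector"
  assumes "finite F" "F \<subseteq> B"
    and der: "\<And>z b. z \<in> V \<Longrightarrow> b \<in> B \<Longrightarrow>
      \<exists>g'. ((\<lambda>t. g (z + t *\<^sub>R b)) has_vector_derivative g') (at 0) \<and> norm g' \<le> e"
    and in_V: "\<And>u. (\<And>b. \<bar>u b\<bar> \<le> \<bar>s b\<bar>) \<Longrightarrow> x + (\<Sum>b\<in>F. u b *\<^sub>R b) \<in> V"
  shows "norm (g (x + (\<Sum>b\<in>F. s b *\<^sub>R b)) - g x) \<le> e * (\<Sum>b\<in>F. \<bar>s b\<bar>)"
  using assms(1,2) in_V
proof (induction F rule: finite_induct)
  case (insert c F)
  define y where "y = x + (\<Sum>b\<in>F. s b *\<^sub>R b)"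
  have c: "c \<in> B" and F: "F \<subseteq> B" using insert.prems by auto
  have IH: "norm (g y - g x) \<le> e * (\<Sum>b\<in>F. \<bar>s b\<bar>)"
    unfolding y_def
  proof (rule insert.IH[OF F])
    fix u assume u: "\<And>b. \<bar>u b\<bar> \<le> \<bar>s b\<bar>"
    \<comment> \<open>A displacement along F is one along \<open>insert c F\<close> whose
      coefficient at c is 0, so the bound on the coefficients is kept.\<close>
    have "x + (\<Sum>b\<in>insert c F. (u(c := 0)) b *\<^sub>R b) \<in> V"
      by (rule insert.prems(2)) (use u in auto)
    moreover have "(\<Sum>b\<in>F. (u(c := 0)) b *\<^sub>R b) = (\<Sum>b\<in>F. u b *\<^sub>R b)"
      using insert.hyps by (intro sum.cong) auto
    ultimately show "x + (\<Sum>b\<in>F. u b *\<^sub>R b) \<in> V" using insert.hyps by simp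
  qed
  have seg: "y + r *\<^sub>R c \<in> V" if "r \<in> closed_segment 0 (s c)" for r
  proof -
    have "\<bar>r\<bar> \<le> \<bar>s c\<bar>" using that by (auto simp: closed_segment_eq_real_ivl split: if_splits)
    then have "x + (\<Sum>b\<in>insert c F. (s(c := r)) b *\<^sub>R b) \<in> V"
      by (intro insert.prems(2)) auto
    moreover have "(\<Sum>b\<in>F. (s(c := r)) b *\<^sub>R b) = (\<Sum>b\<in>F. s b *\<^sub>R b)"
      using insert.hyps by (intro sum.cong) auto
    ultimately show ?thesis using insert.hyps by (simp add: y_def algebra_simps)
  qed
  have "\<exists>g'. ((\<lambda>t. g (y + t *\<^sub>R c)) has_vector_derivative g') (at r) \<and> norm g' \<le> e"
    if r: "r \<in> closed_segment 0 (s c)" for r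
  proof -
    obtain g' where g': "((\<lambda>t. g (y + r *\<^sub>R c + t *\<^sub>R c)) has_vector_derivative g') (at 0)" "norm g' \<le> e"
      using der[OF seg[OF r] c] by blast
    have "((\<lambda>t. g (y + r *\<^sub>R c + t *\<^sub>R c)) \<circ> (\<lambda>t. t - r) has_vector_derivative 1 *\<^sub>R g') (at r)"
      by (rule vector_diff_chain_at) (use g' in \<open>auto intro!: derivative_eq_intros\<close>)
    then show ?thesis using g'(2) by (auto simp: o_def algebra_simps)
  qed
  then obtain G where G: "\<And>r. r \<in> closed_segment 0 (s c) \<Longrightarrow>
      ((\<lambda>t. g (y + t *\<^sub>R c)) has_vector_derivative G r) (at r)"
    "\<And>r. r \<in> closed_segment 0 (s c) \<Longrightarrow> norm (G r) \<le> e" by metis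
  have "norm (g (y + s c *\<^sub>R c) - g (y + 0 *\<^sub>R c)) \<le> e * norm (s c - 0)"
  proof (rule differentiable_bound[of "closed_segment 0 (s c)" "\<lambda>t. g (y + t *\<^sub>R c)" "\<lambda>r h. h *\<^sub>R G r"])
    fix r assume "r \<in> closed_segment 0 (s c)"
    with G show "((\<lambda>t. g (y + t *\<^sub>R c)) has_derivative (\<lambda>h. h *\<^sub>R G r)) (at r within closed_segment 0 (s c))"
      by (metis has_vector_derivative_at_within has_vector_derivative_def)
    show "onorm (\<lambda>h. h *\<^sub>R G r) \<le> e"
      using G(2)[OF \<open>r \<in> _\<close>] by (intro onorm_le) (simp add: mult.commute[of e] mult_left_mono)
  qed auto
  then have "norm (g (y + s c *\<^sub>R c) - g y) \<le> e * \<bar>s c\<bar>" by simp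
  with IH have "norm (g (y + s c *\<^sub>R c) - g x) \<le> e * \<bar>s c\<bar> + e * (\<Sum>b\<in>F. \<bar>s b\<bar>)"
    by (smt (verit) norm_triangle_ineq diff_add_cancel add_diff_eq)
  moreover have "x + (\<Sum>b\<in>insert c F. s b *\<^sub>R b) = y + s c *\<^sub>R c"
    using insert.hyps by (simp add: y_def algebra_simps)
  moreover have "(\<Sum>b\<in>insert c F. \<bar>s b\<bar>) = \<bar>s c\<bar> + (\<Sum>b\<in>F. \<bar>s b\<bar>)"
    using insert.hyps by simp
  ultimately show ?case by (simp only: distrib_left)
qed simp

text \<open>The theorem on negligible images used below needs a total derivative within V, a set
  that may have lower dimension than \<open>'e\<close>, while \<open>Ck_on\<close> only gives
  partial ones. Subtracting the candidate derivative L leaves a function whose partial derivatives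
  are \<open>D b z - D b x\<close>, small near x by continuity, and the coordinatewise bound applies
  to it.\<close>

lemma Ck_on_differentiable:
  fixes f :: "'e::euclidean_space \<Rightarrow> 'b::real_normed_vector"
  assumes B: "B \<subseteq> Basis" and V: "openin (top_of_set (span B)) V" and f: "Ck_on 1 B V f"
  shows "f differentiable_on V"
  unfolding differentiable_on_def
proof
  fix x assume x: "x \<in> V"
  have finB: "finite B" by (rule finite_subset[OF B finite_Basis])
  obtain D where D: "\<And>b z. b \<in> B \<Longrightarrow> z \<in> V \<Longrightarrow>
      ((\<lambda>t. f (z + t *\<^sub>R b)) has_vector_derivative D b z) (at 0)"
    and Dc: "\<And>b. b \<in> B \<Longrightarrow> continuous_on V (D b)"
  proof -
    from f have "\<forall>b\<in>B. \<exists>g. (\<forall>x\<in>V. ((\<lambda>t. f (x + t *\<^sub>R b)) has_vector_derivative g x) (at 0)) \<and> continuous_on V g"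
      by simp
    from bchoice[OF this] obtain D where "\<forall>b\<in>B. (\<forall>x\<in>V. ((\<lambda>t. f (x + t *\<^sub>R b)) has_vector_derivative D b x) (at 0))
        \<and> continuous_on V (D b)" ..
    then show ?thesis by (intro that) blast+
  qed
  define L where "L = (\<lambda>h. \<Sum>b\<in>B. (h \<bullet> b) *\<^sub>R D b x)"
  have L: "bounded_linear L" unfolding L_def
    by (rule bounded_linear_sum, rule bounded_linear_compose[OF bounded_linear_scaleR_left bounded_linear_inner_left])
  have Lb: "L b = D b x" if "b \<in> B" for b
  proof -
    have "L b = (\<Sum>c\<in>B. if c = b then D b x else 0)"
      unfolding L_def using that B
      by (intro sum.cong refl) (auto simp: inner_Basis subset_iff split: if_splits)
    then show ?thesis using that finB by simp
  qed
  obtain T where T: "open T" "V = span B \<inter> T" using V by (auto simp: openin_open)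
  have "(f has_derivative L) (at x within V)"
    unfolding has_derivative_within_alt
  proof (intro conjI allI impI L)
    fix e :: real assume e: "e > 0"
    \<comment> \<open>The sum of |s b| over B is at most n times the distance of y from x. So the
      radius d / n keeps all partial displacements within d of x, and the error e / n per derivative
      adds up to e. The summand 1 keeps n positive in dimension zero.\<close>
    define n where "n = real (card B) + 1"
    have n: "n > 0" by (simp add: n_def)
    have "\<forall>b\<in>B. \<exists>d>0. \<forall>z\<in>V. dist z x < d \<longrightarrow> norm (D b z - D b x) < e / n"
    proof
      fix b assume "b \<in> B"
      from Dc[OF this] x have "\<forall>e>0. \<exists>d>0. \<forall>z\<in>V. dist z x < d \<longrightarrow> norm (D b z - D b x) < e"
        unfolding continuous_on_iff dist_norm by blast
      then show "\<exists>d>0. \<forall>z\<in>V. dist z x < d \<longrightarrow> norm (D b z - D b x) < e / n"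
        using e n by simp
    qed
    from bchoice[OF this] obtain \<delta> where \<delta>: "\<And>b. b \<in> B \<Longrightarrow> \<delta> b > 0"
      "\<And>b z. b \<in> B \<Longrightarrow> z \<in> V \<Longrightarrow> dist z x < \<delta> b \<Longrightarrow> norm (D b z - D b x) < e / n"
      by blast
    obtain r where r: "r > 0" "ball x r \<subseteq> T" using T x open_contains_ball by blast
    define d where "d = Min (insert r (\<delta> ` B))"
    have d: "d > 0" unfolding d_def using finB \<delta> r by (subst Min_gr_iff) auto
    have dr: "d \<le> r" "\<And>b. b \<in> B \<Longrightarrow> d \<le> \<delta> b" unfolding d_def using finB by auto
    define V' where "V' = V \<inter> ball x d"
    define g where "g y = f y - L y" for y
    have "norm (f y - f x - L (y - x)) \<le> e * norm (y - x)" if y: "y \<in> V" "norm (y - x) < d / n" for y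
    proof -
      define s where "s b = (y - x) \<bullet> b" for b
      have sb: "\<bar>s b\<bar> \<le> norm (y - x)" if "b \<in> B" for b
        unfolding s_def using that B by (meson Basis_le_norm subsetD)
      have ssum: "(\<Sum>b\<in>B. \<bar>s b\<bar>) \<le> n * norm (y - x)"
      proof -
        have "(\<Sum>b\<in>B. \<bar>s b\<bar>) \<le> (\<Sum>b\<in>B. norm (y - x))" by (intro sum_mono sb)
        also have "\<dots> \<le> n * norm (y - x)" by (simp add: n_def distrib_right)
        finally show ?thesis .
      qed
      have "y - x \<in> span B" using y x T by (auto intro: span_diff)
      then have repr: "(\<Sum>b\<in>B. s b *\<^sub>R b) = y - x"
      proof -
        have "y - x = (\<Sum>b\<in>Basis. s b *\<^sub>R b)" by (simp add: s_def euclidean_representation)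
        also have "\<dots> = (\<Sum>b\<in>B. s b *\<^sub>R b)"
        proof (rule sum.mono_neutral_right[OF finite_Basis B], intro ballI)
          fix b assume b: "b \<in> Basis - B"
          have "orthogonal b (y - x)"
            by (rule orthogonal_to_span[OF \<open>y - x \<in> span B\<close>])
               (use b B in \<open>auto simp: orthogonal_def inner_Basis\<close>)
          then show "s b *\<^sub>R b = 0" by (simp add: s_def orthogonal_def inner_commute)
        qed
        finally show ?thesis ..
      qed
      have "norm (g (x + (\<Sum>b\<in>B. s b *\<^sub>R b)) - g x) \<le> e / n * (\<Sum>b\<in>B. \<bar>s b\<bar>)"
      proof (rule telescope_bound[of B B V'])
        fix z b assume z: "z \<in> V'" "b \<in> B"
        have "((\<lambda>t. f (z + t *\<^sub>R b) - (L z + t *\<^sub>R L b)) has_vector_derivative (D b z - (0 + 1 *\<^sub>R L b))) (at 0)"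
        proof (rule has_vector_derivative_diff)
          show "((\<lambda>t. f (z + t *\<^sub>R b)) has_vector_derivative D b z) (at 0)"
            using D[of b z] z by (simp add: V'_def)
          show "((\<lambda>t. L z + t *\<^sub>R L b) has_vector_derivative (0 + 1 *\<^sub>R L b)) (at 0)"
            by (auto intro!: derivative_eq_intros)
        qed
        moreover have "(\<lambda>t. g (z + t *\<^sub>R b)) = (\<lambda>t. f (z + t *\<^sub>R b) - (L z + t *\<^sub>R L b))"
          by (simp add: g_def linear_simps[OF L])
        moreover have "norm (D b z - D b x) \<le> e / n"
          using \<delta>(2)[of b z] z dr(2)[of b] by (simp add: V'_def dist_commute)
        ultimately show "\<exists>g'. ((\<lambda>t. g (z + t *\<^sub>R b)) has_vector_derivative g') (at 0) \<and> norm g' \<le> e / n"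
          using Lb z by auto
      next
        fix u assume u: "\<And>b. \<bar>u b\<bar> \<le> \<bar>s b\<bar>"
        have "norm (\<Sum>b\<in>B. u b *\<^sub>R b) \<le> (\<Sum>b\<in>B. \<bar>s b\<bar>)"
          by (rule sum_norm_le) (use u B in auto)
        also have "\<dots> < d" using ssum y(2) n by (simp add: field_simps)
        finally have lt: "norm (\<Sum>b\<in>B. u b *\<^sub>R b) < d" .
        have "x + (\<Sum>b\<in>B. u b *\<^sub>R b) \<in> span B"
          using x T(2) by (intro span_add span_sum span_mul) (auto intro: span_base)
        moreover have "x + (\<Sum>b\<in>B. u b *\<^sub>R b) \<in> ball x d" using lt by (simp add: dist_norm)
        ultimately show "x + (\<Sum>b\<in>B. u b *\<^sub>R b) \<in> V'"
          using T(2) r(2) subset_ball[OF dr(1), of x] by (auto simp: V'_def)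
      qed (use finB in auto)
      also have "\<dots> \<le> e / n * (n * norm (y - x))"
        using e n ssum by (intro mult_left_mono) auto
      also have "\<dots> = e * norm (y - x)" using n by simp
      finally show ?thesis unfolding repr by (simp add: g_def linear_simps[OF L] algebra_simps)
    qed
    then show "\<exists>d>0. \<forall>y\<in>V. norm (y - x) < d \<longrightarrow> norm (f y - f x - L (y - x)) \<le> e * norm (y - x)"
      using d n by (intro exI[of _ "d / n"]) simp
  qed
  then show "f differentiable at x within V" by (auto simp: differentiable_def)
qed

section \<open>Smooth maps on manifolds\<close>

locale smooth_mfd =
  fixes M :: "('m::{t2_space, second_countable_topology}, 'e::euclidean_space) smooth_structure"
  assumes manifold: "smooth_manifold M"
begin

lemma model_basis: "model_basis M \<subseteq> Basis"
  using manifold by (simp add: smooth_manifold_def)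

lemma chart_at: obtains U \<phi> where "(U, \<phi>) \<in> charts M" "p \<in> U"
proof -
  have "p \<in> (\<Union>(U, \<phi>)\<in>charts M. U)" using manifold by (simp add: smooth_manifold_def)
  then show ?thesis using that by auto
qed

context
  fixes U \<phi> assumes chart: "(U, \<phi>) \<in> charts M"
begin

lemma chart_open: "open U"
  using manifold chart by (auto simp: smooth_manifold_def)

text \<open>The axioms of a manifold give a homeomorphism with some inverse, whereas smoothness is
  expressed with \<open>inv_into U \<phi>\<close>; the two agree on the image of the chart.\<close>

lemma chart_homeomorphism: "homeomorphism U (\<phi> ` U) \<phi> (inv_into U \<phi>)"
proof -
  obtain \<psi> where \<psi>: "homeomorphism U (\<phi> ` U) \<phi> \<psi>"
    using manifold chart by (force simp: smooth_manifold_def)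
  have inj: "inj_on \<phi> U" using \<psi> by (metis homeomorphism_apply1 inj_onI)
  have eq: "\<psi> y = inv_into U \<phi> y" if "y \<in> \<phi> ` U" for y
    using that inj homeomorphism_apply1[OF \<psi>] by auto
  have "continuous_on (\<phi> ` U) (inv_into U \<phi>)"
    using homeomorphism_cont2[OF \<psi>] eq by (rule continuous_on_eq)
  then show ?thesis
    using homeomorphism_cont1[OF \<psi>] inj
    by (intro homeomorphismI) (auto simp: f_inv_into_f)
qed

lemma chart_inj: "inj_on \<phi> U"
  by (rule inj_on_inverseI[of U "inv_into U \<phi>"]) (rule homeomorphism_apply1[OF chart_homeomorphism])

lemma chart_inv: "p \<in> U \<Longrightarrow> inv_into U \<phi> (\<phi> p) = p"
  using chart_inj by simp

lemma chart_openin: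
  assumes "open W" shows "openin (top_of_set (span (model_basis M))) (\<phi> ` (U \<inter> W))"
proof -
  have "openin (top_of_set (\<phi> ` U)) (\<phi> ` (U \<inter> W))"
    by (rule homeomorphism_imp_open_map[OF chart_homeomorphism]) (use assms in auto)
  moreover have "openin (top_of_set (span (model_basis M))) (\<phi> ` U)"
    using manifold chart by (auto simp: smooth_manifold_def)
  ultimately show ?thesis by (rule openin_trans)
qed

lemma smooth_map_chart: "smooth_map M U \<phi>"
  unfolding smooth_map_def
proof safe
  fix U' \<phi>' assume "(U', \<phi>') \<in> charts M"
  then show "smooth_on (model_basis M) (\<phi>' ` (U' \<inter> U)) (\<phi> \<circ> inv_into U' \<phi>')"
    using manifold chart by (force simp: smooth_manifold_def)
qed

end

lemma smooth_map_chartD: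
  "smooth_map M W f \<Longrightarrow> (U, \<phi>) \<in> charts M \<Longrightarrow>
    Ck_on k (model_basis M) (\<phi> ` (U \<inter> W)) (f \<circ> inv_into U \<phi>)"
  by (auto simp: smooth_map_def smooth_on_def)

lemma smooth_mapI:
  "(\<And>U \<phi> k. (U, \<phi>) \<in> charts M \<Longrightarrow> Ck_on k (model_basis M) (\<phi> ` (U \<inter> W)) (f \<circ> inv_into U \<phi>)) \<Longrightarrow>
    smooth_map M W f"
  by (auto simp: smooth_map_def smooth_on_def)

lemma smooth_map_subset: "smooth_map M W f \<Longrightarrow> W' \<subseteq> W \<Longrightarrow> smooth_map M W' f"
  by (intro smooth_mapI, rule Ck_on_subset, erule (1) smooth_map_chartD) auto

lemma smooth_map_cong:
  assumes "open W" "\<And>p. p \<in> W \<Longrightarrow> f p = g p"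
  shows "smooth_map M W f \<longleftrightarrow> smooth_map M W g"
proof -
  have "Ck_on k (model_basis M) (\<phi> ` (U \<inter> W)) (f \<circ> inv_into U \<phi>) \<longleftrightarrow>
      Ck_on k (model_basis M) (\<phi> ` (U \<inter> W)) (g \<circ> inv_into U \<phi>)" if "(U, \<phi>) \<in> charts M" for U \<phi> k
    by (rule Ck_on_cong[OF chart_openin[OF that assms(1)]]) (auto simp: chart_inv[OF that] assms(2))
  then show ?thesis by (auto intro!: smooth_mapI dest: smooth_map_chartD)
qed

lemma smooth_map_const [simp]: "smooth_map M W (\<lambda>p. c)"
  by (intro smooth_mapI) (simp add: o_def Ck_on_const)

lemma smooth_map_bilinear:
  assumes "bounded_bilinear pr" "smooth_map M W f" "smooth_map M W g"
  shows "smooth_map M W (\<lambda>p. pr (f p) (g p))"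
  using Ck_on_bilinear[OF assms(1) smooth_map_chartD[OF assms(2)] smooth_map_chartD[OF assms(3)]]
  by (intro smooth_mapI) (simp add: o_def)

lemma smooth_map_linear:
  assumes "bounded_linear L" "smooth_map M W f"
  shows "smooth_map M W (\<lambda>p. L (f p))"
  using Ck_on_linear[OF assms(1) smooth_map_chartD[OF assms(2)]]
  by (intro smooth_mapI) (simp add: o_def)

lemma smooth_map_add:
  assumes "smooth_map M W f" "smooth_map M W g"
  shows "smooth_map M W (\<lambda>p. f p + g p)"
  using Ck_on_add[OF smooth_map_chartD[OF assms(1)] smooth_map_chartD[OF assms(2)]]
  by (intro smooth_mapI) (simp add: o_def)

lemma smooth_map_sum:
  "(\<And>i. i \<in> I \<Longrightarrow> smooth_map M W (f i)) \<Longrightarrow> smooth_map M W (\<lambda>p. \<Sum>i\<in>I. f i p)"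
  by (induction I rule: infinite_finite_induct) (auto intro: smooth_map_add)

lemma smooth_map_mult:
  fixes f g :: "'m \<Rightarrow> 'a::real_normed_algebra"
  shows "smooth_map M W f \<Longrightarrow> smooth_map M W g \<Longrightarrow> smooth_map M W (\<lambda>p. f p * g p)"
  by (rule smooth_map_bilinear[OF bounded_bilinear_mult])

lemma smooth_map_prod:
  fixes f :: "'i \<Rightarrow> 'm \<Rightarrow> 'a::{real_normed_algebra,comm_ring_1}"
  shows "(\<And>i. i \<in> I \<Longrightarrow> smooth_map M W (f i)) \<Longrightarrow> smooth_map M W (\<lambda>p. \<Prod>i\<in>I. f i p)"
  by (induction I rule: infinite_finite_induct) (auto intro: smooth_map_mult)

lemma smooth_map_compose:
  fixes d :: "nat \<Rightarrow> real \<Rightarrow> real"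
  assumes d: "\<And>n x. x \<in> S \<Longrightarrow> (d n has_real_derivative d (Suc n) x) (at x)"
    and f: "smooth_map M W f" "\<And>p. p \<in> W \<Longrightarrow> f p \<in> S"
  shows "smooth_map M W (\<lambda>p. d n (f p))"
proof (rule smooth_mapI)
  fix U \<phi> k assume c: "(U, \<phi>) \<in> charts M"
  have "(f \<circ> inv_into U \<phi>) ` \<phi> ` (U \<inter> W) \<subseteq> S"
    using f(2) by (auto simp: chart_inv[OF c])
  from Ck_on_compose_real[of S d, OF d this smooth_map_chartD[OF f(1) c]]
  show "Ck_on k (model_basis M) (\<phi> ` (U \<inter> W)) ((\<lambda>p. d n (f p)) \<circ> inv_into U \<phi>)"
    by (simp add: o_def)
qed

lemma smooth_map_local:
  assumes "open W" "\<And>p. p \<in> W \<Longrightarrow> \<exists>N. open N \<and> p \<in> N \<and> smooth_map M (W \<inter> N) f"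
  shows "smooth_map M W f"
proof (rule smooth_mapI)
  fix U \<phi> k assume c: "(U, \<phi>) \<in> charts M"
  show "Ck_on k (model_basis M) (\<phi> ` (U \<inter> W)) (f \<circ> inv_into U \<phi>)"
  proof (rule Ck_on_local[OF chart_openin[OF c assms(1)]])
    fix x assume "x \<in> \<phi> ` (U \<inter> W)"
    then obtain p where p: "p \<in> U" "p \<in> W" "x = \<phi> p" by auto
    then obtain N where N: "open N" "p \<in> N" "smooth_map M (W \<inter> N) f" using assms(2) by blast
    obtain T where T: "open T" "\<phi> ` (U \<inter> (W \<inter> N)) = span (model_basis M) \<inter> T"
      using chart_openin[OF c open_Int[OF assms(1) N(1)]] by (auto simp: openin_open)
    have "\<phi> ` (U \<inter> W) \<subseteq> span (model_basis M)"
      using chart_openin[OF c assms(1)] by (auto simp: openin_open)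
    then have "\<phi> ` (U \<inter> W) \<inter> T \<subseteq> \<phi> ` (U \<inter> (W \<inter> N))" unfolding T(2) by blast
    then have "Ck_on k (model_basis M) (\<phi> ` (U \<inter> W) \<inter> T) (f \<circ> inv_into U \<phi>)"
      by (rule Ck_on_subset[OF smooth_map_chartD[OF N(3) c]])
    moreover have "x \<in> T" using p N T(2) by blast
    ultimately show "\<exists>T. open T \<and> x \<in> T \<and> Ck_on k (model_basis M) (\<phi> ` (U \<inter> W) \<inter> T) (f \<circ> inv_into U \<phi>)"
      using T(1) by blast
  qed
qed

lemma smooth_map_continuous:
  assumes "open W" "smooth_map M W f"
  shows "continuous_on W f"
proof -
  have "continuous (at p) f" if p: "p \<in> W" for p
  proof -
    obtain U \<phi> where c: "(U, \<phi>) \<in> charts M" "p \<in> U" by (rule chart_at)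
    have "continuous_on (\<phi> ` (U \<inter> W)) (f \<circ> inv_into U \<phi>)"
      using smooth_map_chartD[OF assms(2) c(1), of 0] by simp
    moreover have "continuous_on (U \<inter> W) \<phi>"
      using chart_homeomorphism[OF c(1)] by (auto simp: homeomorphism_def intro: continuous_on_subset)
    ultimately have "continuous_on (U \<inter> W) ((f \<circ> inv_into U \<phi>) \<circ> \<phi>)"
      by (rule continuous_on_compose[rotated])
    then have "continuous_on (U \<inter> W) f"
      by (rule continuous_on_eq) (auto simp: chart_inv[OF c(1)])
    then show ?thesis
      using c p assms(1) chart_open[OF c(1)] by (simp add: continuous_on_eq_continuous_at open_Int)
  qed
  then show ?thesis by (simp add: continuous_at_imp_continuous_on)
qed

end

section \<open>Bump functions and locally finite refinements\<close>

text \<open>The functions p(1/x) exp(-1/x), extended by 0 to x \<le> 0. The polynomial is carried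
  along because the family is then closed under differentiation.\<close>

definition flat :: "real poly \<Rightarrow> real \<Rightarrow> real" where
  "flat p x = (if x > 0 then poly p (1 / x) * exp (- (1 / x)) else 0)"

lemma poly_exp_tendsto_0: "((\<lambda>x. poly p x * exp (- x)) \<longlongrightarrow> (0::real)) at_top"
proof -
  have "((\<lambda>x. \<Sum>i\<le>degree p. coeff p i * (x ^ i / exp x)) \<longlongrightarrow> (\<Sum>i\<le>degree p. coeff p i * 0)) at_top"
    by (intro tendsto_sum tendsto_mult tendsto_const tendsto_power_div_exp_0)
  moreover have "(\<lambda>x. \<Sum>i\<le>degree p. coeff p i * (x ^ i / exp x)) = (\<lambda>x. poly p x * exp (- x))"
    by (auto simp: poly_altdef sum_distrib_right exp_minus divide_inverse mult.assoc)
  ultimately show ?thesis by simp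
qed

text \<open>For x > 0 the derivatives of p(1/x) and exp(-1/x) contribute - p'(1/x) / x^2 and p(1/x)
  / x^2, hence the polynomial X^2 (p - p').\<close>

lemma flat_derivative:
  "(flat p has_real_derivative flat ([:0, 0, 1:] * (p - pderiv p)) x) (at x)"
proof -
  consider "x > 0" | "x < 0" | "x = 0" by linarith
  then show ?thesis
  proof cases
    case 1
    have "((\<lambda>x. poly p (1 / x) * exp (- (1 / x))) has_real_derivative
        flat ([:0, 0, 1:] * (p - pderiv p)) x) (at x)"
      using 1 by (auto intro!: derivative_eq_intros DERIV_chain'[OF _ poly_DERIV]
          simp: flat_def field_simps power2_eq_square)
    then show ?thesis
      by (rule has_field_derivative_transform_within_open[of _ _ _ "{0<..}"])
         (use 1 in \<open>auto simp: flat_def\<close>)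
  next
    case 2
    have "((\<lambda>x. 0) has_real_derivative flat ([:0, 0, 1:] * (p - pderiv p)) x) (at x)"
      using 2 by (auto simp: flat_def)
    then show ?thesis
      by (rule has_field_derivative_transform_within_open[of _ _ _ "{..<0}"])
         (use 2 in \<open>auto simp: flat_def\<close>)
  next
    case 3
    \<comment> \<open>The right difference quotient at 0 is X p evaluated at 1/h, times exp(-1/h);
      as 1/h tends to infinity the exponential wins.\<close>
    have "((\<lambda>h. poly (pCons 0 p) (inverse h) * exp (- inverse h)) \<longlongrightarrow> (0::real)) (at_right 0)"
      using filterlim_compose[OF poly_exp_tendsto_0 filterlim_inverse_at_top_right] .
    then have r: "((\<lambda>h. flat p h / h) \<longlongrightarrow> 0) (at_right 0)"
      by (rule tendsto_cong[THEN iffD1, rotated])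
         (auto simp: flat_def field_simps eventually_at_right_less elim!: eventually_mono
               intro!: eventually_at_right_less[THEN eventually_mono])
    have l: "((\<lambda>h. flat p h / h) \<longlongrightarrow> 0) (at_left 0)"
      by (rule tendsto_eventually)
         (auto simp: flat_def eventually_at_left_field intro!: exI[of _ "-1"])
    have "((\<lambda>h. (flat p (0 + h) - flat p 0) / h) \<longlongrightarrow> 0) (at 0)"
      using l r by (simp add: filterlim_split_at flat_def[of _ 0])
    then show ?thesis using 3 by (simp add: DERIV_def flat_def)
  qed
qed

text \<open>The successive derivatives of the classical flat function exp(-1/x), which belongs to
  the polynomial 1.\<close>

definition flat_seq :: "nat \<Rightarrow> real \<Rightarrow> real" where
  "flat_seq n = flat (((\<lambda>p. [:0, 0, 1:] * (p - pderiv p)) ^^ n) 1)"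

lemma flat_seq_derivative: "(flat_seq n has_real_derivative flat_seq (Suc n) x) (at x)"
  using flat_derivative by (simp add: flat_seq_def)

lemma flat_seq_0: "flat_seq 0 x \<ge> 0" "flat_seq 0 x > 0 \<longleftrightarrow> x > 0" "x \<le> 0 \<Longrightarrow> flat_seq 0 x = 0"
  by (auto simp: flat_seq_def flat_def)

context smooth_mfd
begin

lemma smooth_map_flat: "smooth_map M W f \<Longrightarrow> smooth_map M W (\<lambda>p. flat_seq 0 (f p))"
  using smooth_map_compose[of UNIV flat_seq] flat_seq_derivative by blast

text \<open>In a chart the function is the flat function of r^2 - |\<phi> q - \<phi> p|^2, and it is
  extended by 0. The preimage L of the closed ball is compact, hence closed as the space is
  Hausdorff; so the chart domain and the complement of L are open, cover everything, and smoothness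
  can be checked on each.\<close>

lemma bump_function:
  assumes "open W" "p \<in> W"
  obtains \<beta> :: "'m \<Rightarrow> real" and L where "smooth_map M UNIV \<beta>" "\<And>q. \<beta> q \<ge> 0" "\<beta> p > 0"
    "compact L" "L \<subseteq> W" "\<And>q. q \<notin> L \<Longrightarrow> \<beta> q = 0"
proof -
  obtain U \<phi> where c: "(U, \<phi>) \<in> charts M" "p \<in> U" by (rule chart_at)
  let ?S = "span (model_basis M)"
  obtain T where T: "open T" "\<phi> ` (U \<inter> W) = ?S \<inter> T"
    using chart_openin[OF c(1) assms(1)] by (auto simp: openin_open)
  have "\<phi> p \<in> T" using T(2) c assms(2) by blast
  then obtain r where r: "r > 0" "cball (\<phi> p) r \<subseteq> T" using T(1) open_contains_cball by blast
  define L where "L = inv_into U \<phi> ` (cball (\<phi> p) r \<inter> ?S)"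
  have sub: "cball (\<phi> p) r \<inter> ?S \<subseteq> \<phi> ` (U \<inter> W)" unfolding T(2)
    by (rule Int_greatest[OF Int_lower2 order_trans[OF Int_lower1 r(2)]])
  have L: "compact L" unfolding L_def
  proof (rule compact_continuous_image)
    show "continuous_on (cball (\<phi> p) r \<inter> ?S) (inv_into U \<phi>)"
      by (rule continuous_on_subset[OF homeomorphism_cont2[OF chart_homeomorphism[OF c(1)]] order_trans[OF sub]])
         auto
    show "compact (cball (\<phi> p) r \<inter> ?S)" by (intro compact_Int_closed compact_cball closed_span)
  qed
  have LW: "L \<subseteq> U \<inter> W"
  proof -
    have "L \<subseteq> inv_into U \<phi> ` \<phi> ` (U \<inter> W)" unfolding L_def using sub by (rule image_mono)
    also have "\<dots> = U \<inter> W" using chart_inv[OF c(1)] by (auto simp: image_iff)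
    finally show ?thesis .
  qed
  define f where "f q = r\<^sup>2 - (\<phi> q - \<phi> p) \<bullet> (\<phi> q - \<phi> p)" for q
  have f: "smooth_map M U f"
  proof -
    have 1: "smooth_map M U (\<lambda>q. \<phi> q + (- \<phi> p))"
      by (intro smooth_map_add smooth_map_chart[OF c(1)] smooth_map_const)
    have "smooth_map M U (\<lambda>q. r\<^sup>2 + (- ((\<phi> q + - \<phi> p) \<bullet> (\<phi> q + - \<phi> p))))"
      by (intro smooth_map_add smooth_map_const smooth_map_linear[OF bounded_linear_minus[OF bounded_linear_ident]]
          smooth_map_bilinear[OF bounded_bilinear_inner 1 1])
    then show ?thesis by (simp add: f_def[abs_def])
  qed
  have fpos: "q \<in> L" if q: "q \<in> U" "f q > 0" for q
  proof -
    have "(norm (\<phi> q - \<phi> p))\<^sup>2 \<le> r\<^sup>2" using q by (simp add: f_def dot_square_norm)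
    then have "norm (\<phi> q - \<phi> p) \<le> r" using r by (simp add: power2_le_iff_abs_le)
    then have "\<phi> q \<in> cball (\<phi> p) r" by (simp add: dist_norm norm_minus_commute)
    moreover have "\<phi> q \<in> ?S" using chart_openin[OF c(1) open_UNIV] q by (auto simp: openin_open)
    ultimately have "inv_into U \<phi> (\<phi> q) \<in> L" unfolding L_def by blast
    then show ?thesis using chart_inv[OF c(1) q(1)] by simp
  qed
  define \<beta> where "\<beta> q = (if q \<in> U then flat_seq 0 (f q) else 0)" for q
  have zero: "\<beta> q = 0" if "q \<notin> L" for q
    using fpos[of q] that flat_seq_0(3)[of "f q"] by (cases "f q > 0") (auto simp: \<beta>_def)
  have "smooth_map M UNIV \<beta>"
  proof (rule smooth_map_local)
    fix q
    show "\<exists>N. open N \<and> q \<in> N \<and> smooth_map M (UNIV \<inter> N) \<beta>"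
    proof (cases "q \<in> U")
      case True
      have "smooth_map M U \<beta>"
        using smooth_map_flat[OF f] smooth_map_cong[OF chart_open[OF c(1)], of \<beta> "\<lambda>q. flat_seq 0 (f q)"]
        by (simp add: \<beta>_def)
      then show ?thesis using True chart_open[OF c(1)] by auto
    next
      case False
      have o: "open (- L)" using L by (simp add: compact_imp_closed open_Compl)
      have "smooth_map M (- L) \<beta>"
        using smooth_map_cong[OF o, of \<beta> "\<lambda>q. 0"] zero by simp
      then show ?thesis using False LW o by auto
    qed
  qed auto
  moreover have "\<beta> p > 0" using c r flat_seq_0 by (simp add: \<beta>_def f_def)
  ultimately show thesis
    using that[of \<beta> L] L LW zero flat_seq_0(1) by (auto simp: \<beta>_def)
qed

text \<open>The factors \<open>flat_seq 0 (1 / (n + 1) - \<beta> m)\<close> with \<open>m < n\<close> switch off the later functions near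
  every point where some \<open>\<beta> m\<close> is positive; no exhaustion by compact sets is needed.\<close>

lemma locally_finite_refinement:
  assumes cover: "\<And>p. \<exists>W. open W \<and> p \<in> W \<and> Pr W"
  obtains \<rho> :: "nat \<Rightarrow> 'm \<Rightarrow> real" and W L where
    "\<And>n. smooth_map M UNIV (\<rho> n)" "\<And>n q. \<rho> n q \<ge> 0"
    "\<And>n. open (W n)" "\<And>n. Pr (W n)" "\<And>n. closed (L n)" "\<And>n. L n \<subseteq> W n"
    "\<And>n q. q \<notin> L n \<Longrightarrow> \<rho> n q = 0" "\<And>p. \<exists>n. \<rho> n p > 0"
    "\<And>p. \<exists>N n0. open N \<and> p \<in> N \<and> (\<forall>n\<ge>n0. \<forall>q\<in>N. \<rho> n q = 0)"
proof -
  define good where "good \<beta> W L \<longleftrightarrow> smooth_map M UNIV \<beta> \<and> (\<forall>q. \<beta> q \<ge> 0) \<and> open W \<and> Pr W \<and>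
     closed L \<and> L \<subseteq> W \<and> (\<forall>q. q \<notin> L \<longrightarrow> \<beta> q = 0)" for \<beta> :: "'m \<Rightarrow> real" and W L
  define F where "F = {{q. \<beta> q > 0} | \<beta> W L. good \<beta> W L}"
  have pos_open: "open {q. \<beta> q > c}" if "smooth_map M UNIV \<beta>" for \<beta> :: "'m \<Rightarrow> real" and c
    using smooth_map_continuous[OF open_UNIV that] by (intro open_Collect_less) auto
  have "open S" if "S \<in> F" for S
    using that pos_open by (auto simp: F_def good_def)
  \<comment> \<open>Second countability, carried by the sort of the point type, reduces the cover by
    positivity sets to a countable one.\<close>
  then obtain F' where F': "F' \<subseteq> F" "countable F'" "\<Union>F' = \<Union>F" using Lindelof by metis
  have "\<Union>F = UNIV"
  proof -
    have "p \<in> \<Union>F" for p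
    proof -
      obtain W where W: "open W" "p \<in> W" "Pr W" using cover by blast
      obtain \<beta> :: "'m \<Rightarrow> real" and L where *: "smooth_map M UNIV \<beta>" "\<And>q. \<beta> q \<ge> 0" "\<beta> p > 0"
        "compact L" "L \<subseteq> W" "\<And>q. q \<notin> L \<Longrightarrow> \<beta> q = 0" using bump_function[OF W(1,2)] by metis
      then have "good \<beta> W L" using W by (auto simp: good_def compact_imp_closed)
      then show ?thesis using *(3) by (auto simp: F_def)
    qed
    then show ?thesis by blast
  qed
  with F' have "F' \<noteq> {}" by auto
  then have rng: "range (from_nat_into F') = F'" using F'(2) by (rule range_from_nat_into)
  have "\<forall>n. \<exists>\<beta> W L. from_nat_into F' n = {q. \<beta> q > 0} \<and> good \<beta> W L"
  proof
    fix n
    have "from_nat_into F' n \<in> F" using rng F'(1) by auto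
    then show "\<exists>\<beta> W L. from_nat_into F' n = {q. \<beta> q > 0} \<and> good \<beta> W L" unfolding F_def by blast
  qed
  then obtain \<beta> W L where \<beta>: "\<And>n. from_nat_into F' n = {q. \<beta> n q > 0}" and g: "\<And>n. good (\<beta> n) (W n) (L n)"
    by metis
  have sm: "smooth_map M UNIV (\<beta> n)" and nn: "\<beta> n q \<ge> 0" for n q using g by (auto simp: good_def)
  have cov: "\<exists>n. \<beta> n p > 0" for p
  proof -
    have "p \<in> (\<Union>n. from_nat_into F' n)" using rng \<open>\<Union>F = UNIV\<close> F'(3) by simp
    then show ?thesis using \<beta> by auto
  qed
  define \<rho> where "\<rho> n q = \<beta> n q * (\<Prod>m<n. flat_seq 0 (1 / real (Suc n) + - \<beta> m q))" for n q
  show thesis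
  proof (rule that[of \<rho> W L])
    show "smooth_map M UNIV (\<rho> n)" for n
      unfolding \<rho>_def
      by (intro smooth_map_mult smooth_map_prod smooth_map_flat smooth_map_add smooth_map_const sm
          smooth_map_linear[OF bounded_linear_minus[OF bounded_linear_ident]])
    show "\<rho> n q \<ge> 0" for n q
      unfolding \<rho>_def by (intro mult_nonneg_nonneg prod_nonneg nn ballI flat_seq_0)
    show "\<rho> n q = 0" if "q \<notin> L n" for n q
      using g[of n] that by (simp add: \<rho>_def good_def)
    show "\<exists>n. \<rho> n p > 0" for p
    proof -
      \<comment> \<open>All earlier functions vanish at p, so every switching factor of \<rho> j has
        the argument 1 / (j + 1) there and is positive.\<close>
      define j where "j = (LEAST n. \<beta> n p > 0)"
      have j: "\<beta> j p > 0" unfolding j_def using cov by (rule LeastI_ex)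
      have "\<beta> m p = 0" if "m < j" for m
        using not_less_Least[of m "\<lambda>n. \<beta> n p > 0"] that nn[of m p] by (simp add: j_def)
      then have "\<rho> j p > 0" unfolding \<rho>_def using j
        by (intro mult_pos_pos prod_pos) (auto simp: flat_seq_0)
      then show ?thesis ..
    qed
    show "\<exists>N n0. open N \<and> p \<in> N \<and> (\<forall>n\<ge>n0. \<forall>q\<in>N. \<rho> n q = 0)" for p
    proof -
      obtain j where j: "\<beta> j p > 0" using cov by blast
      \<comment> \<open>For n > max j k, on the open set where \<beta> j exceeds half its value at
        p, the factor with m = j occurs in the product and has a negative argument. So \<rho> n
        vanishes on that set.\<close>
      obtain k where k: "1 / real (Suc k) < \<beta> j p / 2"
        using nat_approx_posE[of "\<beta> j p / 2"] j by auto
      have "\<rho> n q = 0" if "n \<ge> Suc (max j k)" "\<beta> j q > \<beta> j p / 2" for n q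
      proof -
        have "1 / real (Suc n) \<le> 1 / real (Suc k)" using that by (intro divide_left_mono) auto
        then have "flat_seq 0 (1 / real (Suc n) + - \<beta> j q) = 0"
          using that k by (intro flat_seq_0(3)) linarith
        then show ?thesis using that unfolding \<rho>_def by (auto intro!: bexI[of _ j])
      qed
      then show ?thesis
        using pos_open[OF sm, of "\<beta> j p / 2" j] j
        by (intro exI[of _ "{q. \<beta> j q > \<beta> j p / 2}"] exI[of _ "Suc (max j k)"]) auto
    qed
  qed (use g in \<open>auto simp: good_def\<close>)
qed

end

section \<open>Sections of a Hermitian vector bundle in coordinates\<close>

lemma scaleR_eq_vector_scale: "r *\<^sub>R v = complex_of_real r *s (v :: complex ^ 'k)"
  by (simp add: vec_eq_iff) (simp add: scaleR_conv_of_real)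

lemma bounded_bilinear_vector_scale: "bounded_bilinear ((*s) :: complex \<Rightarrow> complex ^ 'k \<Rightarrow> complex ^ 'k)"
proof
  have "norm (c *s v) \<le> norm c * norm v * 1" for c and v :: "complex ^ 'k"
    by (simp add: norm_vec_def norm_mult L2_set_right_distrib)
  then show "\<exists>K. \<forall>(a :: complex) b :: complex ^ 'k. norm (a *s b) \<le> norm a * norm b * K" by blast
qed (auto simp: vec_eq_iff algebra_simps)

locale hermitian_bundle = smooth_mfd M
  for M :: "('m::{t2_space, second_countable_topology}, 'e::euclidean_space) smooth_structure" +
  fixes E :: "('m, 'v, 'k::finite) bundle_data" and h0 :: "'m \<Rightarrow> 'v \<Rightarrow> 'v \<Rightarrow> complex"
  assumes hermitian: "hermitian_vector_bundle M E h0"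
begin

text \<open>The coordinate map at a point comes from a trivialisation chosen at that point only; it need
  not depend continuously on the point.\<close>

definition coord :: "'m \<Rightarrow> 'v \<Rightarrow> complex ^ 'k" where
  "coord p = snd (SOME T. T \<in> trivialisations E \<and> p \<in> fst T) p"

definition lift :: "'m \<Rightarrow> complex ^ 'k \<Rightarrow> 'v" where
  "lift p = inv_into (carrier (fibre E p)) (coord p)"

definition form :: "'m \<Rightarrow> complex ^ 'k \<Rightarrow> complex ^ 'k \<Rightarrow> complex" where
  "form p z w = h0 p (lift p z) (lift p w)"

text \<open>The local section that is constantly z in the trivialisation \<tau>, expressed in the
  pointwise coordinates \<open>coord\<close>.\<close>

definition frame :: "('m \<Rightarrow> 'v \<Rightarrow> complex ^ 'k) \<Rightarrow> complex ^ 'k \<Rightarrow> 'm \<Rightarrow> complex ^ 'k" where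
  "frame \<tau> z p = coord p (inv_into (carrier (fibre E p)) (\<tau> p) z)"

text \<open>As \<open>coord\<close> may jump from point to point, smoothness of a coordinate
  function means nothing by itself; it is tested by lifting into the fibre and applying the
  trivialisations of the bundle. In exchange all sections are maps into the single type
  \<open>complex ^ 'k\<close>.\<close>

definition smooth_section :: "'m set \<Rightarrow> ('m \<Rightarrow> complex ^ 'k) \<Rightarrow> bool" where
  "smooth_section W \<sigma> \<longleftrightarrow>
     (\<forall>(U, \<tau>)\<in>trivialisations E. smooth_map M (U \<inter> W) (\<lambda>p. \<tau> p (lift p (\<sigma> p))))"

lemma is_vector_bundle: "vector_bundle M E"
  using hermitian by (simp add: hermitian_vector_bundle_def)

lemma fibre_module: "Module.module complex_field (fibre E p)"
  using is_vector_bundle by (simp add: vector_bundle_def)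

lemma trivialisation_at: obtains U \<tau> where "(U, \<tau>) \<in> trivialisations E" "p \<in> U"
proof -
  have "p \<in> (\<Union>(U, \<tau>)\<in>trivialisations E. U)" using is_vector_bundle by (simp add: vector_bundle_def)
  then show ?thesis using that by auto
qed

lemma trivialisations:
  "\<forall>(U, \<tau>)\<in>trivialisations E. open U \<and>
        (\<forall>p\<in>U. bij_betw (\<tau> p) (carrier (fibre E p)) UNIV \<and>
           (\<forall>v\<in>carrier (fibre E p). \<forall>w\<in>carrier (fibre E p).
              \<tau> p (v \<oplus>\<^bsub>fibre E p\<^esub> w) = \<tau> p v + \<tau> p w) \<and>
           (\<forall>c. \<forall>v\<in>carrier (fibre E p). \<tau> p (c \<odot>\<^bsub>fibre E p\<^esub> v) = c *s \<tau> p v))"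
  using is_vector_bundle unfolding vector_bundle_def by (elim conjE)

lemma trivialisation_open: "(U, \<tau>) \<in> trivialisations E \<Longrightarrow> open U"
  using bspec[OF trivialisations, of "(U, \<tau>)", unfolded prod.case] by (rule conjunct1)

lemma trivialisation:
  assumes "(U, \<tau>) \<in> trivialisations E" "p \<in> U"
  shows "bij_betw (\<tau> p) (carrier (fibre E p)) UNIV"
    and "\<And>v w. v \<in> carrier (fibre E p) \<Longrightarrow> w \<in> carrier (fibre E p) \<Longrightarrow>
      \<tau> p (v \<oplus>\<^bsub>fibre E p\<^esub> w) = \<tau> p v + \<tau> p w"
    and "\<And>c v. v \<in> carrier (fibre E p) \<Longrightarrow> \<tau> p (c \<odot>\<^bsub>fibre E p\<^esub> v) = c *s \<tau> p v"
  using bspec[OF conjunct2[OF bspec[OF trivialisations assms(1), unfolded prod.case]] assms(2)]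
  by (blast+)

lemma coord_trivialisation:
  obtains U \<tau> where "(U, \<tau>) \<in> trivialisations E" "p \<in> U" "coord p = \<tau> p"
proof -
  obtain U \<tau> where "(U, \<tau>) \<in> trivialisations E" "p \<in> U" by (rule trivialisation_at)
  then have "\<exists>T. T \<in> trivialisations E \<and> p \<in> fst T" by force
  from someI_ex[OF this] show ?thesis
    by (intro that[of "fst (SOME T. T \<in> trivialisations E \<and> p \<in> fst T)"
        "snd (SOME T. T \<in> trivialisations E \<and> p \<in> fst T)"]) (auto simp: coord_def)
qed

lemma coord_bij: "bij_betw (coord p) (carrier (fibre E p)) UNIV"
  using coord_trivialisation[of p] trivialisation(1) by metis

lemma coord_add: "v \<in> carrier (fibre E p) \<Longrightarrow> w \<in> carrier (fibre E p) \<Longrightarrow>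
      coord p (v \<oplus>\<^bsub>fibre E p\<^esub> w) = coord p v + coord p w"
  using coord_trivialisation[of p] trivialisation(2) by metis

lemma coord_scale: "v \<in> carrier (fibre E p) \<Longrightarrow> coord p (c \<odot>\<^bsub>fibre E p\<^esub> v) = c *s coord p v"
  using coord_trivialisation[of p] trivialisation(3) by metis

lemma lift_closed [simp]: "lift p z \<in> carrier (fibre E p)"
  unfolding lift_def using coord_bij[of p] by (intro inv_into_into) (auto simp: bij_betw_def)

lemma coord_lift [simp]: "coord p (lift p z) = z"
  unfolding lift_def using coord_bij[of p] by (simp add: bij_betw_def f_inv_into_f)

lemma lift_coord [simp]: "v \<in> carrier (fibre E p) \<Longrightarrow> lift p (coord p v) = v"
  unfolding lift_def using coord_bij[of p] by (simp add: bij_betw_def)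

lemma coord_inj: "v \<in> carrier (fibre E p) \<Longrightarrow> w \<in> carrier (fibre E p) \<Longrightarrow> coord p v = coord p w \<Longrightarrow> v = w"
  by (metis lift_coord)

lemma fibre_add_closed:
  "v \<in> carrier (fibre E p) \<Longrightarrow> w \<in> carrier (fibre E p) \<Longrightarrow> v \<oplus>\<^bsub>fibre E p\<^esub> w \<in> carrier (fibre E p)"
proof -
  interpret Module.module complex_field "fibre E p" by (rule fibre_module)
  show "v \<in> carrier (fibre E p) \<Longrightarrow> w \<in> carrier (fibre E p) \<Longrightarrow> v \<oplus>\<^bsub>fibre E p\<^esub> w \<in> carrier (fibre E p)"
    by simp
qed

lemma fibre_scale_closed:
  "v \<in> carrier (fibre E p) \<Longrightarrow> c \<odot>\<^bsub>fibre E p\<^esub> v \<in> carrier (fibre E p)"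
proof -
  interpret Module.module complex_field "fibre E p" by (rule fibre_module)
  show "v \<in> carrier (fibre E p) \<Longrightarrow> c \<odot>\<^bsub>fibre E p\<^esub> v \<in> carrier (fibre E p)"
    by (simp add: ring_of_type_def)
qed

lemma lift_add: "lift p (z + w) = lift p z \<oplus>\<^bsub>fibre E p\<^esub> lift p w"
  by (rule coord_inj[of _ p]) (simp_all add: fibre_add_closed coord_add)

lemma lift_scale: "lift p (c *s z) = c \<odot>\<^bsub>fibre E p\<^esub> lift p z"
  by (rule coord_inj[of _ p]) (simp_all add: fibre_scale_closed coord_scale)

lemma fibre_zero_closed: "\<zero>\<^bsub>fibre E p\<^esub> \<in> carrier (fibre E p)"
proof -
  interpret Module.module complex_field "fibre E p" by (rule fibre_module)
  show ?thesis by simp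
qed

lemma coord_zero: "coord p \<zero>\<^bsub>fibre E p\<^esub> = 0"
proof -
  interpret Module.module complex_field "fibre E p" by (rule fibre_module)
  have "coord p \<zero>\<^bsub>fibre E p\<^esub> = coord p (\<zero>\<^bsub>fibre E p\<^esub> \<oplus>\<^bsub>fibre E p\<^esub> \<zero>\<^bsub>fibre E p\<^esub>)" by simp
  then show ?thesis by (simp only: coord_add[OF zero_closed zero_closed]) simp
qed

context
  fixes U \<tau> p assumes triv: "(U, \<tau>) \<in> trivialisations E" "p \<in> U"
begin

lemma triv_add: "\<tau> p (lift p (z + w)) = \<tau> p (lift p z) + \<tau> p (lift p w)"
  by (simp add: lift_add trivialisation(2)[OF triv])

lemma triv_scale: "\<tau> p (lift p (c *s z)) = c *s \<tau> p (lift p z)"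
  by (simp add: lift_scale trivialisation(3)[OF triv])

lemma triv_scaleR: "\<tau> p (lift p (r *\<^sub>R z)) = r *\<^sub>R \<tau> p (lift p z)"
  by (simp add: scaleR_eq_vector_scale triv_scale)

lemma triv_0: "\<tau> p (lift p 0) = 0"
  using triv_scale[of 0 0] by simp

lemma triv_sum: "\<tau> p (lift p (\<Sum>i\<in>I. f i)) = (\<Sum>i\<in>I. \<tau> p (lift p (f i)))"
  by (induction I rule: infinite_finite_induct) (auto simp: triv_0 triv_add)

lemma triv_frame: "\<tau> p (lift p (frame \<tau> z p)) = z"
proof -
  have "inv_into (carrier (fibre E p)) (\<tau> p) z \<in> carrier (fibre E p)"
    using trivialisation(1)[OF triv] by (intro inv_into_into) (auto simp: bij_betw_def)
  then show ?thesis
    using trivialisation(1)[OF triv] by (simp add: frame_def bij_betw_def f_inv_into_f)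
qed

lemma lift_frame: "lift p (frame \<tau> z p) = inv_into (carrier (fibre E p)) (\<tau> p) z"
proof -
  have "inv_into (carrier (fibre E p)) (\<tau> p) z \<in> carrier (fibre E p)"
    using trivialisation(1)[OF triv] by (intro inv_into_into) (auto simp: bij_betw_def)
  then show ?thesis by (simp add: frame_def)
qed

lemma frame_triv: "frame \<tau> (\<tau> p (lift p z)) p = z"
  using trivialisation(1)[OF triv] by (simp add: frame_def bij_betw_def)

lemma triv_inj: "\<tau> p (lift p z) = \<tau> p (lift p w) \<Longrightarrow> z = w"
  by (metis frame_triv)

lemma frame_expansion: "z = (\<Sum>a\<in>UNIV. (\<tau> p (lift p z) $ a) *s frame \<tau> (axis a 1) p)"
proof (rule triv_inj)
  have "\<tau> p (lift p (\<Sum>a\<in>UNIV. (\<tau> p (lift p z) $ a) *s frame \<tau> (axis a 1) p)) =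
      (\<Sum>a\<in>UNIV. (\<tau> p (lift p z) $ a) *s axis a 1)"
    by (simp add: triv_sum triv_scale triv_frame)
  also have "\<dots> = \<tau> p (lift p z)" by (simp add: basis_expansion)
  finally show "\<tau> p (lift p z) = \<tau> p (lift p (\<Sum>a\<in>UNIV. (\<tau> p (lift p z) $ a) *s frame \<tau> (axis a 1) p))" ..
qed

end

text \<open>In another trivialisation this section is a transition function applied to a constant
  vector.\<close>

lemma smooth_frame:
  assumes "(U, \<tau>) \<in> trivialisations E" shows "smooth_section U (frame \<tau> z)"
  unfolding smooth_section_def
proof safe
  fix U' \<tau>' assume 2: "(U', \<tau>') \<in> trivialisations E"
  have "smooth_map M (U \<inter> U') (\<lambda>p. \<tau>' p (inv_into (carrier (fibre E p)) (\<tau> p) z))"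
  proof -
    have "\<forall>(U, \<tau>)\<in>trivialisations E. \<forall>(U', \<tau>')\<in>trivialisations E. \<forall>z.
        smooth_map M (U \<inter> U') (\<lambda>p. \<tau>' p (inv_into (carrier (fibre E p)) (\<tau> p) z))"
      using is_vector_bundle unfolding vector_bundle_def by (elim conjE)
    from bspec[OF bspec[OF this assms, unfolded prod.case] 2, unfolded prod.case] show ?thesis ..
  qed
  then have "smooth_map M (U' \<inter> U) (\<lambda>p. \<tau>' p (inv_into (carrier (fibre E p)) (\<tau> p) z))"
    by (simp add: Int_commute)
  then show "smooth_map M (U' \<inter> U) (\<lambda>p. \<tau>' p (lift p (frame \<tau> z p)))"
    by (subst smooth_map_cong) (auto simp: lift_frame[OF assms]
        intro: open_Int trivialisation_open[OF assms] trivialisation_open[OF 2])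
qed

lemma smooth_sectionD:
  "smooth_section W \<sigma> \<Longrightarrow> (U, \<tau>) \<in> trivialisations E \<Longrightarrow>
    smooth_map M (U \<inter> W) (\<lambda>p. \<tau> p (lift p (\<sigma> p)))"
  by (auto simp: smooth_section_def)

lemma smooth_section_subset: "smooth_section W \<sigma> \<Longrightarrow> W' \<subseteq> W \<Longrightarrow> smooth_section W' \<sigma>"
  unfolding smooth_section_def by (auto intro: smooth_map_subset)

lemma smooth_section_cong:
  assumes "open W" "\<And>p. p \<in> W \<Longrightarrow> \<sigma> p = \<sigma>' p"
  shows "smooth_section W \<sigma> \<longleftrightarrow> smooth_section W \<sigma>'"
proof -
  have "smooth_map M (U \<inter> W) (\<lambda>p. \<tau> p (lift p (\<sigma> p))) \<longleftrightarrow> smooth_map M (U \<inter> W) (\<lambda>p. \<tau> p (lift p (\<sigma>' p)))"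
    if "(U, \<tau>) \<in> trivialisations E" for U \<tau>
    by (rule smooth_map_cong) (use assms trivialisation_open[OF that] in auto)
  then show ?thesis by (auto simp: smooth_section_def)
qed

lemma smooth_section_local:
  assumes "open W" "\<And>p. p \<in> W \<Longrightarrow> \<exists>N. open N \<and> p \<in> N \<and> smooth_section (W \<inter> N) \<sigma>"
  shows "smooth_section W \<sigma>"
  unfolding smooth_section_def
proof safe
  fix U \<tau> assume T: "(U, \<tau>) \<in> trivialisations E"
  show "smooth_map M (U \<inter> W) (\<lambda>p. \<tau> p (lift p (\<sigma> p)))"
  proof (rule smooth_map_local)
    fix p assume "p \<in> U \<inter> W"
    with assms(2) obtain N where N: "open N" "p \<in> N" "smooth_section (W \<inter> N) \<sigma>" by blast
    then show "\<exists>N. open N \<and> p \<in> N \<and> smooth_map M (U \<inter> W \<inter> N) (\<lambda>p. \<tau> p (lift p (\<sigma> p)))"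
      using smooth_sectionD[OF N(3) T] by (auto simp: Int_assoc)
  qed (use assms trivialisation_open[OF T] in auto)
qed

lemma smooth_section_scale:
  assumes W: "open W" and f: "smooth_map M W f" and \<sigma>: "smooth_section W \<sigma>"
  shows "smooth_section W (\<lambda>p. f p *s \<sigma> p)"
  unfolding smooth_section_def
proof safe
  fix U \<tau> assume T: "(U, \<tau>) \<in> trivialisations E"
  have "smooth_map M (U \<inter> W) (\<lambda>p. f p *s \<tau> p (lift p (\<sigma> p)))"
    by (rule smooth_map_bilinear[OF bounded_bilinear_vector_scale])
       (use smooth_map_subset[OF f] smooth_sectionD[OF \<sigma> T] in auto)
  then show "smooth_map M (U \<inter> W) (\<lambda>p. \<tau> p (lift p (f p *s \<sigma> p)))"
    by (subst smooth_map_cong) (auto simp: triv_scale[OF T] intro: open_Int W trivialisation_open[OF T])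
qed

lemma smooth_map_of_real:
  "smooth_map M W f \<Longrightarrow> smooth_map M W (\<lambda>p. complex_of_real (f p))"
  by (rule smooth_map_linear[OF bounded_linear_of_real])

lemma smooth_section_scaleR:
  assumes "open W" "smooth_map M W f" "smooth_section W \<sigma>"
  shows "smooth_section W (\<lambda>p. f p *\<^sub>R \<sigma> p)"
  unfolding scaleR_eq_vector_scale
  by (rule smooth_section_scale[OF assms(1) smooth_map_of_real[OF assms(2)] assms(3)])

lemma smooth_section_add:
  assumes W: "open W" and f: "smooth_section W \<sigma>'" and \<sigma>: "smooth_section W \<sigma>"
  shows "smooth_section W (\<lambda>p. \<sigma>' p + \<sigma> p)"
  unfolding smooth_section_def
proof safe
  fix U \<tau> assume T: "(U, \<tau>) \<in> trivialisations E"
  have "smooth_map M (U \<inter> W) (\<lambda>p. \<tau> p (lift p (\<sigma>' p)) + \<tau> p (lift p (\<sigma> p)))"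
    by (intro smooth_map_add smooth_sectionD[OF _ T] \<sigma> f)
  then show "smooth_map M (U \<inter> W) (\<lambda>p. \<tau> p (lift p (\<sigma>' p + \<sigma> p)))"
    by (subst smooth_map_cong) (auto simp: triv_add[OF T] intro: open_Int W trivialisation_open[OF T])
qed

lemma smooth_section_0: "open W \<Longrightarrow> smooth_section W (\<lambda>p. 0)"
  unfolding smooth_section_def
  by safe (subst smooth_map_cong, auto simp: triv_0 intro: open_Int trivialisation_open)

lemma smooth_section_sum:
  "open W \<Longrightarrow> (\<And>i. i \<in> I \<Longrightarrow> smooth_section W (f i)) \<Longrightarrow> smooth_section W (\<lambda>p. \<Sum>i\<in>I. f i p)"
  by (induction I rule: infinite_finite_induct) (auto intro: smooth_section_0 smooth_section_add)

section \<open>The Hermitian form in coordinates\<close>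

lemma h0_axioms:
  assumes "v \<in> carrier (fibre E p)" "w \<in> carrier (fibre E p)"
  shows "h0 p w v = cnj (h0 p v w)"
    and "\<And>u. u \<in> carrier (fibre E p) \<Longrightarrow> h0 p v (w \<oplus>\<^bsub>fibre E p\<^esub> u) = h0 p v w + h0 p v u"
    and "\<And>c. h0 p v (c \<odot>\<^bsub>fibre E p\<^esub> w) = c * h0 p v w"
proof -
  have "\<forall>p. \<forall>v\<in>carrier (fibre E p). \<forall>w\<in>carrier (fibre E p).
        h0 p w v = cnj (h0 p v w) \<and>
        (\<forall>u\<in>carrier (fibre E p). h0 p v (w \<oplus>\<^bsub>fibre E p\<^esub> u) = h0 p v w + h0 p v u) \<and>
        (\<forall>c. h0 p v (c \<odot>\<^bsub>fibre E p\<^esub> w) = c * h0 p v w)"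
    using hermitian unfolding hermitian_vector_bundle_def by (elim conjE)
  note * = bspec[OF bspec[OF spec[OF this] assms(1)] assms(2)]
  show "h0 p w v = cnj (h0 p v w)" by (rule conjunct1[OF *])
  show "\<And>u. u \<in> carrier (fibre E p) \<Longrightarrow> h0 p v (w \<oplus>\<^bsub>fibre E p\<^esub> u) = h0 p v w + h0 p v u"
    by (rule bspec[OF conjunct1[OF conjunct2[OF *]]])
  show "\<And>c. h0 p v (c \<odot>\<^bsub>fibre E p\<^esub> w) = c * h0 p v w"
    by (rule spec[OF conjunct2[OF conjunct2[OF *]]])
qed

lemma form_cnj: "form p w z = cnj (form p z w)"
  unfolding form_def by (rule h0_axioms(1)) simp_all

lemma form_add_right: "form p z (w + u) = form p z w + form p z u"
  unfolding form_def lift_add by (rule h0_axioms(2)) simp_all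

lemma form_scale_right: "form p z (c *s w) = c * form p z w"
  unfolding form_def lift_scale by (rule h0_axioms(3)) simp_all

lemma form_pos:
  assumes "z \<noteq> 0" shows "form p z z \<in> \<real>" "Re (form p z z) > 0"
proof -
  have "lift p z \<noteq> \<zero>\<^bsub>fibre E p\<^esub>" using assms coord_lift coord_zero by metis
  then show "form p z z \<in> \<real>" "Re (form p z z) > 0"
  proof -
    have *: "\<forall>p. \<forall>v\<in>carrier (fibre E p). v \<noteq> \<zero>\<^bsub>fibre E p\<^esub> \<longrightarrow> h0 p v v \<in> \<real> \<and> Re (h0 p v v) > 0"
      using hermitian unfolding hermitian_vector_bundle_def by (elim conjE)
    from \<open>lift p z \<noteq> _\<close> bspec[OF spec[OF *, of p] lift_closed, of z]
    show "form p z z \<in> \<real>" "Re (form p z z) > 0" by (simp_all add: form_def)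
  qed
qed

lemma form_add_left: "form p (w + u) z = form p w z + form p u z"
  by (metis form_cnj form_add_right complex_cnj_add)

lemma form_scale_left: "form p (c *s w) z = cnj c * form p w z"
  by (metis form_cnj form_scale_right complex_cnj_mult)

lemma form_0_right: "form p z 0 = 0"
  using form_scale_right[of p z 0 0] by simp

lemma form_0_left: "form p 0 z = 0"
  using form_scale_left[of p 0 0 z] by simp

lemma form_sum_right: "form p z (\<Sum>i\<in>I. f i) = (\<Sum>i\<in>I. form p z (f i))"
  by (induction I rule: infinite_finite_induct) (auto simp: form_0_right form_add_right)

lemma form_sum_left: "form p (\<Sum>i\<in>I. f i) z = (\<Sum>i\<in>I. form p (f i) z)"
  by (induction I rule: infinite_finite_induct) (auto simp: form_0_left form_add_left)

text \<open>Near a point both sections are expanded in a frame of constant sections. The components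
  are smooth, and so are the entries of the Gram matrix of that frame, by the definition of a
  Hermitian bundle.\<close>

lemma smooth_map_form:
  assumes W: "open W" and \<sigma>: "smooth_section W \<sigma>" "smooth_section W \<sigma>'"
  shows "smooth_map M W (\<lambda>p. form p (\<sigma> p) (\<sigma>' p))"
proof (rule smooth_map_local[OF W])
  fix p assume "p \<in> W"
  obtain U \<tau> where T: "(U, \<tau>) \<in> trivialisations E" "p \<in> U" by (rule trivialisation_at)
  have o: "open (U \<inter> W)" using W trivialisation_open[OF T(1)] by auto
  have ff: "smooth_map M (U \<inter> W) (\<lambda>p. form p (frame \<tau> z p) (frame \<tau> z' p))" for z z'
  proof -
    have "smooth_map M U (\<lambda>p. h0 p (inv_into (carrier (fibre E p)) (\<tau> p) z)
                                (inv_into (carrier (fibre E p)) (\<tau> p) z'))"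
    proof -
      have "\<forall>(U, \<tau>)\<in>trivialisations E. \<forall>z z'.
        smooth_map M U (\<lambda>p. h0 p (inv_into (carrier (fibre E p)) (\<tau> p) z)
                                (inv_into (carrier (fibre E p)) (\<tau> p) z'))"
        using hermitian unfolding hermitian_vector_bundle_def by (elim conjE)
      from bspec[OF this T(1), unfolded prod.case] show ?thesis by blast
    qed
    then have "smooth_map M (U \<inter> W) (\<lambda>p. h0 p (inv_into (carrier (fibre E p)) (\<tau> p) z)
                                (inv_into (carrier (fibre E p)) (\<tau> p) z'))"
      by (rule smooth_map_subset) auto
    then show ?thesis
      by (subst smooth_map_cong[OF o]) (auto simp: form_def lift_frame[OF T(1)])
  qed
  have comp: "smooth_map M (U \<inter> W) (\<lambda>p. \<tau> p (lift p (s p)) $ a)" if "smooth_section W s" for s a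
    by (rule smooth_map_linear[OF bounded_linear_vec_nth smooth_sectionD[OF that T(1)]])
  have "smooth_map M (U \<inter> W) (\<lambda>p. \<Sum>a\<in>UNIV. cnj (\<tau> p (lift p (\<sigma> p)) $ a) *
      (\<Sum>b\<in>UNIV. \<tau> p (lift p (\<sigma>' p)) $ b * form p (frame \<tau> (axis a 1) p) (frame \<tau> (axis b 1) p)))"
    by (intro smooth_map_sum smooth_map_mult ff comp \<sigma> smooth_map_linear[OF bounded_linear_cnj])
  moreover have "form p (\<sigma> p) (\<sigma>' p) = (\<Sum>a\<in>UNIV. cnj (\<tau> p (lift p (\<sigma> p)) $ a) *
      (\<Sum>b\<in>UNIV. \<tau> p (lift p (\<sigma>' p)) $ b * form p (frame \<tau> (axis a 1) p) (frame \<tau> (axis b 1) p)))"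
    if "p \<in> U" for p
    by (subst frame_expansion[OF T(1) that, of "\<sigma> p"], subst frame_expansion[OF T(1) that, of "\<sigma>' p"])
       (simp only: form_sum_left form_scale_left, simp only: form_sum_right form_scale_right)
  ultimately have "smooth_map M (U \<inter> W) (\<lambda>p. form p (\<sigma> p) (\<sigma>' p))"
    by (subst smooth_map_cong[OF o]) auto
  then show "\<exists>N. open N \<and> p \<in> N \<and> smooth_map M (W \<inter> N) (\<lambda>p. form p (\<sigma> p) (\<sigma>' p))"
    using T trivialisation_open[OF T(1)] by (auto simp: Int_commute)
qed

end

section \<open>Finitely many sections spanning every fibre\<close>

lemma differentiable_on_sum:
  "(\<And>i. i \<in> I \<Longrightarrow> f i differentiable_on S) \<Longrightarrow> (\<lambda>x. \<Sum>i\<in>I. f i x) differentiable_on S"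
  by (induction I rule: infinite_finite_induct) auto

text \<open>Choosing the vectors \<open>c y\<close> one after the other, each one has to avoid the image of a
  lower-dimensional space, which is negligible.\<close>

lemma generic_translation:
  fixes \<alpha> :: "'y::euclidean_space \<Rightarrow> 'e::euclidean_space \<Rightarrow> 'w::euclidean_space"
  assumes dim: "DIM('e) + DIM('y) < DIM('w)"
    and \<alpha>: "\<And>y. y \<in> Basis \<Longrightarrow> \<alpha> y differentiable_on V"
    and F: "finite F" "F \<subseteq> Basis"
  shows "\<exists>c. \<forall>x\<in>V. \<forall>\<xi>. (\<Sum>y\<in>F. (\<xi> \<bullet> y) *\<^sub>R (\<alpha> y x + c y)) = 0 \<longrightarrow> (\<forall>y\<in>F. \<xi> \<bullet> y = 0)"
  using F
proof (induction F rule: finite_induct)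
  case (insert z F)
  then obtain c where c: "\<And>x \<xi>. x \<in> V \<Longrightarrow> (\<Sum>y\<in>F. (\<xi> \<bullet> y) *\<^sub>R (\<alpha> y x + c y)) = 0 \<Longrightarrow> \<forall>y\<in>F. \<xi> \<bullet> y = 0"
    by auto
  \<comment> \<open>A relation with nonzero coefficient at z can be scaled to have coefficient -1
    there; it then expresses the unknown vector at z as \<open>g (x, \<xi>)\<close>. So every vector
    outside the image of g is admissible.\<close>
  define g where "g = (\<lambda>u. (\<Sum>y\<in>F. (snd u \<bullet> y) *\<^sub>R (\<alpha> y (fst u) + c y)) - \<alpha> z (fst u))"
  have fst_diff: "(\<lambda>u :: 'e \<times> 'y. \<alpha> y (fst u)) differentiable_on (V \<times> UNIV)" if "y \<in> Basis" for y
  proof -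
    have "\<alpha> y differentiable_on fst ` (V \<times> (UNIV :: 'y set))"
      using \<alpha>[OF that] by simp
    then show ?thesis
      by (rule differentiable_on_compose[OF linear_imp_differentiable_on[OF linear_fst]])
  qed
  have "(\<lambda>u :: 'e \<times> 'y. snd u \<bullet> y) differentiable_on (V \<times> UNIV)" for y
  proof -
    have "linear (\<lambda>u :: 'e \<times> 'y. snd u \<bullet> y)"
      by (intro linearI) (auto simp: inner_add_left)
    then show ?thesis by (rule linear_imp_differentiable_on)
  qed
  then have "g differentiable_on (V \<times> UNIV)"
    unfolding g_def using insert.prems insert.hyps
    by (intro differentiable_on_diff differentiable_on_sum differentiable_on_scaleR differentiable_on_add
        differentiable_on_const fst_diff) auto
  then have "negligible (g ` (V \<times> UNIV))"
    by (rule negligible_differentiable_image_lowdim[rotated]) (use dim in simp)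
  then obtain w where w: "w \<notin> g ` (V \<times> UNIV)" by (metis UNIV_eq_I non_negligible_UNIV)
  show ?case
  proof (intro exI[of _ "c(z := w)"] ballI allI impI)
    fix x \<xi> v
    assume x: "x \<in> V" and v: "v \<in> insert z F"
      and eq: "(\<Sum>y\<in>insert z F. (\<xi> \<bullet> y) *\<^sub>R (\<alpha> y x + (c(z := w)) y)) = 0"
    have "(\<Sum>y\<in>F. (\<xi> \<bullet> y) *\<^sub>R (\<alpha> y x + (c(z := w)) y)) = (\<Sum>y\<in>F. (\<xi> \<bullet> y) *\<^sub>R (\<alpha> y x + c y))"
      using insert.hyps by (intro sum.cong) auto
    with eq have eq': "(\<xi> \<bullet> z) *\<^sub>R (\<alpha> z x + w) + (\<Sum>y\<in>F. (\<xi> \<bullet> y) *\<^sub>R (\<alpha> y x + c y)) = 0"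
      using insert.hyps by simp
    have z0: "\<xi> \<bullet> z = 0"
    proof (rule ccontr)
      assume nz: "\<xi> \<bullet> z \<noteq> 0"
      define \<eta> where "\<eta> = (- 1 / (\<xi> \<bullet> z)) *\<^sub>R \<xi>"
      have \<eta>: "(- 1 / (\<xi> \<bullet> z)) *\<^sub>R (\<Sum>y\<in>F. (\<xi> \<bullet> y) *\<^sub>R (\<alpha> y x + c y)) =
          (\<Sum>y\<in>F. (\<eta> \<bullet> y) *\<^sub>R (\<alpha> y x + c y))"
        by (simp add: \<eta>_def scaleR_right.sum sum_negf divide_inverse)
      have "- (\<alpha> z x + w) + (\<Sum>y\<in>F. (\<eta> \<bullet> y) *\<^sub>R (\<alpha> y x + c y)) =
          (- 1 / (\<xi> \<bullet> z)) *\<^sub>R ((\<xi> \<bullet> z) *\<^sub>R (\<alpha> z x + w) + (\<Sum>y\<in>F. (\<xi> \<bullet> y) *\<^sub>R (\<alpha> y x + c y)))"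
        unfolding \<eta>[symmetric] scaleR_right_distrib[of "- 1 / (\<xi> \<bullet> z)" "(\<xi> \<bullet> z) *\<^sub>R _"] using nz by simp
      also have "\<dots> = 0" by (simp add: eq')
      finally have "- (\<alpha> z x + w) + (\<Sum>y\<in>F. (\<eta> \<bullet> y) *\<^sub>R (\<alpha> y x + c y)) = 0" .
      then have "w = g (x, \<eta>)" by (simp add: g_def algebra_simps)
      then show False using w x by auto
    qed
    then show "\<xi> \<bullet> v = 0" using eq' c[OF x, of \<xi>] v by auto
  qed
qed simp

context hermitian_bundle
begin

lemma span_triv:
  assumes "(U, \<tau>) \<in> trivialisations E" "p \<in> U"
  shows "span ((\<lambda>z. \<tau> p (lift p z)) ` S) = UNIV \<longleftrightarrow> span S = UNIV"
proof -
  have lin: "linear (\<lambda>z. \<tau> p (lift p z))"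
    by (intro linearI triv_add[OF assms] triv_scaleR[OF assms])
  have inj: "inj (\<lambda>z. \<tau> p (lift p z))" using triv_inj[OF assms] by (rule injI)
  have surj: "surj (\<lambda>z. \<tau> p (lift p z))"
    using triv_frame[OF assms] by (metis surj_def)
  have "span ((\<lambda>z. \<tau> p (lift p z)) ` S) = (\<lambda>z. \<tau> p (lift p z)) ` span S"
    by (rule linear_span_image[OF lin])
  also have "\<dots> = UNIV \<longleftrightarrow> span S = UNIV"
    using inj surj by (metis inj_image_eq_iff)
  finally show ?thesis .
qed

text \<open>At a point, the sections form a real matrix with one column per basis vector w. They
  span the fibre if and only if the transposed map is injective, which is the form in which
  \<open>generic_translation\<close> yields genericity. Adding frame vectors cut off by \<rho>
  translates the transposed vectors by \<rho> p times fixed vectors \<open>c y\<close>. No smallness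
  is required: where \<rho> vanishes nothing changes, and elsewhere the new family spans regardless
  of the old one.\<close>

lemma spanning_step:
  fixes t :: "('e \<times> (complex ^ 'k) \<times> real) \<Rightarrow> 'm \<Rightarrow> complex ^ 'k"
  assumes chart: "(U, \<phi>) \<in> charts M" and triv: "(U', \<tau>) \<in> trivialisations E"
    and \<rho>: "smooth_map M UNIV \<rho>" "closed L" "L \<subseteq> U \<inter> U'" "\<And>q. q \<notin> L \<Longrightarrow> \<rho> q = (0::real)"
    and t: "\<And>w. smooth_section UNIV (t w)"
  shows "\<exists>t'. (\<forall>w. smooth_section UNIV (t' w)) \<and> (\<forall>w p. \<rho> p = 0 \<longrightarrow> t' w p = t w p) \<and>
    (\<forall>p. \<rho> p \<noteq> 0 \<longrightarrow> span ((\<lambda>w. t' w p) ` Basis) = UNIV)"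
proof -
  define P where "P = U \<inter> {p. \<rho> p \<noteq> 0}"
  have P: "open P" unfolding P_def
    using chart_open[OF chart] smooth_map_continuous[OF open_UNIV \<rho>(1)]
    by (intro open_Int open_Collect_neq) auto
  have PU: "P \<subseteq> U'" "P \<subseteq> U" using \<rho> by (auto simp: P_def)
  define a where "a w p = \<tau> p (lift p (t w p))" for w p
  have a: "smooth_map M P (a w)" for w
    unfolding a_def using smooth_map_subset[OF smooth_sectionD[OF t triv, of w]] PU by simp
  \<comment> \<open>The row of the matrix that belongs to y, as a vector of the index space of the
    sections.\<close>
  define \<alpha> where "\<alpha> y p = (\<Sum>w\<in>Basis. (y \<bullet> a w p) *\<^sub>R w)" for y p
  have \<alpha>: "smooth_map M P (\<alpha> y)" for y
    unfolding \<alpha>_def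
    by (intro smooth_map_sum smooth_map_bilinear[OF bounded_bilinear_scaleR]
        smooth_map_bilinear[OF bounded_bilinear_inner] smooth_map_const a)
  have \<rho>P: "smooth_map M P (\<lambda>p. \<rho> p)" using smooth_map_subset[OF \<rho>(1)] by simp
  have diff: "(f \<circ> inv_into U \<phi>) differentiable_on (\<phi> ` P)" if "smooth_map M P f"
    for f :: "'m \<Rightarrow> 'z::real_normed_vector"
  proof -
    have "U \<inter> P = P" using PU by auto
    then show ?thesis
      using Ck_on_differentiable[OF model_basis chart_openin[OF chart P] smooth_map_chartD[OF that chart]]
      by simp
  qed
  \<comment> \<open>Dividing by \<rho> turns the translation by \<rho> p times \<open>c y\<close>
    into one that does not depend on the point.\<close>
  define \<beta> where "\<beta> y = (\<lambda>x. inverse (\<rho> (inv_into U \<phi> x)) *\<^sub>R \<alpha> y (inv_into U \<phi> x))" for y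
  have "\<beta> y differentiable_on \<phi> ` P" for y
    unfolding \<beta>_def
  proof (rule differentiable_on_scaleR)
    show "(\<lambda>x. \<alpha> y (inv_into U \<phi> x)) differentiable_on \<phi> ` P"
      using diff[OF \<alpha>[of y]] by (simp add: o_def)
    have "inv_into U \<phi> (\<phi> p) = p" if "p \<in> P" for p
      using chart_inv[OF chart] that PU by auto
    then show "(\<lambda>x. inverse (\<rho> (inv_into U \<phi> x))) differentiable_on \<phi> ` P"
      using diff[OF \<rho>P] by (intro differentiable_on_inverse) (auto simp: o_def P_def)
  qed
  \<comment> \<open>The summand \<open>real\<close> of the index space supplies the strict
    inequality of dimensions.\<close>
  then have "\<exists>c :: complex ^ 'k \<Rightarrow> 'e \<times> (complex ^ 'k) \<times> real. \<forall>x\<in>\<phi> ` P. \<forall>\<xi>.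
      (\<Sum>y\<in>Basis. (\<xi> \<bullet> y) *\<^sub>R (\<beta> y x + c y)) = 0 \<longrightarrow> (\<forall>y\<in>Basis. \<xi> \<bullet> y = 0)"
    by (intro generic_translation) auto
  then obtain c :: "complex ^ 'k \<Rightarrow> 'e \<times> (complex ^ 'k) \<times> real" where
    c: "\<forall>x\<in>\<phi> ` P. \<forall>\<xi>. (\<Sum>y\<in>Basis. (\<xi> \<bullet> y) *\<^sub>R (\<beta> y x + c y)) = 0 \<longrightarrow> (\<forall>y\<in>Basis. \<xi> \<bullet> y = 0)"
    ..
  define t' where "t' w p = t w p + (\<Sum>y\<in>Basis. (\<rho> p * (c y \<bullet> w)) *\<^sub>R frame \<tau> y p)" for w p
  have "smooth_section UNIV (t' w)" for w
    unfolding t'_def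
  proof (intro smooth_section_add smooth_section_sum t open_UNIV)
    fix y
    show "smooth_section UNIV (\<lambda>p. (\<rho> p * (c y \<bullet> w)) *\<^sub>R frame \<tau> y p)"
    proof (rule smooth_section_local)
      fix p
      show "\<exists>N. open N \<and> p \<in> N \<and> smooth_section (UNIV \<inter> N) (\<lambda>p. (\<rho> p * (c y \<bullet> w)) *\<^sub>R frame \<tau> y p)"
      proof (cases "p \<in> L")
        case True
        have "smooth_section U' (\<lambda>p. (\<rho> p * (c y \<bullet> w)) *\<^sub>R frame \<tau> y p)"
          by (intro smooth_section_scaleR trivialisation_open[OF triv] smooth_frame[OF triv] smooth_map_mult
              smooth_map_const smooth_map_subset[OF \<rho>(1)]) auto
        then show ?thesis using True \<rho> trivialisation_open[OF triv] by auto
      next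
        case False
        have "smooth_section (- L) (\<lambda>p. (\<rho> p * (c y \<bullet> w)) *\<^sub>R frame \<tau> y p)"
          by (subst smooth_section_cong[where \<sigma>' = "\<lambda>p. 0"]) (use \<rho> in \<open>auto intro: smooth_section_0\<close>)
        then show ?thesis using False \<rho> by auto
      qed
    qed auto
  qed
  moreover have "t' w p = t w p" if "\<rho> p = 0" for w p
    by (simp add: t'_def that)
  moreover have "span ((\<lambda>w. t' w p) ` Basis) = UNIV" if p: "\<rho> p \<noteq> 0" for p
  proof -
    have pP: "p \<in> P" "p \<in> U'" "p \<in> U" using p \<rho> by (auto simp: P_def)
    note T = triv pP(2)
    define a' where "a' w = \<tau> p (lift p (t' w p))" for w
    have a': "a' w = a w p + \<rho> p *\<^sub>R (\<Sum>y\<in>Basis. (c y \<bullet> w) *\<^sub>R y)" for w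
      by (simp add: a'_def t'_def a_def triv_add[OF T] triv_sum[OF T] triv_scaleR[OF T] triv_frame[OF T]
          scaleR_right.sum)
    have "span (a' ` Basis) = UNIV"
    proof (rule ccontr)
      assume "span (a' ` Basis) \<noteq> UNIV"
      \<comment> \<open>A vector orthogonal to all the sections lies in the kernel of the transposed
        map.\<close>
      then obtain \<xi> where \<xi>: "\<xi> \<noteq> 0" "\<And>x. x \<in> span (a' ` Basis) \<Longrightarrow> \<xi> \<bullet> x = 0"
        using span_not_UNIV_orthogonal by metis
      have "0 = (\<Sum>w\<in>Basis. (\<xi> \<bullet> a' w) *\<^sub>R w)"
        by (rule sum.neutral[symmetric]) (simp add: \<xi>(2)[OF span_base[OF imageI]])
      also have "\<dots> = \<alpha> \<xi> p + \<rho> p *\<^sub>R (\<Sum>w\<in>Basis. (\<Sum>y\<in>Basis. (c y \<bullet> w) * (\<xi> \<bullet> y)) *\<^sub>R w)"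
        by (simp add: a' \<alpha>_def inner_add_right scaleR_left_distrib sum.distrib inner_sum_right scaleR_right.sum
            sum_distrib_left mult.assoc)
      also have "(\<Sum>w\<in>Basis. (\<Sum>y\<in>Basis. (c y \<bullet> w) * (\<xi> \<bullet> y)) *\<^sub>R w) =
          (\<Sum>y\<in>Basis. (\<xi> \<bullet> y) *\<^sub>R (\<Sum>w\<in>Basis. (c y \<bullet> w) *\<^sub>R w))"
        unfolding scaleR_left.sum scaleR_right.sum
        by (subst sum.swap) (simp add: mult.commute)
      also have "\<dots> = (\<Sum>y\<in>Basis. (\<xi> \<bullet> y) *\<^sub>R c y)"
        by (simp only: euclidean_representation)
      also have "\<alpha> \<xi> p = (\<Sum>y\<in>Basis. (\<xi> \<bullet> y) *\<^sub>R \<alpha> y p)"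
      proof -
        have "(\<xi> \<bullet> a w p) = (\<Sum>y\<in>Basis. (\<xi> \<bullet> y) * (y \<bullet> a w p))" for w
          by (subst euclidean_inner) (simp add: inner_commute)
        then show ?thesis
          unfolding \<alpha>_def scaleR_right.sum by (subst sum.swap) (simp add: scaleR_left.sum)
      qed
      finally have "(\<Sum>y\<in>Basis. (\<xi> \<bullet> y) *\<^sub>R \<alpha> y p) + \<rho> p *\<^sub>R (\<Sum>y\<in>Basis. (\<xi> \<bullet> y) *\<^sub>R c y) = 0" ..
      then have "inverse (\<rho> p) *\<^sub>R ((\<Sum>y\<in>Basis. (\<xi> \<bullet> y) *\<^sub>R \<alpha> y p) + \<rho> p *\<^sub>R (\<Sum>y\<in>Basis. (\<xi> \<bullet> y) *\<^sub>R c y)) = 0"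
        by simp
      then have "inverse (\<rho> p) *\<^sub>R (\<Sum>y\<in>Basis. (\<xi> \<bullet> y) *\<^sub>R \<alpha> y p) + (\<Sum>y\<in>Basis. (\<xi> \<bullet> y) *\<^sub>R c y) = 0"
        using p by (simp only: scaleR_right_distrib scaleR_scaleR left_inverse[OF p] scaleR_one)
      then have "(\<Sum>y\<in>Basis. (\<xi> \<bullet> y) *\<^sub>R (\<beta> y (\<phi> p) + c y)) = 0"
        using p chart_inv[OF chart pP(3)]
        by (simp add: \<beta>_def scaleR_right_distrib scaleR_right.sum sum.distrib mult.left_commute mult.commute)
      then have "\<forall>y\<in>Basis. \<xi> \<bullet> y = 0" using c pP by blast
      then show False using \<xi>(1) euclidean_all_zero_iff by blast
    qed
    moreover have "a' ` Basis = (\<lambda>z. \<tau> p (lift p z)) ` (\<lambda>w. t' w p) ` Basis"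
      by (simp add: a'_def image_image)
    ultimately show ?thesis using span_triv[OF T] by simp
  qed
  ultimately show ?thesis by blast
qed

text \<open>One step is made for each function of a locally finite family of cut-offs inside
  trivialised charts. Near any point only finitely many steps change the sections, so the sequence
  of families becomes stationary there and its limit is smooth. Spanning is over the reals, as in
  the genericity argument.\<close>

lemma finitely_many_spanning_sections:
  obtains t :: "('e \<times> (complex ^ 'k) \<times> real) \<Rightarrow> 'm \<Rightarrow> complex ^ 'k"
  where "\<And>w. smooth_section UNIV (t w)" "\<And>p. span ((\<lambda>w. t w p) ` Basis) = UNIV"
proof -
  have cover: "\<exists>W. open W \<and> p \<in> W \<and>
      (\<exists>U \<phi> U' \<tau>. (U, \<phi>) \<in> charts M \<and> (U', \<tau>) \<in> trivialisations E \<and> W \<subseteq> U \<inter> U')" for p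
  proof -
    obtain U \<phi> where 1: "(U, \<phi>) \<in> charts M" "p \<in> U" by (rule chart_at)
    obtain U' \<tau> where 2: "(U', \<tau>) \<in> trivialisations E" "p \<in> U'" by (rule trivialisation_at)
    show ?thesis
      using 1 2 chart_open[OF 1(1)] trivialisation_open[OF 2(1)]
      by (intro exI[of _ "U \<inter> U'"]) blast
  qed
  obtain \<rho> :: "nat \<Rightarrow> 'm \<Rightarrow> real" and W L where \<rho>:
    "\<And>n. smooth_map M UNIV (\<rho> n)" "\<And>n q. \<rho> n q \<ge> 0"
    "\<And>n. open (W n)" "\<And>n. \<exists>U \<phi> U' \<tau>. (U, \<phi>) \<in> charts M \<and> (U', \<tau>) \<in> trivialisations E \<and> W n \<subseteq> U \<inter> U'"
    "\<And>n. closed (L n)" "\<And>n. L n \<subseteq> W n"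
    "\<And>n q. q \<notin> L n \<Longrightarrow> \<rho> n q = 0" "\<And>p. \<exists>n. \<rho> n p > 0"
    "\<And>p. \<exists>N n0. open N \<and> p \<in> N \<and> (\<forall>n\<ge>n0. \<forall>q\<in>N. \<rho> n q = 0)"
    by (rule locally_finite_refinement[OF cover]) blast
  define good :: "nat \<Rightarrow> (('e \<times> (complex ^ 'k) \<times> real) \<Rightarrow> 'm \<Rightarrow> complex ^ 'k) \<Rightarrow> bool" where
    "good n t \<longleftrightarrow> (\<forall>w. smooth_section UNIV (t w)) \<and>
       (\<forall>p. (\<exists>j<n. \<rho> j p > 0) \<longrightarrow> span ((\<lambda>w. t w p) ` Basis) = UNIV)" for n t
  have "\<exists>f. \<forall>n. good n (f n) \<and> (\<forall>w p. \<rho> n p = 0 \<longrightarrow> f (Suc n) w p = f n w p)"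
  proof (rule dependent_nat_choice)
    show "\<exists>t. good 0 t" by (auto simp: good_def intro!: exI[of _ "\<lambda>w p. 0"] smooth_section_0)
    fix t n assume g: "good n t"
    obtain U \<phi> U' \<tau> where c: "(U, \<phi>) \<in> charts M" "(U', \<tau>) \<in> trivialisations E" "W n \<subseteq> U \<inter> U'"
      using \<rho>(4) by blast
    have LU: "L n \<subseteq> U \<inter> U'" using c \<rho>(6) by blast
    have "smooth_section UNIV (t w)" for w using g unfolding good_def by blast
    obtain t' where T: "(\<forall>w. smooth_section UNIV (t' w)) \<and> (\<forall>w p. \<rho> n p = 0 \<longrightarrow> t' w p = t w p) \<and>
      (\<forall>p. \<rho> n p \<noteq> 0 \<longrightarrow> span ((\<lambda>w. t' w p) ` Basis) = UNIV)"
      using spanning_step[OF c(1,2) \<rho>(1)[of n] \<rho>(5)[of n] LU \<rho>(7) \<open>\<And>w. smooth_section UNIV (t w)\<close>] ..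
    note t' = conjunct1[OF T] conjunct1[OF conjunct2[OF T]] conjunct2[OF conjunct2[OF T]]
    have "span ((\<lambda>w. t' w p) ` Basis) = UNIV" if j: "j < Suc n" "\<rho> j p > 0" for j p
    proof (cases "\<rho> n p = 0")
      case True
      then have "j < n" using j by (metis less_irrefl not_less_less_Suc_eq)
      then have *: "span ((\<lambda>w. t w p) ` Basis) = UNIV" using g j(2) unfolding good_def by blast
      have "t' w p = t w p" for w using t'(2) True by blast
      then show ?thesis using * by (simp only:)
    next
      case False
      then show ?thesis using t'(3) by blast
    qed
    then have "good (Suc n) t'" using t'(1) unfolding good_def by blast
    then show "\<exists>t'. good (Suc n) t' \<and> (\<forall>w p. \<rho> n p = 0 \<longrightarrow> t' w p = t w p)"
      using t'(2) by blast
  qed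
  then obtain f where "\<forall>n. good n (f n) \<and> (\<forall>w p. \<rho> n p = 0 \<longrightarrow> f (Suc n) w p = f n w p)" ..
  then have f: "good n (f n)" "\<rho> n p = 0 \<Longrightarrow> f (Suc n) w p = f n w p" for n w p by blast+
  have stab: "f n w p = f n0 w p" if "\<And>n. n \<ge> n0 \<Longrightarrow> \<rho> n p = 0" "n \<ge> n0" for n n0 w p
    using that(2) by (induction n rule: dec_induct) (auto simp: f(2) that(1))
  \<comment> \<open>The stage is chosen for each point separately. By \<open>stab\<close> every
    later stage has the same value, so near a point one common stage describes t.\<close>
  define t where "t w p = f (LEAST n0. \<forall>n\<ge>n0. \<rho> n p = 0) w p" for w p
  have tf: "t w p = f n w p" if "\<And>n. n \<ge> n0 \<Longrightarrow> \<rho> n p = 0" "n \<ge> n0" for n n0 w p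
  proof -
    define m where "m = (LEAST n0. \<forall>n\<ge>n0. \<rho> n p = 0)"
    have m: "\<forall>n\<ge>m. \<rho> n p = 0" unfolding m_def by (rule LeastI[of _ n0]) (use that in blast)
    have "m \<le> n0" unfolding m_def by (rule Least_le) (use that in blast)
    from stab[OF m[rule_format] order_trans[OF this that(2)], of w]
    show ?thesis by (simp only: t_def m_def)
  qed
  show thesis
  proof (rule that[of t])
    fix w show "smooth_section UNIV (t w)"
    proof (rule smooth_section_local)
      fix p
      obtain N n0 where N: "open N" "p \<in> N" "\<forall>n\<ge>n0. \<forall>q\<in>N. \<rho> n q = 0" using \<rho>(9) by blast
      have "smooth_section N (f n0 w)"
        using f(1)[of n0] smooth_section_subset[OF _ subset_UNIV] unfolding good_def by blast
      moreover have "t w q = f n0 w q" if "q \<in> N" for q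
        by (rule tf[of n0]) (use N(3) that in auto)
      ultimately have "smooth_section N (t w)"
        using smooth_section_cong[OF N(1), of "t w" "f n0 w"] by blast
      then show "\<exists>N. open N \<and> p \<in> N \<and> smooth_section (UNIV \<inter> N) (t w)" using N by auto
    qed simp
  next
    fix p
    obtain N n0 where N: "open N" "p \<in> N" "\<forall>n\<ge>n0. \<forall>q\<in>N. \<rho> n q = 0" using \<rho>(9) by blast
    obtain j where j: "\<rho> j p > 0" using \<rho>(8) by blast
    \<comment> \<open>From stage n0 on nothing changes at p, and from stage \<open>Suc j\<close> on
      the step of \<rho> j, which is positive at p, has been made.\<close>
    have "span ((\<lambda>w. f (max n0 (Suc j)) w p) ` Basis) = UNIV"
      using f(1)[of "max n0 (Suc j)"] j less_max_iff_disj[of j n0 "Suc j"] unfolding good_def by blast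
    moreover have "t w p = f (max n0 (Suc j)) w p" for w
      by (rule tf[of n0]) (use N in auto)
    ultimately show "span ((\<lambda>w. t w p) ` Basis) = UNIV" by simp
  qed
qed

end

section \<open>A smooth Parseval frame\<close>

definition residual ::
  "(complex ^ 'k \<Rightarrow> complex ^ 'k \<Rightarrow> complex) \<Rightarrow> (nat \<Rightarrow> complex ^ 'k) \<Rightarrow> nat \<Rightarrow> complex ^ 'k \<Rightarrow> complex ^ 'k"
  where "residual h e n v = v - (\<Sum>b<n. h (e b) v *s e b)"

definition normalise :: "(complex ^ 'k \<Rightarrow> complex ^ 'k \<Rightarrow> complex) \<Rightarrow> complex ^ 'k \<Rightarrow> complex ^ 'k"
  where "normalise h v = complex_of_real (Re (h v v) powr (- 1 / 2)) *s v"

text \<open>Defined for arbitrary sequences: a vanishing residual is normalised to 0. That the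
  process succeeds is expressed later by the residuals being nonzero, an open condition on the base
  point.\<close>

fun gram_schmidt ::
  "(complex ^ 'k \<Rightarrow> complex ^ 'k \<Rightarrow> complex) \<Rightarrow> (nat \<Rightarrow> complex ^ 'k) \<Rightarrow> nat \<Rightarrow> complex ^ 'k" where
  "gram_schmidt h s n =
     normalise h (s n - (\<Sum>b<n. h (gram_schmidt h s b) (s n) *s gram_schmidt h s b))"

declare gram_schmidt.simps [simp del]

lemma gram_schmidt: "gram_schmidt h s n = normalise h (residual h (gram_schmidt h s) n (s n))"
  by (subst gram_schmidt.simps) (simp add: residual_def)

text \<open>The derivatives of x^(-1/2) of all orders on the positive axis, in the shape that
  \<open>smooth_map_compose\<close> asks for; n = 0 is the function itself.\<close>

lemma DERIV_rsqrt_seq: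
  fixes x :: real
  assumes "x \<in> {0<..}"
  shows "((\<lambda>x. (\<Prod>i<n. - 1 / 2 - real i) * x powr (- 1 / 2 - real n)) has_real_derivative
    (\<Prod>i<Suc n. - 1 / 2 - real i) * x powr (- 1 / 2 - real (Suc n))) (at x)"
  using assms by (auto intro!: derivative_eq_intros simp: algebra_simps)

context smooth_mfd
begin

lemma smooth_map_rsqrt:
  fixes f :: "'m \<Rightarrow> real"
  assumes "smooth_map M W f" "\<And>p. p \<in> W \<Longrightarrow> f p > 0"
  shows "smooth_map M W (\<lambda>p. f p powr (- 1 / 2))"
proof -
  have "smooth_map M W (\<lambda>p. (\<Prod>i<0. - 1 / 2 - real i) * f p powr (- 1 / 2 - real 0))"
    by (rule smooth_map_compose[where S = "{0<..}" and
          d = "\<lambda>n x. (\<Prod>i<n. - 1 / 2 - real i) * x powr (- 1 / 2 - real n)"],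
        erule DERIV_rsqrt_seq, rule assms(1), simp add: assms(2))
  then show ?thesis by simp
qed

end

context hermitian_bundle
begin

section \<open>Orthonormal systems in a fibre\<close>

definition orthonormal :: "'m \<Rightarrow> (nat \<Rightarrow> complex ^ 'k) \<Rightarrow> nat \<Rightarrow> bool" where
  "orthonormal p e n \<longleftrightarrow> (\<forall>b<n. \<forall>c<n. form p (e b) (e c) = (if b = c then 1 else 0))"

lemma form_diff_right: "form p z (w - u) = form p z w - form p z u"
  by (metis add_diff_cancel diff_add_cancel form_add_right)

lemma form_residual:
  assumes "orthonormal p e n" "b < n"
  shows "form p (e b) (residual (form p) e n v) = 0"
proof -
  have "(\<Sum>c<n. form p (e c) v * form p (e b) (e c)) = (\<Sum>c<n. if c = b then form p (e b) v else 0)"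
    using assms by (intro sum.cong) (auto simp: orthonormal_def)
  then show ?thesis
    using assms by (simp add: residual_def form_diff_right form_sum_right form_scale_right)
qed

lemma form_normalise:
  assumes "g \<noteq> 0" shows "form p (normalise (form p) g) (normalise (form p) g) = 1"
proof -
  define r where "r = Re (form p g g)"
  have r: "r > 0" "form p g g = complex_of_real r"
    using form_pos[OF assms, of p] by (auto simp: r_def complex_is_Real_iff complex_eq_iff)
  have "(r powr (- 1 / 2)) * (r powr (- 1 / 2)) * r = 1"
    using r(1) by (simp add: powr_add[symmetric] powr_minus field_simps)
  then have "complex_of_real ((r powr (- 1 / 2)) * (r powr (- 1 / 2)) * r) = 1" by simp
  then show ?thesis
    by (simp add: normalise_def form_scale_left form_scale_right r_def[symmetric] r(2) mult_ac)
qed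

lemma orthonormal_extend:
  assumes "orthonormal p e n" "g \<noteq> 0" "\<And>b. b < n \<Longrightarrow> form p (e b) g = 0"
    and e': "\<And>b. b < n \<Longrightarrow> e' b = e b" "e' n = normalise (form p) g"
  shows "orthonormal p e' (Suc n)"
proof -
  have 1: "form p (e b) (normalise (form p) g) = 0" if "b < n" for b
    using assms(3)[OF that] by (simp add: normalise_def form_scale_right)
  have 2: "form p (normalise (form p) g) (e b) = 0" if "b < n" for b
    using 1[OF that] form_cnj[of p "e b" "normalise (form p) g"] by (metis complex_cnj_zero_iff)
  show ?thesis
    unfolding orthonormal_def
  proof (intro allI impI)
    fix b c assume "b < Suc n" "c < Suc n"
    then consider "b < n" "c < n" | "b < n" "c = n" | "b = n" "c < n" | "b = n" "c = n" by linarith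
    then show "form p (e' b) (e' c) = (if b = c then 1 else 0)"
      using assms(1) 1 2 form_normalise[OF assms(2)]
      by cases (auto simp: e' orthonormal_def)
  qed
qed

lemma orthonormal_gram_schmidt:
  "(\<And>b. b < n \<Longrightarrow> residual (form p) (gram_schmidt (form p) s) b (s b) \<noteq> 0) \<Longrightarrow>
    orthonormal p (gram_schmidt (form p) s) n"
proof (induction n)
  case (Suc n)
  then have "orthonormal p (gram_schmidt (form p) s) n" by simp
  then show ?case
    by (rule orthonormal_extend[where g = "residual (form p) (gram_schmidt (form p) s) n (s n)"])
       (use Suc.prems form_residual[OF \<open>orthonormal p (gram_schmidt (form p) s) n\<close>] gram_schmidt in auto)
qed (simp add: orthonormal_def)

lemma orthonormal_card_le:
  assumes "orthonormal p e n" shows "n \<le> CARD('k)"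
proof -
  have inj: "inj_on e {..<n}"
  proof (rule inj_onI)
    fix b c assume "b \<in> {..<n}" "c \<in> {..<n}" "e b = e c"
    then show "b = c" using assms unfolding orthonormal_def
      by (metis lessThan_iff zero_neq_one)
  qed
  have "vec.independent (e ` {..<n})"
  proof (rule vec.independent_if_scalars_zero)
    fix f x assume f: "(\<Sum>x\<in>e ` {..<n}. f x *s x) = 0" and "x \<in> e ` {..<n}"
    then obtain b where b: "b < n" "x = e b" by auto
    have "0 = form p (e b) (\<Sum>c<n. f (e c) *s e c)"
      using f by (simp add: sum.reindex[OF inj] form_0_right)
    also have "\<dots> = (\<Sum>c<n. if c = b then f (e b) else 0)"
      using assms b unfolding form_sum_right form_scale_right
      by (intro sum.cong) (auto simp: orthonormal_def)
    finally show "f x = 0" using b by simp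
  qed simp
  then have "card (e ` {..<n}) \<le> vec.dim (UNIV :: (complex ^ 'k) set)"
    by (intro vec.independent_card_le_dim) auto
  then show ?thesis unfolding vec_dim_card card_image[OF inj] by simp
qed

text \<open>Otherwise the normalised residual would extend the system to one more orthonormal vector
  than the dimension permits.\<close>

lemma orthonormal_expansion:
  assumes "orthonormal p e CARD('k)"
  shows "(\<Sum>b<CARD('k). form p (e b) v *s e b) = v"
proof (rule ccontr)
  assume "\<not> ?thesis"
  then have "residual (form p) e CARD('k) v \<noteq> 0" by (auto simp: residual_def)
  from orthonormal_extend[OF assms this form_residual[OF assms],
      of "e(CARD('k) := normalise (form p) (residual (form p) e CARD('k) v))"]
  show False using orthonormal_card_le by fastforce
qed

text \<open>If all residuals vanished, S would lie in the complex span of n vectors. That span is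
  also a real subspace, so it would contain the real span of S, which is everything, although n is
  smaller than the complex dimension.\<close>

lemma residual_nonzero:
  assumes "orthonormal p e n" "n < CARD('k)" "span S = UNIV"
  shows "\<exists>v\<in>S. residual (form p) e n v \<noteq> 0"
proof (rule ccontr)
  assume neg: "\<not> ?thesis"
  let ?X = "vec.span (e ` {..<n})"
  have "S \<subseteq> ?X"
  proof
    fix v assume "v \<in> S"
    with neg have "v = (\<Sum>b<n. form p (e b) v *s e b)" by (auto simp: residual_def)
    also have "\<dots> \<in> ?X" by (intro vec.span_sum vec.span_scale vec.span_base) auto
    finally show "v \<in> ?X" .
  qed
  moreover have "subspace ?X"
    unfolding subspace_def scaleR_eq_vector_scale
    by (auto intro: vec.span_zero vec.span_add vec.span_scale)
  ultimately have "span S \<subseteq> ?X" by (rule span_minimal)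
  then have "vec.dim (UNIV :: (complex ^ 'k) set) \<le> card (e ` {..<n})"
    using assms(3) by (intro vec.dim_le_card) auto
  also have "\<dots> \<le> n" using card_image_le[of "{..<n}" e] by simp
  finally show False using assms(2) unfolding vec_dim_card by simp
qed

lemma form_self_pos_iff: "Re (form p g g) > 0 \<longleftrightarrow> g \<noteq> 0"
  using form_pos(2)[of g p] by (auto simp: form_0_right)

section \<open>Dependence of Gram-Schmidt on the base point\<close>

lemma smooth_residual:
  assumes "open W" "\<And>b. b < n \<Longrightarrow> smooth_section W (\<lambda>p. e p b)" "smooth_section W s"
  shows "smooth_section W (\<lambda>p. residual (form p) (e p) n (s p))"
proof -
  have "smooth_section W (\<lambda>p. s p + (\<Sum>b<n. (- form p (e p b) (s p)) *s e p b))"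
    using assms
    by (intro smooth_section_add smooth_section_sum smooth_section_scale
        smooth_map_linear[OF bounded_linear_minus[OF bounded_linear_ident]] smooth_map_form) auto
  then show ?thesis by (simp add: residual_def sum_negf)
qed

lemma smooth_Re_form:
  "open W \<Longrightarrow> smooth_section W g \<Longrightarrow> smooth_map M W (\<lambda>p. Re (form p (g p) (g p)))"
  by (rule smooth_map_linear[OF bounded_linear_Re]) (rule smooth_map_form)

lemma smooth_gram_schmidt:
  assumes "open W" "\<And>b. b \<le> n \<Longrightarrow> smooth_section W (s b)"
    and "\<And>b p. b \<le> n \<Longrightarrow> p \<in> W \<Longrightarrow>
      residual (form p) (gram_schmidt (form p) (\<lambda>b. s b p)) b (s b p) \<noteq> 0"
  shows "smooth_section W (\<lambda>p. gram_schmidt (form p) (\<lambda>b. s b p) n)"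
  using assms(2,3)
proof (induction n rule: less_induct)
  case (less n)
  let ?g = "\<lambda>p. residual (form p) (gram_schmidt (form p) (\<lambda>b. s b p)) n (s n p)"
  have g: "smooth_section W ?g"
    by (rule smooth_residual[OF assms(1)]) (use less in auto)
  have "smooth_section W (\<lambda>p. complex_of_real (Re (form p (?g p) (?g p)) powr (- 1 / 2)) *s ?g p)"
    using less.prems(2)
    by (intro smooth_section_scale g assms(1) smooth_map_of_real smooth_map_rsqrt smooth_Re_form)
       (simp add: form_self_pos_iff)
  then show ?case by (subst gram_schmidt) (simp add: normalise_def)
qed

text \<open>The n-th residual is only known to be smooth where all earlier ones are nonzero, so
  openness is established one index at a time.\<close>

lemma open_residual_nonzero:
  assumes "\<And>b. b < n \<Longrightarrow> smooth_section UNIV (s b)"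
  shows "open {p. \<forall>b<n. residual (form p) (gram_schmidt (form p) (\<lambda>b. s b p)) b (s b p) \<noteq> 0}"
  using assms
proof (induction n)
  case (Suc n)
  let ?r = "\<lambda>b p. residual (form p) (gram_schmidt (form p) (\<lambda>b. s b p)) b (s b p)"
  let ?O = "{p. \<forall>b<n. ?r b p \<noteq> 0}"
  have O: "open ?O" using Suc by simp
  have "smooth_section ?O (\<lambda>p. gram_schmidt (form p) (\<lambda>b. s b p) b)" if "b < n" for b
    by (rule smooth_gram_schmidt[OF O]) (use that Suc.prems in \<open>auto intro: smooth_section_subset[OF _ subset_UNIV]\<close>)
  then have "smooth_section ?O (?r n)"
    by (intro smooth_residual[OF O]) (use Suc.prems in \<open>auto intro: smooth_section_subset[OF _ subset_UNIV]\<close>)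
  then have "continuous_on ?O (\<lambda>p. Re (form p (?r n p) (?r n p)))"
    by (intro smooth_map_continuous[OF O] smooth_Re_form O)
  then have "open ((\<lambda>p. Re (form p (?r n p) (?r n p))) -` {0<..} \<inter> ?O)"
    using continuous_on_open_vimage[OF O] open_greaterThan by blast
  moreover have "(\<lambda>p. Re (form p (?r n p) (?r n p))) -` {0<..} \<inter> ?O = {p. \<forall>b<Suc n. ?r b p \<noteq> 0}"
    by (auto simp: form_self_pos_iff less_Suc_eq)
  ultimately show ?case by simp
qed simp

lemma gram_schmidt_cong:
  "(\<And>b. b \<le> n \<Longrightarrow> s b = s' b) \<Longrightarrow> gram_schmidt h s n = gram_schmidt h s' n"
proof (induction n rule: less_induct)
  case (less n)
  then have "residual h (gram_schmidt h s) n (s n) = residual h (gram_schmidt h s') n (s' n)"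
    by (auto simp: residual_def intro!: sum.cong)
  then show ?case by (subst (1 2) gram_schmidt) simp
qed

lemma residual_cong:
  "(\<And>b. b < n \<Longrightarrow> e b = e' b) \<Longrightarrow> residual h e n v = residual h e' n v"
  by (auto simp: residual_def intro!: sum.cong)

text \<open>Greedy choice: as long as fewer than \<open>CARD('k)\<close> vectors are found, a
  spanning set contains a vector with nonzero residual. Overwriting \<iota> at n leaves the first n
  steps unchanged.\<close>

lemma spanning_selection:
  assumes "span ((\<lambda>w. t w) ` S) = UNIV" "n \<le> CARD('k)"
  shows "\<exists>\<iota>. (\<forall>b<n. \<iota> b \<in> S) \<and>
    (\<forall>b<n. residual (form p) (gram_schmidt (form p) (\<lambda>b. t (\<iota> b))) b (t (\<iota> b)) \<noteq> 0)"
  using assms(2)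
proof (induction n)
  case (Suc n)
  then obtain \<iota> where \<iota>: "\<forall>b<n. \<iota> b \<in> S"
    "\<forall>b<n. residual (form p) (gram_schmidt (form p) (\<lambda>b. t (\<iota> b))) b (t (\<iota> b)) \<noteq> 0" by auto
  have "orthonormal p (gram_schmidt (form p) (\<lambda>b. t (\<iota> b))) n"
    by (rule orthonormal_gram_schmidt) (use \<iota> in auto)
  from residual_nonzero[OF this _ assms(1)] Suc.prems obtain w where w: "w \<in> S"
    "residual (form p) (gram_schmidt (form p) (\<lambda>b. t (\<iota> b))) n (t w) \<noteq> 0" by auto
  have eq: "residual (form p) (gram_schmidt (form p) (\<lambda>b. t ((\<iota>(n := w)) b))) b v =
      residual (form p) (gram_schmidt (form p) (\<lambda>b. t (\<iota> b))) b v" if "b \<le> n" for b v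
    by (intro residual_cong gram_schmidt_cong) (use that in auto)
  show ?case
  proof (intro exI[of _ "\<iota>(n := w)"] conjI allI impI)
    fix b assume b: "b < Suc n"
    then show "(\<iota>(n := w)) b \<in> S" using \<iota> w by (auto simp: less_Suc_eq)
    show "residual (form p) (gram_schmidt (form p) (\<lambda>b. t ((\<iota>(n := w)) b))) b (t ((\<iota>(n := w)) b)) \<noteq> 0"
      using b \<iota> w by (subst eq) (auto simp: less_Suc_eq)
  qed
qed simp

text \<open>The squares sum to 1 because the weights enter a frame expansion twice. Vanishing near
  every point outside \<open>\<O> i\<close>, and not only at it, lets the weighted local sections be
  extended by 0.\<close>

lemma partition_of_unity:
  fixes \<O> :: "'i \<Rightarrow> 'm set"
  assumes J: "finite J" "\<And>i. i \<in> J \<Longrightarrow> open (\<O> i)" "\<And>p. \<exists>i\<in>J. p \<in> \<O> i"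
  obtains \<kappa> :: "'i \<Rightarrow> 'm \<Rightarrow> real" where
    "\<And>i. smooth_map M UNIV (\<kappa> i)" "\<And>p. (\<Sum>i\<in>J. (\<kappa> i p)\<^sup>2) = 1"
    "\<And>i p. i \<in> J \<Longrightarrow> p \<notin> \<O> i \<Longrightarrow> \<exists>N. open N \<and> p \<in> N \<and> (\<forall>q\<in>N. \<kappa> i q = 0)"
proof -
  have cover: "\<exists>W. open W \<and> p \<in> W \<and> (\<exists>i\<in>J. W \<subseteq> \<O> i)" for p
    using J(2,3) by blast
  obtain \<rho> :: "nat \<Rightarrow> 'm \<Rightarrow> real" and W L where \<rho>:
    "\<And>n. smooth_map M UNIV (\<rho> n)" "\<And>n q. \<rho> n q \<ge> 0"
    "\<And>n. open (W n)" "\<And>n. \<exists>i\<in>J. W n \<subseteq> \<O> i"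
    "\<And>n. closed (L n)" "\<And>n. L n \<subseteq> W n"
    "\<And>n q. q \<notin> L n \<Longrightarrow> \<rho> n q = 0" "\<And>p. \<exists>n. \<rho> n p > 0"
    "\<And>p. \<exists>N n0. open N \<and> p \<in> N \<and> (\<forall>n\<ge>n0. \<forall>q\<in>N. \<rho> n q = 0)"
    by (rule locally_finite_refinement[OF cover]) blast
  from \<rho>(4) obtain \<iota> where \<iota>: "\<And>n. \<iota> n \<in> J" "\<And>n. W n \<subseteq> \<O> (\<iota> n)" by metis
  \<comment> \<open>The countably many functions are grouped by the member of the finite cover to
    which each is assigned; the sum is finite by local finiteness.\<close>
  define \<psi> where "\<psi> i p = (\<Sum>n | \<rho> n p \<noteq> 0 \<and> \<iota> n = i. \<rho> n p)" for i p
  have \<psi>: "\<psi> i p = (\<Sum>n\<in>{n. n < n0 \<and> \<iota> n = i}. \<rho> n p)" if "\<And>n. n \<ge> n0 \<Longrightarrow> \<rho> n p = 0" for i p n0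
    unfolding \<psi>_def
  proof (rule sum.mono_neutral_left)
    show "{n. \<rho> n p \<noteq> 0 \<and> \<iota> n = i} \<subseteq> {n. n < n0 \<and> \<iota> n = i}" using that not_le by blast
  qed auto
  have \<psi>_smooth: "smooth_map M UNIV (\<psi> i)" for i
  proof (rule smooth_map_local)
    fix p
    obtain N n0 where N: "open N" "p \<in> N" "\<forall>n\<ge>n0. \<forall>q\<in>N. \<rho> n q = 0" using \<rho>(9) by blast
    have "smooth_map M N (\<psi> i)"
      by (subst smooth_map_cong[OF N(1), where g = "\<lambda>p. \<Sum>n\<in>{n. n < n0 \<and> \<iota> n = i}. \<rho> n p"])
         (use N \<psi> in \<open>auto intro!: smooth_map_sum smooth_map_subset[OF \<rho>(1)]\<close>)
    then show "\<exists>N. open N \<and> p \<in> N \<and> smooth_map M (UNIV \<inter> N) (\<psi> i)" using N by auto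
  qed simp
  have \<psi>_zero: "\<exists>N. open N \<and> p \<in> N \<and> (\<forall>q\<in>N. \<psi> i q = 0)" if p: "p \<notin> \<O> i" for i p
  proof -
    obtain N n0 where N: "open N" "p \<in> N" "\<forall>n\<ge>n0. \<forall>q\<in>N. \<rho> n q = 0" using \<rho>(9) by blast
    \<comment> \<open>Only finitely many \<rho> n matter on N. Removing the closed sets L n of those
      grouped under i leaves a neighbourhood of p, because these sets lie in
      \<open>\<O> i\<close>.\<close>
    define N' where "N' = N \<inter> (\<Inter>n\<in>{n. n < n0 \<and> \<iota> n = i}. - L n)"
    have "open N'" unfolding N'_def
      by (intro open_Int N open_INT) (use \<rho>(5) in \<open>auto simp: open_Compl\<close>)
    moreover have "p \<in> N'" using N p \<rho>(6) \<iota>(2) by (force simp: N'_def)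
    moreover have "\<psi> i q = 0" if "q \<in> N'" for q
      by (subst \<psi>[of n0]) (use that N \<rho>(7) in \<open>auto simp: N'_def intro!: sum.neutral\<close>)
    ultimately show ?thesis by blast
  qed
  define \<Psi> where "\<Psi> p = (\<Sum>i\<in>J. \<psi> i p * \<psi> i p)" for p
  have \<Psi>_pos: "\<Psi> p > 0" for p
  proof -
    obtain n where n: "\<rho> n p > 0" using \<rho>(8) by blast
    obtain N n0 where N: "p \<in> N" "\<forall>n\<ge>n0. \<forall>q\<in>N. \<rho> n q = 0" using \<rho>(9) by blast
    then have "n < n0" using n by (metis less_irrefl not_le)
    have "\<psi> (\<iota> n) p > 0"
      by (subst \<psi>[of n0], use N in simp, rule sum_pos2[of _ n])
         (use n \<open>n < n0\<close> \<rho>(2) in auto)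
    then show ?thesis unfolding \<Psi>_def
      by (intro sum_pos2[OF J(1) \<iota>(1)[of n]]) auto
  qed
  define \<kappa> where "\<kappa> i p = \<psi> i p * \<Psi> p powr (- 1 / 2)" for i p
  show thesis
  proof (rule that[of \<kappa>])
    show "smooth_map M UNIV (\<kappa> i)" for i
      unfolding \<kappa>_def using \<Psi>_pos
      by (intro smooth_map_mult \<psi>_smooth smooth_map_rsqrt) (auto simp: \<Psi>_def intro!: smooth_map_sum smooth_map_mult \<psi>_smooth)
    show "(\<Sum>i\<in>J. (\<kappa> i p)\<^sup>2) = 1" for p
    proof -
      have "(\<Psi> p powr (- 1 / 2)) * (\<Psi> p powr (- 1 / 2)) * \<Psi> p = 1"
        using \<Psi>_pos[of p] by (simp add: powr_add[symmetric] powr_minus field_simps)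
      moreover have "(\<Sum>i\<in>J. (\<kappa> i p)\<^sup>2) = (\<Psi> p powr (- 1 / 2)) * (\<Psi> p powr (- 1 / 2)) * (\<Sum>i\<in>J. \<psi> i p * \<psi> i p)"
        unfolding sum_distrib_left by (simp add: \<kappa>_def power2_eq_square mult_ac)
      ultimately show ?thesis by (simp add: \<Psi>_def)
    qed
    show "\<exists>N. open N \<and> p \<in> N \<and> (\<forall>q\<in>N. \<kappa> i q = 0)" if "p \<notin> \<O> i" for i p
      using \<psi>_zero[OF that] by (auto simp: \<kappa>_def)
  qed
qed

text \<open>The finite cover is indexed by the maps \<iota> that choose \<open>CARD('k)\<close> of
  the spanning sections; \<open>\<O> \<iota>\<close> is the set where Gram-Schmidt succeeds on the
  chosen ones. Each \<iota> reproduces z with the weight \<kappa>^2, and the weights sum to 1. The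
  third property is what later produces the unit of the algebra.\<close>

theorem parseval_frame:
  obtains n and x :: "nat \<Rightarrow> 'm \<Rightarrow> complex ^ 'k" where
    "\<And>i. i < n \<Longrightarrow> smooth_section UNIV (x i)"
    "\<And>p z. (\<Sum>i<n. form p (x i p) z *s x i p) = z"
    "\<And>p. (\<Sum>i<n. form p (x i p) (x i p)) = of_nat CARD('k)"
proof -
  obtain t :: "('e \<times> (complex ^ 'k) \<times> real) \<Rightarrow> 'm \<Rightarrow> complex ^ 'k"
    where t: "\<And>w. smooth_section UNIV (t w)" "\<And>p. span ((\<lambda>w. t w p) ` Basis) = UNIV"
    by (rule finitely_many_spanning_sections, rule that)
  define e where "e \<iota> b p = gram_schmidt (form p) (\<lambda>b. t (\<iota> b) p) b" for \<iota> b p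
  define \<O> where "\<O> \<iota> = {p. \<forall>b<CARD('k). residual (form p) (gram_schmidt (form p) (\<lambda>b. t (\<iota> b) p)) b (t (\<iota> b) p) \<noteq> 0}" for \<iota>
  \<comment> \<open>Extensional functions, so that the index set is finite.\<close>
  define J :: "(nat \<Rightarrow> ('e \<times> (complex ^ 'k) \<times> real)) set" where "J = {..<CARD('k)} \<rightarrow>\<^sub>E Basis"
  have finJ: "finite J" unfolding J_def by (intro finite_PiE) auto
  have open_O: "open (\<O> \<iota>)" for \<iota> unfolding \<O>_def by (rule open_residual_nonzero) (rule t)
  have cov: "\<exists>\<iota>\<in>J. p \<in> \<O> \<iota>" for p
  proof -
    obtain \<iota> where \<iota>: "\<forall>b<CARD('k). \<iota> b \<in> (Basis :: ('e \<times> (complex ^ 'k) \<times> real) set)"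
      "\<forall>b<CARD('k). residual (form p) (gram_schmidt (form p) (\<lambda>b. t (\<iota> b) p)) b (t (\<iota> b) p) \<noteq> 0"
      using spanning_selection[of "\<lambda>w. t w p" Basis "CARD('k)" p] t(2) by auto
    define \<iota>' where "\<iota>' = restrict \<iota> {..<CARD('k)}"
    have "residual (form p) (gram_schmidt (form p) (\<lambda>b. t (\<iota>' b) p)) b (t (\<iota>' b) p) =
        residual (form p) (gram_schmidt (form p) (\<lambda>b. t (\<iota> b) p)) b (t (\<iota> b) p)" if "b < CARD('k)" for b
    proof -
      have "residual (form p) (gram_schmidt (form p) (\<lambda>b. t (\<iota>' b) p)) b v =
          residual (form p) (gram_schmidt (form p) (\<lambda>b. t (\<iota> b) p)) b v" for v
        by (intro residual_cong gram_schmidt_cong) (use that in \<open>auto simp: \<iota>'_def\<close>)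
      then show ?thesis using that by (simp add: \<iota>'_def)
    qed
    then have "p \<in> \<O> \<iota>'" using \<iota> by (auto simp: \<O>_def)
    moreover have "\<iota>' \<in> J" using \<iota> by (auto simp: \<iota>'_def J_def)
    ultimately show ?thesis by blast
  qed
  obtain \<kappa> :: "(nat \<Rightarrow> ('e \<times> (complex ^ 'k) \<times> real)) \<Rightarrow> 'm \<Rightarrow> real" where \<kappa>: "\<And>\<iota>. smooth_map M UNIV (\<kappa> \<iota>)" "\<And>p. (\<Sum>\<iota>\<in>J. (\<kappa> \<iota> p)\<^sup>2) = 1"
    "\<And>\<iota> p. \<iota> \<in> J \<Longrightarrow> p \<notin> \<O> \<iota> \<Longrightarrow> \<exists>N. open N \<and> p \<in> N \<and> (\<forall>q\<in>N. \<kappa> \<iota> q = 0)"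
    by (rule partition_of_unity[OF finJ open_O cov], rule that)
  define y where "y = (\<lambda>(\<iota>, b) p. \<kappa> \<iota> p *\<^sub>R e \<iota> b p)"
  define I where "I = J \<times> {..<CARD('k)}"
  have finI: "finite I" using finJ by (simp add: I_def)
  have y_smooth: "smooth_section UNIV (y i)" if "i \<in> I" for i
  proof -
    obtain \<iota> b where i0: "i = (\<iota>, b)" by (rule prod.exhaust)
    have i: "i = (\<iota>, b)" "\<iota> \<in> J" "b < CARD('k)"
      using i0 that unfolding I_def by simp_all
    show ?thesis
    proof (rule smooth_section_local)
      fix p
      show "\<exists>N. open N \<and> p \<in> N \<and> smooth_section (UNIV \<inter> N) (y i)"
      proof (cases "p \<in> \<O> \<iota>")
        case True
        have "smooth_section (\<O> \<iota>) (\<lambda>p. e \<iota> b p)" unfolding e_def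
          by (rule smooth_gram_schmidt[OF open_O])
             (use i in \<open>auto simp: \<O>_def intro: smooth_section_subset[OF t(1)]\<close>)
        then have "smooth_section (\<O> \<iota>) (y i)"
          unfolding y_def i using smooth_map_subset[OF \<kappa>(1)[of \<iota>], of "\<O> \<iota>"]
          by (auto intro: smooth_section_scaleR open_O)
        then show ?thesis using True open_O by auto
      next
        case False
        then obtain N where N: "open N" "p \<in> N" "\<forall>q\<in>N. \<kappa> \<iota> q = 0" using \<kappa>(3) i by blast
        have "smooth_section N (y i)"
          by (subst smooth_section_cong[OF N(1), where \<sigma>' = "\<lambda>p. 0"])
             (use N in \<open>auto simp: y_def i intro: smooth_section_0\<close>)
        then show ?thesis using N by auto
      qed
    qed simp
  qed
  \<comment> \<open>Gram-Schmidt succeeds only on \<open>\<O> \<iota>\<close>; off this set the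
    weight is 0, so both sides of the identities below vanish there.\<close>
  have on: "orthonormal p (\<lambda>b. e \<iota> b p) CARD('k)" if "\<iota> \<in> J" "\<kappa> \<iota> p \<noteq> 0" for \<iota> p
  proof -
    have "p \<in> \<O> \<iota>" using \<kappa>(3)[OF that(1)] that(2) by blast
    then show ?thesis unfolding e_def by (intro orthonormal_gram_schmidt) (auto simp: \<O>_def)
  qed
  have scl: "form p (r *\<^sub>R z) w = of_real r * form p z w" "form p z (r *\<^sub>R w) = of_real r * form p z w" for p r z w
    by (simp_all add: scaleR_eq_vector_scale form_scale_left form_scale_right)
  have frame: "(\<Sum>i\<in>I. form p (y i p) z *s y i p) = z" for p z
  proof -
    have "(\<Sum>i\<in>I. form p (y i p) z *s y i p) =
        (\<Sum>\<iota>\<in>J. \<Sum>b<CARD('k). form p (y (\<iota>, b) p) z *s y (\<iota>, b) p)"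
      unfolding I_def by (subst sum.cartesian_product) (simp add: case_prod_unfold)
    also have "\<dots> = (\<Sum>\<iota>\<in>J. (\<kappa> \<iota> p)\<^sup>2 *\<^sub>R z)"
    proof (rule sum.cong)
      fix \<iota> assume \<iota>: "\<iota> \<in> J"
      have "(\<Sum>b<CARD('k). form p (y (\<iota>, b) p) z *s y (\<iota>, b) p) =
          (\<kappa> \<iota> p)\<^sup>2 *\<^sub>R (\<Sum>b<CARD('k). form p (e \<iota> b p) z *s e \<iota> b p)"
      proof -
        have "form p (y (\<iota>, b) p) z *s y (\<iota>, b) p = (\<kappa> \<iota> p)\<^sup>2 *\<^sub>R (form p (e \<iota> b p) z *s e \<iota> b p)" for b
          unfolding y_def prod.case scl by (simp add: scaleR_eq_vector_scale power2_eq_square mult_ac)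
        then show ?thesis by (simp only: scaleR_right.sum)
      qed
      then show "(\<Sum>b<CARD('k). form p (y (\<iota>, b) p) z *s y (\<iota>, b) p) = (\<kappa> \<iota> p)\<^sup>2 *\<^sub>R z"
        using orthonormal_expansion[OF on[OF \<iota>]] by (cases "\<kappa> \<iota> p = 0") auto
    qed simp
    also have "\<dots> = z" using \<kappa>(2)[of p] by (simp add: scaleR_left.sum[symmetric])
    finally show ?thesis .
  qed
  have norm: "(\<Sum>i\<in>I. form p (y i p) (y i p)) = of_nat CARD('k)" for p
  proof -
    have "(\<Sum>i\<in>I. form p (y i p) (y i p)) = (\<Sum>\<iota>\<in>J. \<Sum>b<CARD('k). form p (y (\<iota>, b) p) (y (\<iota>, b) p))"
      unfolding I_def by (subst sum.cartesian_product) (simp add: case_prod_unfold)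
    also have "\<dots> = (\<Sum>\<iota>\<in>J. complex_of_real ((\<kappa> \<iota> p)\<^sup>2) * of_nat CARD('k))"
    proof (rule sum.cong)
      fix \<iota> assume \<iota>: "\<iota> \<in> J"
      have "(\<Sum>b<CARD('k). form p (y (\<iota>, b) p) (y (\<iota>, b) p)) =
          complex_of_real ((\<kappa> \<iota> p)\<^sup>2) * (\<Sum>b<CARD('k). form p (e \<iota> b p) (e \<iota> b p))"
        by (simp add: y_def scl sum_distrib_left power2_eq_square mult_ac)
      moreover have "(\<Sum>b<CARD('k). form p (e \<iota> b p) (e \<iota> b p)) = of_nat CARD('k)" if "\<kappa> \<iota> p \<noteq> 0"
        using on[OF \<iota> that] by (simp add: orthonormal_def)
      ultimately show "(\<Sum>b<CARD('k). form p (y (\<iota>, b) p) (y (\<iota>, b) p)) =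
          complex_of_real ((\<kappa> \<iota> p)\<^sup>2) * of_nat CARD('k)"
        by (cases "\<kappa> \<iota> p = 0") auto
    qed simp
    also have "\<dots> = complex_of_real (\<Sum>\<iota>\<in>J. (\<kappa> \<iota> p)\<^sup>2) * of_nat CARD('k)"
      by (simp add: sum_distrib_right)
    finally show ?thesis using \<kappa>(2)[of p] by simp
  qed
  obtain \<pi> where \<pi>: "bij_betw \<pi> {..<card I} I"
    using ex_bij_betw_nat_finite[OF finI] by (auto simp: atLeast0LessThan)
  show thesis
  proof (rule that[of "card I" "\<lambda>i. y (\<pi> i)"])
    show "smooth_section UNIV (y (\<pi> i))" if "i < card I" for i
      by (rule y_smooth) (use bij_betwE[OF \<pi>] that in auto)
    show "(\<Sum>i<card I. form p (y (\<pi> i) p) z *s y (\<pi> i) p) = z" for p z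
      using sum.reindex_bij_betw[OF \<pi>, of "\<lambda>i. form p (y i p) z *s y i p"] frame by simp
    show "(\<Sum>i<card I. form p (y (\<pi> i) p) (y (\<pi> i) p)) = of_nat CARD('k)" for p
      using sum.reindex_bij_betw[OF \<pi>, of "\<lambda>i. form p (y i p) (y i p)"] norm by simp
  qed
qed

end

section \<open>Formal series as scalars\<close>

lemma ring_of_type_simps [simp]:
  "carrier ring_of_type = UNIV" "x \<otimes>\<^bsub>ring_of_type\<^esub> y = x * y" "x \<oplus>\<^bsub>ring_of_type\<^esub> y = x + y"
  "\<one>\<^bsub>ring_of_type\<^esub> = 1" "\<zero>\<^bsub>ring_of_type\<^esub> = 0"
  by (simp_all add: ring_of_type_def)

lemma cring_ring_of_type: "cring (ring_of_type :: 'a::comm_ring_1 ring)"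
proof (rule cringI)
  show "abelian_group (ring_of_type :: 'a ring)"
    by (rule abelian_groupI) (auto simp: algebra_simps intro: exI[of _ "- x" for x])
  show "comm_monoid (ring_of_type :: 'a ring)"
    by (rule comm_monoidI) (auto simp: algebra_simps)
qed (auto simp: algebra_simps)

lemma fps_cnj_simps [simp]:
  "fps_cnj (a + b) = fps_cnj a + fps_cnj b" "fps_cnj (a * b) = fps_cnj a * fps_cnj b"
  "fps_cnj (fps_cnj a) = a" "fps_cnj 0 = 0" "fps_cnj 1 = 1"
  by (simp_all add: fps_cnj_def fps_eq_iff fps_mult_nth)

lemma fps_cnj_sum: "fps_cnj (\<Sum>i\<in>I. f i) = (\<Sum>i\<in>I. fps_cnj (f i))"
  by (induction I rule: infinite_finite_induct) auto

text \<open>The leading coefficient is replaced by every coefficient that is preceded by zeros only,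
  which avoids \<open>subdegree\<close> and includes the zero series.\<close>

lemma fps_nonneg_iff:
  "fps_nonneg c \<longleftrightarrow> (\<forall>n. fps_nth c n \<in> \<real>) \<and> (\<forall>n. (\<forall>m<n. fps_nth c m = 0) \<longrightarrow> Re (fps_nth c n) \<ge> 0)"
proof (cases "c = 0")
  case False
  have nz: "fps_nth c (subdegree c) \<noteq> 0" using False by (rule nth_subdegree_nonzero)
  have "n = subdegree c \<or> fps_nth c n = 0" if "\<forall>m<n. fps_nth c m = 0" for n
    using that nz nth_less_subdegree_zero[of n c] by (metis linorder_neqE_nat)
  moreover have "\<forall>m<subdegree c. fps_nth c m = 0" by auto
  moreover have "Re (fps_nth c (subdegree c)) \<noteq> 0" if "\<forall>n. fps_nth c n \<in> \<real>"
    using that nz by (metis complex_is_Real_iff complex_eq_iff zero_complex.sel)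
  ultimately show ?thesis
    unfolding fps_nonneg_def using False by (metis less_eq_real_def order_refl zero_complex.sel(1))
qed (simp add: fps_nonneg_def)

lemma fps_nonneg_0: "fps_nonneg 0"
  by (simp add: fps_nonneg_def)

text \<open>Leading terms cannot cancel: in the lowest order where one of the summands is nonzero,
  both coefficients are nonnegative and one of them is positive. So where the sum starts with zeros,
  both summands do.\<close>

lemma fps_nonneg_add:
  assumes "fps_nonneg c" "fps_nonneg d" shows "fps_nonneg (c + d)"
proof -
  have c: "\<And>n. fps_nth c n \<in> \<real>" "\<And>n. (\<And>m. m < n \<Longrightarrow> fps_nth c m = 0) \<Longrightarrow> Re (fps_nth c n) \<ge> 0"
    and d: "\<And>n. fps_nth d n \<in> \<real>" "\<And>n. (\<And>m. m < n \<Longrightarrow> fps_nth d m = 0) \<Longrightarrow> Re (fps_nth d n) \<ge> 0"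
    using assms by (simp_all add: fps_nonneg_iff)
  have z: "fps_nth c m = 0 \<and> fps_nth d m = 0"
    if "m < n" "\<And>m. m < n \<Longrightarrow> fps_nth (c + d) m = 0" for m n
    using that(1)
  proof (induction m rule: less_induct)
    case (less m)
    then have "Re (fps_nth c m) \<ge> 0" "Re (fps_nth d m) \<ge> 0" using c(2)[of m] d(2)[of m] by auto
    moreover have "Re (fps_nth c m) + Re (fps_nth d m) = 0"
      using that(2)[OF less.prems] by (simp flip: plus_complex.sel)
    ultimately have "Re (fps_nth c m) = 0" "Re (fps_nth d m) = 0" by auto
    then show ?case using c(1)[of m] d(1)[of m] by (simp add: complex_is_Real_iff complex_eq_iff)
  qed
  show ?thesis
    unfolding fps_nonneg_iff
  proof (intro conjI allI impI)
    show "fps_nth (c + d) n \<in> \<real>" for n using c(1) d(1) by simp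
    fix n assume "\<forall>m<n. fps_nth (c + d) m = 0"
    then have "\<And>m. m < n \<Longrightarrow> fps_nth c m = 0 \<and> fps_nth d m = 0" using z by blast
    then show "Re (fps_nth (c + d) n) \<ge> 0" using c(2)[of n] d(2)[of n] by simp
  qed
qed

lemma fps_nonneg_sum: "(\<And>i. i \<in> I \<Longrightarrow> fps_nonneg (f i)) \<Longrightarrow> fps_nonneg (\<Sum>i\<in>I. f i)"
  by (induction I rule: infinite_finite_induct) (auto intro: fps_nonneg_0 fps_nonneg_add)

section \<open>Additive maps and spans\<close>

lemma additive_zero:
  assumes "abelian_group G" "abelian_group H" "\<And>x. x \<in> carrier G \<Longrightarrow> f x \<in> carrier H"
    and "\<And>x y. x \<in> carrier G \<Longrightarrow> y \<in> carrier G \<Longrightarrow> f (x \<oplus>\<^bsub>G\<^esub> y) = f x \<oplus>\<^bsub>H\<^esub> f y"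
  shows "f \<zero>\<^bsub>G\<^esub> = \<zero>\<^bsub>H\<^esub>"
proof -
  interpret G: abelian_group G by fact
  interpret H: abelian_group H by fact
  have "f \<zero>\<^bsub>G\<^esub> \<oplus>\<^bsub>H\<^esub> f \<zero>\<^bsub>G\<^esub> = f \<zero>\<^bsub>G\<^esub>"
    using assms(4)[of "\<zero>\<^bsub>G\<^esub>" "\<zero>\<^bsub>G\<^esub>"] by simp
  then show ?thesis using assms(3)[of "\<zero>\<^bsub>G\<^esub>"] by (metis G.zero_closed H.add.l_cancel_one')
qed

lemma additive_finsum:
  assumes "abelian_group G" "abelian_group H" "\<And>x. x \<in> carrier G \<Longrightarrow> f x \<in> carrier H"
    and "\<And>x y. x \<in> carrier G \<Longrightarrow> y \<in> carrier G \<Longrightarrow> f (x \<oplus>\<^bsub>G\<^esub> y) = f x \<oplus>\<^bsub>H\<^esub> f y"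
    and "finite I" "\<And>i. i \<in> I \<Longrightarrow> g i \<in> carrier G"
  shows "f (finsum G g I) = (\<Oplus>\<^bsub>H\<^esub>i\<in>I. f (g i))"
  using assms(5,6)
proof (induction I rule: finite_induct)
  case empty
  interpret G: abelian_group G by fact
  interpret H: abelian_group H by fact
  show ?case using additive_zero[OF assms(1-4)] by simp
next
  case (insert i I)
  interpret G: abelian_group G by fact
  interpret H: abelian_group H by fact
  show ?case using insert assms(3,4) by (simp add: Pi_def)
qed

lemma additive_finsum_type:
  fixes f :: "'a \<Rightarrow> 'b::comm_ring_1"
  assumes "abelian_group G"
    and "\<And>x y. x \<in> carrier G \<Longrightarrow> y \<in> carrier G \<Longrightarrow> f (x \<oplus>\<^bsub>G\<^esub> y) = f x + f y"
    and "finite I" "\<And>i. i \<in> I \<Longrightarrow> g i \<in> carrier G"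
  shows "f (finsum G g I) = (\<Sum>i\<in>I. f (g i))"
  using assms(3,4)
proof (induction I rule: finite_induct)
  case empty
  interpret G: abelian_group G by fact
  have "f \<zero>\<^bsub>G\<^esub> + f \<zero>\<^bsub>G\<^esub> = f \<zero>\<^bsub>G\<^esub>" using assms(2)[of "\<zero>\<^bsub>G\<^esub>" "\<zero>\<^bsub>G\<^esub>"] by simp
  then show ?case by simp
next
  case (insert i I)
  interpret G: abelian_group G by fact
  show ?case using insert assms(2) by (simp add: Pi_def)
qed

lemma module_cong:
  assumes "Module.module R X" "carrier Y = carrier X" "zero Y = zero X" "add Y = add X" "smult Y = smult X"
  shows "Module.module R Y"
proof -
  interpret Module.module R X by fact
  show ?thesis
  proof (rule moduleI)
    show "abelian_group Y"
      by (rule abelian_groupI)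
         (use M.add.inv_closed M.l_neg in \<open>auto simp: assms(2-4) M.a_assoc M.a_comm M.a_lcomm\<close>)
  qed (auto simp: assms(2-5) smult_l_distr smult_r_distr smult_assoc1 R.is_cring)
qed

text \<open>Sums without scalar coefficients are enough for both fullness statements, where a
  coefficient can be moved into one argument of the inner product.\<close>

lemma lin_span_eq_carrier:
  assumes V: "Module.module R V" and S: "S \<subseteq> carrier V"
    and gen: "\<And>v. v \<in> carrier V \<Longrightarrow> \<exists>I (g :: nat \<Rightarrow> _). finite I \<and> g ` I \<subseteq> S \<and> v = finsum V g I"
  shows "lin_span R V S = carrier V"
proof
  interpret Module.module R V by fact
  show "lin_span R V S \<subseteq> carrier V"
    unfolding lin_span_def using S carrier_is_submodule by blast
  show "carrier V \<subseteq> lin_span R V S"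
    unfolding lin_span_def
  proof (intro subsetI InterI)
    fix v W assume v: "v \<in> carrier V" and "W \<in> {W. submodule W R V \<and> S \<subseteq> W}"
    then have W: "submodule W R V" "S \<subseteq> W" by auto
    interpret W: submodule W R V by fact
    obtain I and g :: "nat \<Rightarrow> _" where I: "finite I" "g ` I \<subseteq> S" "v = finsum V g I" using gen[OF v] by blast
    have "finsum V g I \<in> W"
      using I(1,2)
    proof (induction I rule: finite_induct)
      case empty
      show ?case using W.one_closed by simp
    next
      case (insert i I)
      then have "g i \<in> W" "finsum V g I \<in> W" using W(2) by auto
      moreover have "g i \<in> carrier V" "g \<in> I \<rightarrow> carrier V" using insert.prems S by auto
      ultimately show ?case using insert.hyps W.m_closed[of "g i" "finsum V g I"] by simp
    qed
    then show "v \<in> W" using I by simp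
  qed
qed

section \<open>Positivity of tensor products\<close>

lemma lookup_scale [simp]:
  fixes c :: "'b::comm_ring_1"
  shows "Poly_Mapping.lookup (Poly_Mapping.map ((*) c) u) k = c * Poly_Mapping.lookup u k"
  by (simp add: Poly_Mapping.map.rep_eq when_def)

lemma free_module_module: "Module.module complex_series (free_module A)"
proof (rule moduleI[OF cring_ring_of_type])
  have keys_scale: "Poly_Mapping.keys (Poly_Mapping.map ((*) c) u) \<subseteq> Poly_Mapping.keys u"
    for c :: "complex fps" and u :: "'a \<Rightarrow>\<^sub>0 complex fps"
    by (auto simp: in_keys_iff)
  show "abelian_group (free_module A)"
  proof (rule abelian_groupI)
    fix u assume "u \<in> carrier (free_module A)"
    then show "\<exists>v\<in>carrier (free_module A). v \<oplus>\<^bsub>free_module A\<^esub> u = \<zero>\<^bsub>free_module A\<^esub>"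
      by (intro bexI[of _ "- u"]) (auto simp: free_module_def keys_minus)
  qed (auto simp: free_module_def algebra_simps dest: subsetD[OF Poly_Mapping.keys_add])
  fix c d :: "complex fps" and u v
  show "c \<odot>\<^bsub>free_module A\<^esub> u \<in> carrier (free_module A)" if "u \<in> carrier (free_module A)"
    using that keys_scale by (fastforce simp: free_module_def)
qed (auto simp: free_module_def lookup_add algebra_simps intro!: poly_mapping_eqI)

text \<open>The linear extension of q to the free module. If it annihilates the relations, it
  descends to the tensor product.\<close>

definition tensor_functional ::
  "('x \<Rightarrow> complex fps) \<Rightarrow> ('x \<Rightarrow>\<^sub>0 complex fps) \<Rightarrow> complex fps" where
  "tensor_functional q u = (\<Sum>b\<in>Poly_Mapping.keys u. Poly_Mapping.lookup u b * q b)"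

lemma tensor_functional_superset:
  "finite S \<Longrightarrow> Poly_Mapping.keys u \<subseteq> S \<Longrightarrow>
    tensor_functional q u = (\<Sum>b\<in>S. Poly_Mapping.lookup u b * q b)"
  unfolding tensor_functional_def by (rule sum.mono_neutral_left) (auto simp: in_keys_iff)

lemma tensor_functional_add: "tensor_functional q (u + v) = tensor_functional q u + tensor_functional q v"
proof -
  define S where "S = Poly_Mapping.keys u \<union> Poly_Mapping.keys v"
  have S: "finite S" "Poly_Mapping.keys u \<subseteq> S" "Poly_Mapping.keys v \<subseteq> S" "Poly_Mapping.keys (u + v) \<subseteq> S"
    using Poly_Mapping.keys_add[of u v] by (auto simp: S_def)
  show ?thesis
    by (simp add: tensor_functional_superset[OF S(1,2)] tensor_functional_superset[OF S(1,3)]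
        tensor_functional_superset[OF S(1,4)] lookup_add distrib_right sum.distrib)
qed

lemma tensor_functional_uminus: "tensor_functional q (- u) = - tensor_functional q u"
  by (simp add: tensor_functional_def keys_minus sum_negf)

lemma tensor_functional_minus: "tensor_functional q (u - v) = tensor_functional q u - tensor_functional q v"
  using tensor_functional_add[of q u "- v"] by (simp add: tensor_functional_uminus)

lemma tensor_functional_single [simp]: "tensor_functional q (Poly_Mapping.single b c) = c * q b"
  by (simp add: tensor_functional_def)

lemma tensor_functional_scale:
  "tensor_functional q (Poly_Mapping.map ((*) c) u) = c * tensor_functional q u"
proof -
  have "Poly_Mapping.keys (Poly_Mapping.map ((*) c) u) \<subseteq> Poly_Mapping.keys u"
    by (auto simp: in_keys_iff)
  from tensor_functional_superset[OF finite_keys this, of q] show ?thesis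
    by (simp add: tensor_functional_def sum_distrib_left mult.assoc)
qed

text \<open>The kernel of the functional is a submodule; containing the relations, it contains their
  span, and elements of one class differ by an element of that span.\<close>

lemma tensor_class_eqD:
  assumes "tensor_class C F H \<pi> u = tensor_class C F H \<pi> u'"
    and u: "u \<in> carrier (free_module (carrier F \<times> carrier H))"
    and rel: "tensor_relations C F H \<pi> \<subseteq> carrier (free_module (carrier F \<times> carrier H))"
      "\<And>r. r \<in> tensor_relations C F H \<pi> \<Longrightarrow> tensor_functional q r = 0"
  shows "tensor_functional q u = tensor_functional q u'"
proof -
  let ?V = "free_module (carrier F \<times> carrier H)"
  interpret V: Module.module complex_series ?V by (rule free_module_module)
  let ?N = "{r \<in> carrier ?V. tensor_functional q r = 0}"
  have q_add: "tensor_functional q (x \<oplus>\<^bsub>?V\<^esub> y) = tensor_functional q x + tensor_functional q y" for x y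
    by (simp add: free_module_def tensor_functional_add)
  have q_zero: "tensor_functional q \<zero>\<^bsub>?V\<^esub> = 0"
    by (simp add: free_module_def tensor_functional_def)
  have "submodule ?N complex_series ?V"
  proof (rule V.submoduleI)
    fix x assume x: "x \<in> ?N"
    have "tensor_functional q (x \<oplus>\<^bsub>?V\<^esub> \<ominus>\<^bsub>?V\<^esub> x) = 0"
      using x by (simp add: V.M.r_neg q_zero)
    then show "\<ominus>\<^bsub>?V\<^esub> x \<in> ?N" using x by (simp add: q_add)
  qed (auto simp: q_zero q_add, simp add: free_module_def tensor_functional_scale)
  then have span: "lin_span complex_series ?V (tensor_relations C F H \<pi>) \<subseteq> ?N"
    unfolding lin_span_def using rel by blast
  have zero: "\<zero>\<^bsub>?V\<^esub> \<in> lin_span complex_series ?V (tensor_relations C F H \<pi>)"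
    unfolding lin_span_def submodule_def using subgroup.one_closed[of _ "add_monoid ?V"] by auto
  have "u \<in> tensor_class C F H \<pi> u"
    unfolding tensor_class_def Let_def a_r_coset_def r_coset_def
    using zero V.M.l_zero[OF u] by force
  then have "u \<in> tensor_class C F H \<pi> u'" using assms(1) by simp
  then obtain s where "s \<in> lin_span complex_series ?V (tensor_relations C F H \<pi>)" "u = s \<oplus>\<^bsub>?V\<^esub> u'"
    unfolding tensor_class_def Let_def a_r_coset_def r_coset_def by auto
  then show ?thesis using span by (auto simp: q_add)
qed

text \<open>The form is linear in the second argument, so independence of the representative follows
  there from the relations being annihilated. For the first argument it follows by Hermitian
  symmetry, without an antilinear version of the argument. A chosen representative of each class
  then defines S.\<close>

lemma psd_on_tensor_productI:
  assumes q_rel: "\<And>a r. a \<in> carrier F \<times> carrier H \<Longrightarrow> r \<in> tensor_relations C F H \<pi> \<Longrightarrow>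
      tensor_functional (q a) r = 0"
    and rel: "tensor_relations C F H \<pi> \<subseteq> carrier (free_module (carrier F \<times> carrier H))"
    and q: "\<And>x v y w. q (x, v) (y, w) = inner_product H v (\<pi> (right_ip F x y) w)"
    and q_cnj: "\<And>a b. a \<in> carrier F \<times> carrier H \<Longrightarrow> b \<in> carrier F \<times> carrier H \<Longrightarrow> q b a = fps_cnj (q a b)"
    and pos: "\<And>u. u \<in> carrier (free_module (carrier F \<times> carrier H)) \<Longrightarrow> fps_nonneg (tensor_form F H \<pi> u u)"
  shows "psd_on_tensor_product C F H \<pi>"
proof -
  let ?V = "free_module (carrier F \<times> carrier H)"
  let ?cl = "tensor_class C F H \<pi>"
  have keys: "u \<in> carrier ?V \<longleftrightarrow> Poly_Mapping.keys u \<subseteq> carrier F \<times> carrier H" for u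
    by (simp add: free_module_def)
  have form: "tensor_form F H \<pi> u u' =
      (\<Sum>a\<in>Poly_Mapping.keys u. fps_cnj (Poly_Mapping.lookup u a) * tensor_functional (q a) u')" for u u'
    unfolding tensor_form_def tensor_functional_def sum_distrib_left
    by (intro sum.cong refl) (auto simp: case_prod_unfold q mult_ac intro!: sum.cong)
  have form_cnj: "tensor_form F H \<pi> u' u = fps_cnj (tensor_form F H \<pi> u u')"
    if "u \<in> carrier ?V" "u' \<in> carrier ?V" for u u'
  proof -
    have "tensor_form F H \<pi> u' u = (\<Sum>b\<in>Poly_Mapping.keys u'. \<Sum>a\<in>Poly_Mapping.keys u.
        fps_cnj (fps_cnj (Poly_Mapping.lookup u a) * (Poly_Mapping.lookup u' b * q a b)))"
      unfolding form tensor_functional_def sum_distrib_left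
    proof (intro sum.cong refl)
      fix b a assume "b \<in> Poly_Mapping.keys u'" "a \<in> Poly_Mapping.keys u"
      then have "q b a = fps_cnj (q a b)" using that q_cnj[of a b] by (auto simp: keys)
      then show "fps_cnj (Poly_Mapping.lookup u' b) * (Poly_Mapping.lookup u a * q b a) =
          fps_cnj (fps_cnj (Poly_Mapping.lookup u a) * (Poly_Mapping.lookup u' b * q a b))" by simp
    qed
    also have "\<dots> = fps_cnj (tensor_form F H \<pi> u u')"
      unfolding form tensor_functional_def sum_distrib_left fps_cnj_sum by (rule sum.swap)
    finally show ?thesis .
  qed
  have cong_right: "tensor_form F H \<pi> u v = tensor_form F H \<pi> u v'"
    if "u \<in> carrier ?V" "v \<in> carrier ?V" "?cl v = ?cl v'" for u v v'
    unfolding form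
  proof (intro sum.cong refl)
    fix a assume "a \<in> Poly_Mapping.keys u"
    then have "a \<in> carrier F \<times> carrier H" using that(1) by (auto simp: keys)
    then have "tensor_functional (q a) v = tensor_functional (q a) v'"
      using tensor_class_eqD[OF that(3,2) rel] q_rel by blast
    then show "fps_cnj (Poly_Mapping.lookup u a) * tensor_functional (q a) v =
        fps_cnj (Poly_Mapping.lookup u a) * tensor_functional (q a) v'" by simp
  qed
  define rep where "rep t = (SOME u. u \<in> carrier ?V \<and> ?cl u = t)" for t
  have rep: "rep (?cl u) \<in> carrier ?V" "?cl (rep (?cl u)) = ?cl u" if "u \<in> carrier ?V" for u
    using someI[of "\<lambda>u'. u' \<in> carrier ?V \<and> ?cl u' = ?cl u" u] that by (auto simp: rep_def)
  have "tensor_form F H \<pi> (rep (?cl u)) (rep (?cl u')) = tensor_form F H \<pi> u u'"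
    if "u \<in> carrier ?V" "u' \<in> carrier ?V" for u u'
    using cong_right[of "rep (?cl u)" "rep (?cl u')" u'] cong_right[of u' "rep (?cl u)" u] that rep
      form_cnj[of u' u] form_cnj[of u' "rep (?cl u)"] by metis
  then show ?thesis
    unfolding psd_on_tensor_product_def tensor_product_def
    by (intro exI[of _ "\<lambda>t t'. tensor_form F H \<pi> (rep t) (rep t')"]) (auto simp: pos)
qed

text \<open>With g_k(x, v) = \<pi>(<z_k, x>) v, the decomposition and the adjunction rule of a
  representation turn <v, \<pi>(<x, y>) w> into the sum over k of <g_k(x, v), g_k(y, w)>. Each
  summand is pulled back from the inner product of H, hence positive semi-definite. The statement
  covers (Q) as well, with the endomorphism algebra and the conjugate bimodule in place of C and
  F.\<close>

lemma property_PI: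
  fixes F :: "('d, 'c, 'f, 'z) inner_bimodule_scheme" and C :: "('c, 'y) star_algebra_scheme"
  assumes C: "unital_star_algebra C" and F: "right_module C F (right_act F)"
    and ip: "right_inner_product C F (right_act F) (right_ip F)"
    and K: "finite K" "\<And>k. k \<in> K \<Longrightarrow> zs k \<in> carrier F"
    and dec: "\<And>x y. x \<in> carrier F \<Longrightarrow> y \<in> carrier F \<Longrightarrow>
      right_ip F x y = (\<Oplus>\<^bsub>C\<^esub>k\<in>K. right_ip F x (zs k) \<otimes>\<^bsub>C\<^esub> right_ip F (zs k) y)"
  shows "property_P T C F"
  unfolding property_P_def
proof (intro allI impI)
  fix H :: "'h inner_module" and \<pi>
  assume "pre_hilbert H \<and> star_representation C H \<pi>"
  then have H: "pre_hilbert H" and \<pi>: "star_representation C H \<pi>" by auto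
  interpret C: Ring.ring C using C by (simp add: unital_star_algebra_def)
  interpret F: Module.module complex_series F using F by (simp add: right_module_def)
  interpret H: Module.module complex_series H using H by (simp add: pre_hilbert_def)
  have ipC [simp]: "right_ip F x y \<in> carrier C" if "x \<in> carrier F" "y \<in> carrier F" for x y
    using ip that by (simp add: right_inner_product_def linear_map_def)
  have ip_inv: "involution C (right_ip F x y) = right_ip F y x" if "x \<in> carrier F" "y \<in> carrier F" for x y
    using ip that by (simp add: right_inner_product_def)
  have \<pi>_bil: "bilinear_map complex_series C H H \<pi>" using \<pi> by (simp add: star_representation_def)
  have \<pi>c [simp]: "\<pi> a v \<in> carrier H" if "a \<in> carrier C" "v \<in> carrier H" for a v
    using \<pi>_bil that by (simp add: bilinear_map_def linear_map_def)
  have inner_add: "inner_product H v (w \<oplus>\<^bsub>H\<^esub> w') = inner_product H v w + inner_product H v w'"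
    if "v \<in> carrier H" "w \<in> carrier H" "w' \<in> carrier H" for v w w'
    using H that unfolding pre_hilbert_def by blast
  have inner_scale: "inner_product H v (c \<odot>\<^bsub>H\<^esub> w) = c * inner_product H v w"
    if "v \<in> carrier H" "w \<in> carrier H" for v w c
    using H that unfolding pre_hilbert_def by blast
  have inner_cnj: "inner_product H w v = fps_cnj (inner_product H v w)"
    if "v \<in> carrier H" "w \<in> carrier H" for v w
    using H that unfolding pre_hilbert_def by blast
  have inner_nonneg: "fps_nonneg (inner_product H v v)" if "v \<in> carrier H" for v
    using H that unfolding pre_hilbert_def by blast
  have \<pi>_adj: "inner_product H v (\<pi> a w) = inner_product H (\<pi> (involution C a) v) w"
    if "a \<in> carrier C" "v \<in> carrier H" "w \<in> carrier H" for v w a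
    using \<pi> that unfolding star_representation_def by blast
  have \<pi>_mult: "\<pi> (a \<otimes>\<^bsub>C\<^esub> b) v = \<pi> a (\<pi> b v)" if "a \<in> carrier C" "b \<in> carrier C" "v \<in> carrier H" for a b v
    using \<pi> that unfolding star_representation_def by blast
  have \<pi>_add: "\<pi> (a \<oplus>\<^bsub>C\<^esub> b) v = \<pi> a v \<oplus>\<^bsub>H\<^esub> \<pi> b v" if "a \<in> carrier C" "b \<in> carrier C" "v \<in> carrier H" for a b v
    using \<pi>_bil that by (simp add: bilinear_map_def linear_map_def)
  have \<pi>_add_right: "\<pi> a (v \<oplus>\<^bsub>H\<^esub> w) = \<pi> a v \<oplus>\<^bsub>H\<^esub> \<pi> a w" if "a \<in> carrier C" "v \<in> carrier H" "w \<in> carrier H" for a v w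
    using \<pi>_bil that by (simp add: bilinear_map_def linear_map_def)
  have \<pi>_scale: "\<pi> (c \<odot>\<^bsub>C\<^esub> a) v = c \<odot>\<^bsub>H\<^esub> \<pi> a v" if "a \<in> carrier C" "v \<in> carrier H" for a v c
    using \<pi>_bil that by (simp add: bilinear_map_def linear_map_def)
  have \<pi>_scale_right: "\<pi> a (c \<odot>\<^bsub>H\<^esub> v) = c \<odot>\<^bsub>H\<^esub> \<pi> a v" if "a \<in> carrier C" "v \<in> carrier H" for a v c
    using \<pi>_bil that by (simp add: bilinear_map_def linear_map_def)
  have ip_add: "right_ip F x (y \<oplus>\<^bsub>F\<^esub> z) = right_ip F x y \<oplus>\<^bsub>C\<^esub> right_ip F x z"
    if "x \<in> carrier F" "y \<in> carrier F" "z \<in> carrier F" for x y z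
    using ip that by (simp add: right_inner_product_def linear_map_def)
  have ip_scale: "right_ip F x (c \<odot>\<^bsub>F\<^esub> y) = c \<odot>\<^bsub>C\<^esub> right_ip F x y"
    if "x \<in> carrier F" "y \<in> carrier F" for x y c
    using ip that by (simp add: right_inner_product_def linear_map_def)
  have ip_act: "right_ip F x (right_act F y a) = right_ip F x y \<otimes>\<^bsub>C\<^esub> a"
    if "x \<in> carrier F" "y \<in> carrier F" "a \<in> carrier C" for x y a
    using ip that by (simp add: right_inner_product_def)
  have actF [simp]: "right_act F x a \<in> carrier F" if "x \<in> carrier F" "a \<in> carrier C" for x a
    using F that by (simp add: right_module_def bilinear_map_def linear_map_def)
  define q where "q = (\<lambda>(x, v) (y, w). inner_product H v (\<pi> (right_ip F x y) w))"
  define g where "g k a = \<pi> (right_ip F (zs k) (fst a)) (snd a)" for k and a :: "'f \<times> 'h"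
  have g [simp]: "g k a \<in> carrier H" if "k \<in> K" "a \<in> carrier F \<times> carrier H" for k a
    using that K(2) by (auto simp: g_def)
  have q_g: "q a b = (\<Sum>k\<in>K. inner_product H (g k a) (g k b))"
    if a: "a \<in> carrier F \<times> carrier H" and b: "b \<in> carrier F \<times> carrier H" for a b
  proof -
    obtain x v y w where ab: "a = (x, v)" "b = (y, w)" by (metis prod.exhaust)
    have xy: "x \<in> carrier F" "v \<in> carrier H" "y \<in> carrier F" "w \<in> carrier H" using a b ab by auto
    have "q a b = inner_product H v (\<pi> (\<Oplus>\<^bsub>C\<^esub>k\<in>K. right_ip F x (zs k) \<otimes>\<^bsub>C\<^esub> right_ip F (zs k) y) w)"
      using dec[OF xy(1,3)] by (simp add: q_def ab)
    also have "\<dots> = (\<Sum>k\<in>K. inner_product H v (\<pi> (right_ip F x (zs k) \<otimes>\<^bsub>C\<^esub> right_ip F (zs k) y) w))"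
      by (rule additive_finsum_type[OF C.is_abelian_group _ K(1)])
         (use xy K(2) in \<open>auto simp: \<pi>_add inner_add\<close>)
    also have "\<dots> = (\<Sum>k\<in>K. inner_product H (g k a) (g k b))"
      using xy K(2) by (intro sum.cong) (auto simp: \<pi>_mult \<pi>_adj ip_inv g_def ab)
    finally show ?thesis .
  qed
  show "psd_on_tensor_product C F H \<pi>"
  proof (rule psd_on_tensor_productI[where q = q])
    show "q (x, v) (y, w) = inner_product H v (\<pi> (right_ip F x y) w)" for x v y w by (simp add: q_def)
    show "q b a = fps_cnj (q a b)" if "a \<in> carrier F \<times> carrier H" "b \<in> carrier F \<times> carrier H" for a b
      using that by (simp add: q_g fps_cnj_sum inner_cnj[of "g _ a" "g _ b"])
    show "tensor_functional (q a) r = 0"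
      if "a \<in> carrier F \<times> carrier H" "r \<in> tensor_relations C F H \<pi>" for a r
      using that unfolding tensor_relations_def
      by (auto simp: tensor_functional_minus q_def ip_add ip_scale ip_act inner_add inner_scale
          \<pi>_add \<pi>_add_right \<pi>_scale \<pi>_scale_right \<pi>_mult)
    show "tensor_relations C F H \<pi> \<subseteq> carrier (free_module (carrier F \<times> carrier H))"
    proof -
      have k: "u - v \<in> carrier (free_module A)"
        if "u \<in> carrier (free_module A)" "v \<in> carrier (free_module A)" for u v and A :: "('f \<times> 'h) set"
        using that keys_diff[of u v] by (auto simp: free_module_def)
      have s: "Poly_Mapping.single b c \<in> carrier (free_module A)" if "b \<in> A"
        for b c and A :: "('f \<times> 'h) set"
        using that by (auto simp: free_module_def)
      show ?thesis unfolding tensor_relations_def by (auto intro!: k s)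
    qed
  next
    fix u assume "u \<in> carrier (free_module (carrier F \<times> carrier H))"
    then have ku: "Poly_Mapping.keys u \<subseteq> carrier F \<times> carrier H" by (simp add: free_module_def)
    let ?S = "Poly_Mapping.keys u"
    \<comment> \<open>The image of u under the linear extension of g_k; the form at u becomes the
      sum over k of <\<xi> k, \<xi> k>.\<close>
    define \<xi> where "\<xi> k = (\<Oplus>\<^bsub>H\<^esub>a\<in>?S. Poly_Mapping.lookup u a \<odot>\<^bsub>H\<^esub> g k a)" for k
    have \<xi>: "\<xi> k \<in> carrier H" if "k \<in> K" for k
      unfolding \<xi>_def using ku that by (intro H.M.finsum_closed) auto
    have inner_\<xi>: "inner_product H v (\<xi> k) = (\<Sum>a\<in>?S. Poly_Mapping.lookup u a * inner_product H v (g k a))"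
      if "k \<in> K" "v \<in> carrier H" for v k
    proof -
      have "inner_product H v (\<xi> k) = (\<Sum>a\<in>?S. inner_product H v (Poly_Mapping.lookup u a \<odot>\<^bsub>H\<^esub> g k a))"
        unfolding \<xi>_def
        by (rule additive_finsum_type[OF H.M.abelian_group_axioms])
           (use that ku in \<open>auto simp: inner_add subset_iff\<close>)
      also have "\<dots> = (\<Sum>a\<in>?S. Poly_Mapping.lookup u a * inner_product H v (g k a))"
        using that ku by (intro sum.cong refl inner_scale) (auto simp: subset_iff)
      finally show ?thesis .
    qed
    have "tensor_form F H \<pi> u u = (\<Sum>a\<in>?S. \<Sum>b\<in>?S. fps_cnj (Poly_Mapping.lookup u a) * Poly_Mapping.lookup u b * q a b)"
      unfolding tensor_form_def by (intro sum.cong) (auto simp: q_def case_prod_unfold)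
    also have "\<dots> = (\<Sum>a\<in>?S. \<Sum>b\<in>?S. \<Sum>k\<in>K. fps_cnj (Poly_Mapping.lookup u a) *
        (Poly_Mapping.lookup u b * inner_product H (g k a) (g k b)))"
      using ku by (intro sum.cong refl) (subst q_g, auto simp: sum_distrib_left mult.assoc)
    also have "\<dots> = (\<Sum>k\<in>K. \<Sum>a\<in>?S. \<Sum>b\<in>?S. fps_cnj (Poly_Mapping.lookup u a) *
        (Poly_Mapping.lookup u b * inner_product H (g k a) (g k b)))"
    proof -
      have "(\<Sum>a\<in>?S. \<Sum>b\<in>?S. \<Sum>k\<in>K. f a b k) = (\<Sum>k\<in>K. \<Sum>a\<in>?S. \<Sum>b\<in>?S. f a b k)"
        for f :: "_ \<Rightarrow> _ \<Rightarrow> _ \<Rightarrow> complex fps"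
      proof -
        have "(\<Sum>a\<in>?S. \<Sum>b\<in>?S. \<Sum>k\<in>K. f a b k) = (\<Sum>a\<in>?S. \<Sum>k\<in>K. \<Sum>b\<in>?S. f a b k)"
          by (rule sum.cong[OF refl]) (rule sum.swap)
        also have "\<dots> = (\<Sum>k\<in>K. \<Sum>a\<in>?S. \<Sum>b\<in>?S. f a b k)" by (rule sum.swap)
        finally show ?thesis .
      qed
      then show ?thesis .
    qed
    also have "\<dots> = (\<Sum>k\<in>K. inner_product H (\<xi> k) (\<xi> k))"
    proof (rule sum.cong)
      fix k assume k: "k \<in> K"
      have "inner_product H (\<xi> k) (\<xi> k) = (\<Sum>b\<in>?S. Poly_Mapping.lookup u b * fps_cnj (inner_product H (g k b) (\<xi> k)))"
        unfolding inner_\<xi>[OF k \<xi>[OF k]]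
        using ku k by (intro sum.cong refl arg_cong2[where f = "(*)"] inner_cnj \<xi>) (auto simp: subset_iff)
      also have "\<dots> = (\<Sum>b\<in>?S. \<Sum>a\<in>?S. Poly_Mapping.lookup u b * fps_cnj (Poly_Mapping.lookup u a * inner_product H (g k b) (g k a)))"
        unfolding sum_distrib_left[symmetric] fps_cnj_sum[symmetric]
        using ku k by (intro sum.cong refl) (subst inner_\<xi>[OF k], auto simp: subset_iff)
      also have "\<dots> = (\<Sum>b\<in>?S. \<Sum>a\<in>?S. fps_cnj (Poly_Mapping.lookup u a) *
          (Poly_Mapping.lookup u b * inner_product H (g k a) (g k b)))"
      proof (intro sum.cong refl)
        fix a b assume ab: "b \<in> ?S" "a \<in> ?S"
        have "inner_product H (g k a) (g k b) = fps_cnj (inner_product H (g k b) (g k a))"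
          using ab ku k by (intro inner_cnj g) auto
        then show "Poly_Mapping.lookup u b * fps_cnj (Poly_Mapping.lookup u a * inner_product H (g k b) (g k a)) =
            fps_cnj (Poly_Mapping.lookup u a) * (Poly_Mapping.lookup u b * inner_product H (g k a) (g k b))"
          by (simp add: mult_ac)
      qed
      finally show "(\<Sum>a\<in>?S. \<Sum>b\<in>?S. fps_cnj (Poly_Mapping.lookup u a) *
        (Poly_Mapping.lookup u b * inner_product H (g k a) (g k b))) = inner_product H (\<xi> k) (\<xi> k)"
        by (subst sum.swap) (rule sym)
    qed simp
    finally show "fps_nonneg (tensor_form F H \<pi> u u)"
      using inner_nonneg \<xi> by (simp add: fps_nonneg_sum)
  qed
qed

section \<open>Right inner product modules\<close>

text \<open>\<open>right_module\<close> does not ask the unit to act as the identity. This is a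
  separate assumption here; for deformations it is derived from their zeroth order.\<close>

locale inner_module_axioms =
  fixes C :: "('c, 'z) star_algebra_scheme" (structure)
    and X :: "(complex fps, 'x, 'y) module_scheme"
    and act :: "'x \<Rightarrow> 'c \<Rightarrow> 'x" and ip :: "'x \<Rightarrow> 'x \<Rightarrow> 'c"
  assumes star: "unital_star_algebra C" and right: "right_module C X act"
    and inner: "right_inner_product C X act ip"
    and act_one [simp]: "x \<in> carrier X \<Longrightarrow> act x \<one>\<^bsub>C\<^esub> = x"
begin

sublocale C: Ring.ring C
  using star by (simp add: unital_star_algebra_def)

sublocale CM: Module.module complex_series C
  using star by (simp add: unital_star_algebra_def)

sublocale X: Module.module complex_series X
  using right by (simp add: right_module_def)

abbreviation inv' where "inv' \<equiv> involution C"

lemma inv_closed [simp]: "a \<in> carrier C \<Longrightarrow> inv' a \<in> carrier C"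
  and inv_inv [simp]: "a \<in> carrier C \<Longrightarrow> inv' (inv' a) = a"
  and inv_add: "a \<in> carrier C \<Longrightarrow> b \<in> carrier C \<Longrightarrow> inv' (a \<oplus>\<^bsub>C\<^esub> b) = inv' a \<oplus>\<^bsub>C\<^esub> inv' b"
  and inv_mult: "a \<in> carrier C \<Longrightarrow> b \<in> carrier C \<Longrightarrow> inv' (a \<otimes>\<^bsub>C\<^esub> b) = inv' b \<otimes>\<^bsub>C\<^esub> inv' a"
  and inv_smult: "a \<in> carrier C \<Longrightarrow> inv' (c \<odot>\<^bsub>C\<^esub> a) = fps_cnj c \<odot>\<^bsub>C\<^esub> inv' a"
  using star by (simp_all add: unital_star_algebra_def)

lemma C_smult_mult:
  assumes "a \<in> carrier C" "b \<in> carrier C"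
  shows "(c \<odot>\<^bsub>C\<^esub> a) \<otimes>\<^bsub>C\<^esub> b = c \<odot>\<^bsub>C\<^esub> (a \<otimes>\<^bsub>C\<^esub> b)" "a \<otimes>\<^bsub>C\<^esub> (c \<odot>\<^bsub>C\<^esub> b) = c \<odot>\<^bsub>C\<^esub> (a \<otimes>\<^bsub>C\<^esub> b)"
  using star assms by (simp_all add: unital_star_algebra_def bilinear_map_def linear_map_def)

lemma act_closed [simp]: "x \<in> carrier X \<Longrightarrow> a \<in> carrier C \<Longrightarrow> act x a \<in> carrier X"
  and act_add_right: "x \<in> carrier X \<Longrightarrow> a \<in> carrier C \<Longrightarrow> b \<in> carrier C \<Longrightarrow>
    act x (a \<oplus>\<^bsub>C\<^esub> b) = act x a \<oplus>\<^bsub>X\<^esub> act x b"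
  and act_add_left: "x \<in> carrier X \<Longrightarrow> y \<in> carrier X \<Longrightarrow> a \<in> carrier C \<Longrightarrow>
    act (x \<oplus>\<^bsub>X\<^esub> y) a = act x a \<oplus>\<^bsub>X\<^esub> act y a"
  and act_smult_right: "x \<in> carrier X \<Longrightarrow> a \<in> carrier C \<Longrightarrow> act x (c \<odot>\<^bsub>C\<^esub> a) = c \<odot>\<^bsub>X\<^esub> act x a"
  and act_smult_left: "x \<in> carrier X \<Longrightarrow> a \<in> carrier C \<Longrightarrow> act (c \<odot>\<^bsub>X\<^esub> x) a = c \<odot>\<^bsub>X\<^esub> act x a"
  and act_mult: "x \<in> carrier X \<Longrightarrow> a \<in> carrier C \<Longrightarrow> b \<in> carrier C \<Longrightarrow>
    act x (a \<otimes>\<^bsub>C\<^esub> b) = act (act x a) b"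
  using right by (simp_all add: right_module_def bilinear_map_def linear_map_def)

lemma X_smult_closed [simp]: "x \<in> carrier X \<Longrightarrow> c \<odot>\<^bsub>X\<^esub> x \<in> carrier X"
  using X.smult_closed[of c x] by simp

lemma C_smult_closed [simp]: "x \<in> carrier C \<Longrightarrow> c \<odot>\<^bsub>C\<^esub> x \<in> carrier C"
  using CM.smult_closed[of c x] by simp

lemma ip_closed [simp]: "x \<in> carrier X \<Longrightarrow> y \<in> carrier X \<Longrightarrow> ip x y \<in> carrier C"
  and ip_add_right: "x \<in> carrier X \<Longrightarrow> y \<in> carrier X \<Longrightarrow> z \<in> carrier X \<Longrightarrow>
    ip x (y \<oplus>\<^bsub>X\<^esub> z) = ip x y \<oplus>\<^bsub>C\<^esub> ip x z"
  and ip_smult_right: "x \<in> carrier X \<Longrightarrow> y \<in> carrier X \<Longrightarrow> ip x (c \<odot>\<^bsub>X\<^esub> y) = c \<odot>\<^bsub>C\<^esub> ip x y"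
  and ip_inv: "x \<in> carrier X \<Longrightarrow> y \<in> carrier X \<Longrightarrow> inv' (ip x y) = ip y x"
  and ip_act_right: "x \<in> carrier X \<Longrightarrow> y \<in> carrier X \<Longrightarrow> a \<in> carrier C \<Longrightarrow>
    ip x (act y a) = ip x y \<otimes>\<^bsub>C\<^esub> a"
  using inner by (simp_all add: right_inner_product_def linear_map_def)

lemma ip_add_left: "x \<in> carrier X \<Longrightarrow> y \<in> carrier X \<Longrightarrow> z \<in> carrier X \<Longrightarrow>
    ip (x \<oplus>\<^bsub>X\<^esub> y) z = ip x z \<oplus>\<^bsub>C\<^esub> ip y z"
  using ip_inv[of z "x \<oplus>\<^bsub>X\<^esub> y"] ip_inv[of z x] ip_inv[of z y] by (simp add: ip_add_right inv_add)

lemma ip_smult_left: "x \<in> carrier X \<Longrightarrow> z \<in> carrier X \<Longrightarrow> ip (c \<odot>\<^bsub>X\<^esub> x) z = fps_cnj c \<odot>\<^bsub>C\<^esub> ip x z"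
  using ip_inv[of z "c \<odot>\<^bsub>X\<^esub> x"] ip_inv[of z x] by (simp add: ip_smult_right inv_smult)

lemma ip_act_left: "x \<in> carrier X \<Longrightarrow> z \<in> carrier X \<Longrightarrow> a \<in> carrier C \<Longrightarrow>
    ip (act x a) z = inv' a \<otimes>\<^bsub>C\<^esub> ip x z"
  using ip_inv[of z "act x a"] ip_inv[of z x] by (simp add: ip_act_right inv_mult)

lemma act_finsum:
  "x \<in> carrier X \<Longrightarrow> finite I \<Longrightarrow> (\<And>i. i \<in> I \<Longrightarrow> g i \<in> carrier C) \<Longrightarrow>
    act x (\<Oplus>\<^bsub>C\<^esub>i\<in>I. g i) = (\<Oplus>\<^bsub>X\<^esub>i\<in>I. act x (g i))"
  by (rule additive_finsum[OF C.is_abelian_group X.M.abelian_group_axioms]) (auto simp: act_add_right)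

lemma act_finsum_left:
  "a \<in> carrier C \<Longrightarrow> finite I \<Longrightarrow> (\<And>i. i \<in> I \<Longrightarrow> g i \<in> carrier X) \<Longrightarrow>
    act (\<Oplus>\<^bsub>X\<^esub>i\<in>I. g i) a = (\<Oplus>\<^bsub>X\<^esub>i\<in>I. act (g i) a)"
  by (rule additive_finsum[where f = "\<lambda>x. act x a", OF X.M.abelian_group_axioms X.M.abelian_group_axioms])
     (auto simp: act_add_left)

lemma ip_finsum:
  "x \<in> carrier X \<Longrightarrow> finite I \<Longrightarrow> (\<And>i. i \<in> I \<Longrightarrow> g i \<in> carrier X) \<Longrightarrow>
    ip x (\<Oplus>\<^bsub>X\<^esub>i\<in>I. g i) = (\<Oplus>\<^bsub>C\<^esub>i\<in>I. ip x (g i))"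
  by (rule additive_finsum[OF X.M.abelian_group_axioms C.is_abelian_group]) (auto simp: ip_add_right)

lemma ip_finsum_left:
  "x \<in> carrier X \<Longrightarrow> finite I \<Longrightarrow> (\<And>i. i \<in> I \<Longrightarrow> g i \<in> carrier X) \<Longrightarrow>
    ip (\<Oplus>\<^bsub>X\<^esub>i\<in>I. g i) x = (\<Oplus>\<^bsub>C\<^esub>i\<in>I. ip (g i) x)"
  by (rule additive_finsum[where f = "\<lambda>y. ip y x", OF X.M.abelian_group_axioms C.is_abelian_group])
     (auto simp: ip_add_left)

end

section \<open>Parseval frames give equivalence bimodules\<close>

locale parseval_module = inner_module_axioms C X act ip
  for C :: "('c, 'z) star_algebra_scheme"
    and X :: "(complex fps, 'x, 'y) module_scheme"
    and act :: "'x \<Rightarrow> 'c \<Rightarrow> 'x" and ip :: "'x \<Rightarrow> 'x \<Rightarrow> 'c" +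
  fixes J K :: "nat set" and xs ys :: "nat \<Rightarrow> 'x"
  assumes J: "finite J" "\<And>j. j \<in> J \<Longrightarrow> xs j \<in> carrier X"
    and parseval: "\<And>z. z \<in> carrier X \<Longrightarrow> (\<Oplus>\<^bsub>X\<^esub>j\<in>J. act (xs j) (ip (xs j) z)) = z"
    and K: "finite K" "\<And>k. k \<in> K \<Longrightarrow> ys k \<in> carrier X"
    and unit_sum: "(\<Oplus>\<^bsub>C\<^esub>k\<in>K. ip (ys k) (ys k)) = \<one>\<^bsub>C\<^esub>"
begin

section \<open>Endomorphisms and their adjoints\<close>

definition End where
  "End = {T \<in> carrier X \<rightarrow>\<^sub>E carrier X.
                 (\<forall>x\<in>carrier X. \<forall>y\<in>carrier X. T (x \<oplus>\<^bsub>X\<^esub> y) = T x \<oplus>\<^bsub>X\<^esub> T y) \<and>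
                 (\<forall>x\<in>carrier X. \<forall>a\<in>carrier C. T (act x a) = act (T x) a)}"

definition D :: "('x \<Rightarrow> 'x) star_algebra" where "D = endomorphism_algebra C X act ip"

definition \<Theta> where "\<Theta> x y = (\<lambda>z\<in>carrier X. act x (ip y z))"

text \<open>The frame expansion of the adjoint of T at y: its coefficient <x_j, T^* y> is rewritten
  as <T x_j, y>.\<close>

definition adj where "adj T = (\<lambda>y\<in>carrier X. \<Oplus>\<^bsub>X\<^esub>j\<in>J. act (xs j) (ip (T (xs j)) y))"

lemma D_simps:
  "carrier D = End" "S \<otimes>\<^bsub>D\<^esub> T = compose (carrier X) S T" "\<one>\<^bsub>D\<^esub> = (\<lambda>x\<in>carrier X. x)"
  "\<zero>\<^bsub>D\<^esub> = (\<lambda>x\<in>carrier X. \<zero>\<^bsub>X\<^esub>)" "S \<oplus>\<^bsub>D\<^esub> T = (\<lambda>x\<in>carrier X. S x \<oplus>\<^bsub>X\<^esub> T x)"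
  "c \<odot>\<^bsub>D\<^esub> T = (\<lambda>x\<in>carrier X. c \<odot>\<^bsub>X\<^esub> T x)"
  "involution D T = (THE S. S \<in> End \<and> (\<forall>x\<in>carrier X. \<forall>y\<in>carrier X. ip x (T y) = ip (S x) y))"
  by (simp_all add: D_def endomorphism_algebra_def End_def)

lemma End_closed [simp]: "T \<in> End \<Longrightarrow> x \<in> carrier X \<Longrightarrow> T x \<in> carrier X"
  and End_add: "T \<in> End \<Longrightarrow> x \<in> carrier X \<Longrightarrow> y \<in> carrier X \<Longrightarrow> T (x \<oplus>\<^bsub>X\<^esub> y) = T x \<oplus>\<^bsub>X\<^esub> T y"
  and End_act: "T \<in> End \<Longrightarrow> x \<in> carrier X \<Longrightarrow> a \<in> carrier C \<Longrightarrow> T (act x a) = act (T x) a"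
  by (auto simp: End_def)

lemma EndI:
  assumes "\<And>x. x \<in> carrier X \<Longrightarrow> f x \<in> carrier X"
    and "\<And>x y. x \<in> carrier X \<Longrightarrow> y \<in> carrier X \<Longrightarrow> f (x \<oplus>\<^bsub>X\<^esub> y) = f x \<oplus>\<^bsub>X\<^esub> f y"
    and "\<And>x a. x \<in> carrier X \<Longrightarrow> a \<in> carrier C \<Longrightarrow> f (act x a) = act (f x) a"
  shows "(\<lambda>x\<in>carrier X. f x) \<in> End"
  using assms by (auto simp: End_def)

lemma End_eqI:
  assumes "S \<in> End" "T \<in> End" "\<And>x. x \<in> carrier X \<Longrightarrow> S x = T x"
  shows "S = T"
  using assms by (auto simp: End_def intro: PiE_ext)

text \<open>Membership in \<open>End\<close> only asks for additivity and right linearity; scalars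
  are included because c acts as the algebra element c times the unit.\<close>

lemma End_smult:
  assumes "T \<in> End" "x \<in> carrier X" shows "T (c \<odot>\<^bsub>X\<^esub> x) = c \<odot>\<^bsub>X\<^esub> T x"
proof -
  have "c \<odot>\<^bsub>X\<^esub> x = act x (c \<odot>\<^bsub>C\<^esub> \<one>\<^bsub>C\<^esub>)" using assms by (simp add: act_smult_right)
  then have "T (c \<odot>\<^bsub>X\<^esub> x) = act (T x) (c \<odot>\<^bsub>C\<^esub> \<one>\<^bsub>C\<^esub>)" using assms by (simp add: End_act)
  also have "\<dots> = c \<odot>\<^bsub>X\<^esub> T x" using assms by (simp add: act_smult_right)
  finally show ?thesis .
qed

lemma End_finsum:
  "T \<in> End \<Longrightarrow> finite I \<Longrightarrow> (\<And>i. i \<in> I \<Longrightarrow> g i \<in> carrier X) \<Longrightarrow>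
    T (\<Oplus>\<^bsub>X\<^esub>i\<in>I. g i) = (\<Oplus>\<^bsub>X\<^esub>i\<in>I. T (g i))"
  by (rule additive_finsum[OF X.M.abelian_group_axioms X.M.abelian_group_axioms]) (auto simp: End_add)

lemma compose_End: "S \<in> End \<Longrightarrow> T \<in> End \<Longrightarrow> compose (carrier X) S T \<in> End"
  unfolding compose_def by (rule EndI) (auto simp: End_add End_act)

lemma add_End: "S \<in> End \<Longrightarrow> T \<in> End \<Longrightarrow> (\<lambda>x\<in>carrier X. S x \<oplus>\<^bsub>X\<^esub> T x) \<in> End"
  by (rule EndI) (auto simp: End_add End_act act_add_left X.M.a_ac)

lemma smult_End: "T \<in> End \<Longrightarrow> (\<lambda>x\<in>carrier X. c \<odot>\<^bsub>X\<^esub> T x) \<in> End"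
  by (rule EndI) (auto simp: End_add End_act act_smult_left X.smult_r_distr)

lemma one_End: "(\<lambda>x\<in>carrier X. x) \<in> End"
  by (rule EndI) auto

lemma act_zero: "a \<in> carrier C \<Longrightarrow> act \<zero>\<^bsub>X\<^esub> a = \<zero>\<^bsub>X\<^esub>"
  using additive_zero[where f = "\<lambda>x. act x a", OF X.M.abelian_group_axioms X.M.abelian_group_axioms]
  by (simp add: act_add_left)

lemma zero_End: "(\<lambda>x\<in>carrier X. \<zero>\<^bsub>X\<^esub>) \<in> End"
  by (rule EndI) (auto simp: act_zero)

lemma \<Theta>_End: "x \<in> carrier X \<Longrightarrow> y \<in> carrier X \<Longrightarrow> \<Theta> x y \<in> End"
  unfolding \<Theta>_def by (rule EndI) (auto simp: act_add_right ip_add_right ip_act_right act_mult)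

lemma adj_End: "T \<in> End \<Longrightarrow> adj T \<in> End"
  unfolding adj_def
proof (rule EndI)
  assume T: "T \<in> End"
  have c: "T (xs j) \<in> carrier X" "xs j \<in> carrier X" if "j \<in> J" for j using that T J by auto
  fix x y a assume x: "x \<in> carrier X"
  show "(\<Oplus>\<^bsub>X\<^esub>j\<in>J. act (xs j) (ip (T (xs j)) x)) \<in> carrier X"
    using c x by (intro X.M.finsum_closed) auto
  show "(\<Oplus>\<^bsub>X\<^esub>j\<in>J. act (xs j) (ip (T (xs j)) (x \<oplus>\<^bsub>X\<^esub> y))) =
      (\<Oplus>\<^bsub>X\<^esub>j\<in>J. act (xs j) (ip (T (xs j)) x)) \<oplus>\<^bsub>X\<^esub> (\<Oplus>\<^bsub>X\<^esub>j\<in>J. act (xs j) (ip (T (xs j)) y))"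
    if y: "y \<in> carrier X"
  proof -
    have "(\<Oplus>\<^bsub>X\<^esub>j\<in>J. act (xs j) (ip (T (xs j)) (x \<oplus>\<^bsub>X\<^esub> y))) =
        (\<Oplus>\<^bsub>X\<^esub>j\<in>J. act (xs j) (ip (T (xs j)) x) \<oplus>\<^bsub>X\<^esub> act (xs j) (ip (T (xs j)) y))"
      using c x y by (intro X.M.finsum_cong') (auto simp: ip_add_right act_add_right)
    also have "\<dots> = (\<Oplus>\<^bsub>X\<^esub>j\<in>J. act (xs j) (ip (T (xs j)) x)) \<oplus>\<^bsub>X\<^esub> (\<Oplus>\<^bsub>X\<^esub>j\<in>J. act (xs j) (ip (T (xs j)) y))"
      using c x y by (intro X.M.finsum_addf) auto
    finally show ?thesis .
  qed
  show "(\<Oplus>\<^bsub>X\<^esub>j\<in>J. act (xs j) (ip (T (xs j)) (act x a))) =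
      act (\<Oplus>\<^bsub>X\<^esub>j\<in>J. act (xs j) (ip (T (xs j)) x)) a" if a: "a \<in> carrier C"
    using c x a J(1) by (subst act_finsum_left) (auto simp: ip_act_right act_mult intro!: X.M.finsum_cong')
qed

text \<open>Expanding y in the frame, T only has to be known on the x_j; both sides become the sum
  of <x, T x_j> <x_j, y>.\<close>

lemma adj:
  assumes T: "T \<in> End" and x: "x \<in> carrier X" and y: "y \<in> carrier X"
  shows "ip x (T y) = ip (adj T x) y"
proof -
  have c: "T (xs j) \<in> carrier X" "xs j \<in> carrier X" if "j \<in> J" for j using that T J by auto
  have "T y = T (\<Oplus>\<^bsub>X\<^esub>j\<in>J. act (xs j) (ip (xs j) y))" using parseval[OF y] by simp
  also have "\<dots> = (\<Oplus>\<^bsub>X\<^esub>j\<in>J. act (T (xs j)) (ip (xs j) y))"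
    using c y J(1) T by (subst End_finsum) (auto simp: End_act intro!: X.M.finsum_cong')
  finally have "ip x (T y) = (\<Oplus>\<^bsub>C\<^esub>j\<in>J. ip x (T (xs j)) \<otimes>\<^bsub>C\<^esub> ip (xs j) y)"
    using c x y J(1) by (simp add: ip_finsum) (auto simp: ip_act_right intro!: C.finsum_cong')
  moreover have "ip (adj T x) y = (\<Oplus>\<^bsub>C\<^esub>j\<in>J. ip x (T (xs j)) \<otimes>\<^bsub>C\<^esub> ip (xs j) y)"
    using c x y J(1) by (simp add: adj_def ip_finsum_left) (auto simp: ip_act_left ip_inv intro!: C.finsum_cong')
  ultimately show ?thesis by simp
qed

text \<open>A vector is determined by its frame coefficients <x_j, x>.\<close>

lemma ip_nondegenerate:
  assumes "x \<in> carrier X" "x' \<in> carrier X" "\<And>y. y \<in> carrier X \<Longrightarrow> ip x y = ip x' y"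
  shows "x = x'"
proof -
  have "ip (xs j) x = ip (xs j) x'" if "j \<in> J" for j
    using assms J(2)[OF that] ip_inv[of x "xs j"] ip_inv[of x' "xs j"] by metis
  then have "(\<Oplus>\<^bsub>X\<^esub>j\<in>J. act (xs j) (ip (xs j) x)) = (\<Oplus>\<^bsub>X\<^esub>j\<in>J. act (xs j) (ip (xs j) x'))"
    using assms J(2) by (intro X.M.finsum_cong') auto
  then show ?thesis using parseval assms by simp
qed

text \<open>Uniqueness of adjoints evaluates the definite description. Each law of the involution
  then reduces to exhibiting one operator that satisfies the adjunction rule.\<close>

lemma involution_D_eqI:
  assumes "T \<in> End" "S \<in> End" "\<And>x y. x \<in> carrier X \<Longrightarrow> y \<in> carrier X \<Longrightarrow> ip x (T y) = ip (S x) y"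
  shows "involution D T = S"
  unfolding D_simps
proof (rule the_equality)
  show "S \<in> End \<and> (\<forall>x\<in>carrier X. \<forall>y\<in>carrier X. ip x (T y) = ip (S x) y)" using assms by blast
  fix S' assume S': "S' \<in> End \<and> (\<forall>x\<in>carrier X. \<forall>y\<in>carrier X. ip x (T y) = ip (S' x) y)"
  show "S' = S"
  proof (rule End_eqI)
    fix x assume x: "x \<in> carrier X"
    show "S' x = S x"
      by (rule ip_nondegenerate) (use S' assms x End_closed in \<open>auto simp: End_closed\<close>)
  qed (use S' assms in auto)
qed

lemma involution_D: "T \<in> End \<Longrightarrow> involution D T = adj T"
  by (rule involution_D_eqI) (auto simp: adj_End adj)

lemma involution_End [simp]: "T \<in> End \<Longrightarrow> involution D T \<in> End"
  by (simp add: involution_D adj_End)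

lemma involution_adj: "T \<in> End \<Longrightarrow> x \<in> carrier X \<Longrightarrow> y \<in> carrier X \<Longrightarrow>
    ip x (T y) = ip (involution D T x) y"
  by (simp add: involution_D adj)

lemma involution_adj': "T \<in> End \<Longrightarrow> x \<in> carrier X \<Longrightarrow> y \<in> carrier X \<Longrightarrow>
    ip (T x) y = ip x (involution D T y)"
  using involution_adj[of T y x] ip_inv[of y "T x"] ip_inv[of "involution D T y" x] by simp

lemma abelian_group_D: "abelian_group D"
proof (rule abelian_groupI)
  fix T assume "T \<in> carrier D"
  then have T: "T \<in> End" by (simp add: D_simps)
  have "(- 1) \<odot>\<^bsub>X\<^esub> x \<oplus>\<^bsub>X\<^esub> x = \<zero>\<^bsub>X\<^esub>" if "x \<in> carrier X" for x
    using X.smult_l_distr[of "- 1" 1 x] X.smult_l_null[of x] X.smult_one[of x] that by simp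
  then have "(\<lambda>x\<in>carrier X. (- 1) \<odot>\<^bsub>X\<^esub> T x) \<oplus>\<^bsub>D\<^esub> T = \<zero>\<^bsub>D\<^esub>"
    using T by (auto simp: D_simps fun_eq_iff)
  then show "\<exists>S\<in>carrier D. S \<oplus>\<^bsub>D\<^esub> T = \<zero>\<^bsub>D\<^esub>" 
    using smult_End[OF T, of "- 1"] by (intro bexI[of _ "\<lambda>x\<in>carrier X. (- 1) \<odot>\<^bsub>X\<^esub> T x"]) (simp_all add: D_simps(1))
next
  fix T assume "T \<in> carrier D"
  then have T: "T \<in> End" by (simp add: D_simps)
  show "\<zero>\<^bsub>D\<^esub> \<oplus>\<^bsub>D\<^esub> T = T"
    unfolding D_simps by (rule End_eqI[OF add_End[OF zero_End T] T]) (use T in simp)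
qed (auto simp: D_simps add_End zero_End X.M.a_ac fun_eq_iff)

lemma module_D: "Module.module complex_series D"
proof (rule moduleI[OF cring_ring_of_type abelian_group_D])
  fix T assume "T \<in> carrier D"
  then have T: "T \<in> End" by (simp add: D_simps)
  show "\<one>\<^bsub>complex_series\<^esub> \<odot>\<^bsub>D\<^esub> T = T"
    unfolding D_simps
    by (rule End_eqI[OF smult_End[OF T] T]) (use X.smult_one T in auto)
  fix c d :: "complex fps" and S
  show "(c \<oplus>\<^bsub>complex_series\<^esub> d) \<odot>\<^bsub>D\<^esub> T = c \<odot>\<^bsub>D\<^esub> T \<oplus>\<^bsub>D\<^esub> d \<odot>\<^bsub>D\<^esub> T"
    using X.smult_l_distr[of c d] T by (auto simp: D_simps fun_eq_iff)
  show "(c \<otimes>\<^bsub>complex_series\<^esub> d) \<odot>\<^bsub>D\<^esub> T = c \<odot>\<^bsub>D\<^esub> (d \<odot>\<^bsub>D\<^esub> T)"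
    using X.smult_assoc1[of c d] T by (auto simp: D_simps fun_eq_iff)
  assume "S \<in> carrier D"
  then have S: "S \<in> End" by (simp add: D_simps)
  show "c \<odot>\<^bsub>D\<^esub> (T \<oplus>\<^bsub>D\<^esub> S) = c \<odot>\<^bsub>D\<^esub> T \<oplus>\<^bsub>D\<^esub> c \<odot>\<^bsub>D\<^esub> S"
    using X.smult_r_distr[of c] T S by (auto simp: D_simps fun_eq_iff)
qed (auto simp: D_simps smult_End)

lemma ring_D: "Ring.ring D"
proof (rule ringI[OF abelian_group_D])
  show "monoid D"
  proof (rule monoidI)
    fix T assume "T \<in> carrier D"
    then have T: "T \<in> End" by (simp add: D_simps)
    show "\<one>\<^bsub>D\<^esub> \<otimes>\<^bsub>D\<^esub> T = T"
      unfolding D_simps by (rule End_eqI[OF compose_End[OF one_End T] T]) (use T in \<open>simp add: compose_def\<close>)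
    show "T \<otimes>\<^bsub>D\<^esub> \<one>\<^bsub>D\<^esub> = T"
      unfolding D_simps by (rule End_eqI[OF compose_End[OF T one_End] T]) (use T in \<open>simp add: compose_def\<close>)
  qed (auto simp: D_simps one_End compose_End, auto simp: compose_def fun_eq_iff)
qed (auto simp: D_simps compose_def fun_eq_iff End_add)

lemma star_D: "unital_star_algebra D"
  unfolding unital_star_algebra_def
proof (intro conjI ballI allI)
  show "bilinear_map complex_series D D D (mult D)"
    unfolding bilinear_map_def linear_map_def
    by (auto simp: D_simps compose_End, auto simp: compose_def fun_eq_iff End_add End_smult)
  fix S T c assume "S \<in> carrier D"
  then have S: "S \<in> End" by (simp add: D_simps)
  show "involution D S \<in> carrier D" using S by (simp add: D_simps(1))
  show "involution D (involution D S) = S"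
    by (rule involution_D_eqI) (use S involution_adj' in auto)
  show "involution D (c \<odot>\<^bsub>D\<^esub> S) = fps_cnj c \<odot>\<^bsub>D\<^esub> involution D S"
    unfolding D_simps(6)
    by (rule involution_D_eqI) (use S in \<open>auto simp: smult_End ip_smult_left ip_smult_right involution_adj\<close>)
  assume "T \<in> carrier D"
  then have T: "T \<in> End" by (simp add: D_simps)
  show "involution D (S \<oplus>\<^bsub>D\<^esub> T) = involution D S \<oplus>\<^bsub>D\<^esub> involution D T"
    unfolding D_simps(5)
    by (rule involution_D_eqI) (use S T in \<open>auto simp: add_End ip_add_left ip_add_right involution_adj\<close>)
  show "involution D (S \<otimes>\<^bsub>D\<^esub> T) = involution D T \<otimes>\<^bsub>D\<^esub> involution D S"
    unfolding D_simps(2)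
    by (rule involution_D_eqI)
       (use S T in \<open>auto simp: compose_End compose_eq involution_adj\<close>)
qed (rule ring_D, rule module_D)

section \<open>The bimodule, its decompositions and its fullness\<close>

definition F :: "('x \<Rightarrow> 'x, 'c, 'x) inner_bimodule" where
  "F = \<lparr>carrier = carrier X, mult = undefined, one = undefined, zero = zero X, add = add X,
       smult = smult X, left_act = (\<lambda>T x. T x), right_act = act, left_ip = \<Theta>, right_ip = ip\<rparr>"

lemma F_simps [simp]:
  "carrier F = carrier X" "zero F = zero X" "add F = add X" "smult F = smult X"
  "left_act F T x = T x" "right_act F = act" "left_ip F = \<Theta>" "right_ip F = ip"
  by (simp_all add: F_def)

lemma module_F: "Module.module complex_series F"
  by (rule module_cong[OF X.module_axioms]) simp_all

lemma \<Theta>_apply: "z \<in> carrier X \<Longrightarrow> \<Theta> x y z = act x (ip y z)"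
  by (simp add: \<Theta>_def)

lemma involution_\<Theta>: "x \<in> carrier X \<Longrightarrow> y \<in> carrier X \<Longrightarrow> involution D (\<Theta> x y) = \<Theta> y x"
  by (rule involution_D_eqI) (auto simp: \<Theta>_End \<Theta>_apply ip_act_right ip_act_left ip_inv)

lemma \<Theta>_add:
  "x \<in> carrier X \<Longrightarrow> y \<in> carrier X \<Longrightarrow> z \<in> carrier X \<Longrightarrow> \<Theta> (x \<oplus>\<^bsub>X\<^esub> y) z = \<Theta> x z \<oplus>\<^bsub>D\<^esub> \<Theta> y z"
  "x \<in> carrier X \<Longrightarrow> y \<in> carrier X \<Longrightarrow> z \<in> carrier X \<Longrightarrow> \<Theta> z (x \<oplus>\<^bsub>X\<^esub> y) = \<Theta> z x \<oplus>\<^bsub>D\<^esub> \<Theta> z y"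
  by (auto simp: \<Theta>_def D_simps fun_eq_iff act_add_left ip_add_left act_add_right)

lemma \<Theta>_smult:
  "x \<in> carrier X \<Longrightarrow> z \<in> carrier X \<Longrightarrow> \<Theta> (c \<odot>\<^bsub>X\<^esub> x) z = c \<odot>\<^bsub>D\<^esub> \<Theta> x z"
  "x \<in> carrier X \<Longrightarrow> z \<in> carrier X \<Longrightarrow> \<Theta> z (c \<odot>\<^bsub>X\<^esub> x) = fps_cnj c \<odot>\<^bsub>D\<^esub> \<Theta> z x"
  by (auto simp: \<Theta>_def D_simps fun_eq_iff act_smult_left ip_smult_left act_smult_right)

lemma \<Theta>_left: "T \<in> End \<Longrightarrow> x \<in> carrier X \<Longrightarrow> y \<in> carrier X \<Longrightarrow> \<Theta> (T x) y = T \<otimes>\<^bsub>D\<^esub> \<Theta> x y"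
  by (auto simp: \<Theta>_def D_simps compose_def fun_eq_iff End_act)

lemma \<Theta>_right: "T \<in> End \<Longrightarrow> x \<in> carrier X \<Longrightarrow> y \<in> carrier X \<Longrightarrow>
    \<Theta> x (involution D T y) = \<Theta> x y \<otimes>\<^bsub>D\<^esub> T"
  by (auto simp: \<Theta>_def D_simps(2) compose_def fun_eq_iff involution_adj)

lemma finsum_D_apply:
  assumes "finite I" "\<And>i. i \<in> I \<Longrightarrow> g i \<in> End" "x \<in> carrier X"
  shows "(\<Oplus>\<^bsub>D\<^esub>i\<in>I. g i) x = (\<Oplus>\<^bsub>X\<^esub>i\<in>I. g i x)"
  by (rule additive_finsum[where f = "\<lambda>T. T x", OF abelian_group_D X.M.abelian_group_axioms])
     (use assms in \<open>auto simp: D_simps\<close>)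

lemma finsum_D_closed:
  assumes "\<And>i. i \<in> I \<Longrightarrow> g i \<in> End" shows "(\<Oplus>\<^bsub>D\<^esub>i\<in>I. g i) \<in> End"
proof -
  interpret D: abelian_group D by (rule abelian_group_D)
  show ?thesis using D.finsum_closed[of g I] assms by (auto simp: D_simps(1))
qed

lemma ip_decomposition:
  assumes "x \<in> carrier X" "y \<in> carrier X"
  shows "ip x y = (\<Oplus>\<^bsub>C\<^esub>j\<in>J. ip x (xs j) \<otimes>\<^bsub>C\<^esub> ip (xs j) y)"
proof -
  have "ip x y = ip x (\<Oplus>\<^bsub>X\<^esub>j\<in>J. act (xs j) (ip (xs j) y))" using parseval assms by simp
  also have "\<dots> = (\<Oplus>\<^bsub>C\<^esub>j\<in>J. ip x (xs j) \<otimes>\<^bsub>C\<^esub> ip (xs j) y)"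
    using assms J by (simp add: ip_finsum) (auto simp: ip_act_right intro!: C.finsum_cong')
  finally show ?thesis .
qed

text \<open>Applied to z, the product of \<Theta>(x, y_k) and \<Theta>(y_k, y) is x <y_k, y_k> <y,
  z>; the sum over k therefore inserts the unit between x and <y, z>.\<close>

lemma \<Theta>_decomposition:
  assumes x: "x \<in> carrier X" and y: "y \<in> carrier X"
  shows "\<Theta> x y = (\<Oplus>\<^bsub>D\<^esub>k\<in>K. \<Theta> x (ys k) \<otimes>\<^bsub>D\<^esub> \<Theta> (ys k) y)"
proof -
  interpret D: Ring.ring D by (rule ring_D)
  have t: "\<Theta> x (ys k) \<otimes>\<^bsub>D\<^esub> \<Theta> (ys k) y \<in> End" if "k \<in> K" for k
    using that x y K(2) D.m_closed[of "\<Theta> x (ys k)" "\<Theta> (ys k) y"] by (simp add: D_simps(1) \<Theta>_End)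
  show ?thesis
  proof (rule End_eqI[OF \<Theta>_End[OF x y] finsum_D_closed[OF t]])
    fix z assume z: "z \<in> carrier X"
    have "(\<Oplus>\<^bsub>D\<^esub>k\<in>K. \<Theta> x (ys k) \<otimes>\<^bsub>D\<^esub> \<Theta> (ys k) y) z = (\<Oplus>\<^bsub>X\<^esub>k\<in>K. (\<Theta> x (ys k) \<otimes>\<^bsub>D\<^esub> \<Theta> (ys k) y) z)"
      by (rule finsum_D_apply[OF K(1) t z])
    also have "\<dots> = (\<Oplus>\<^bsub>X\<^esub>k\<in>K. act (act x (ip (ys k) (ys k))) (ip y z))"
      using x y z K by (intro X.M.finsum_cong')
        (auto simp: D_simps compose_def \<Theta>_apply ip_act_right act_mult)
    also have "\<dots> = act (act x (\<Oplus>\<^bsub>C\<^esub>k\<in>K. ip (ys k) (ys k))) (ip y z)"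
      using x y z K by (simp add: act_finsum act_finsum_left)
    also have "\<dots> = \<Theta> x y z" using x y z by (simp add: unit_sum \<Theta>_apply)
    finally show "\<Theta> x y z = (\<Oplus>\<^bsub>D\<^esub>k\<in>K. \<Theta> x (ys k) \<otimes>\<^bsub>D\<^esub> \<Theta> (ys k) y) z" ..
  qed
qed

lemma \<Theta>_positive:
  assumes x: "x \<in> carrier X" shows "\<Theta> x x \<in> positive_elements D"
  unfolding positive_elements_def
proof (intro CollectI conjI allI impI)
  interpret D: Ring.ring D by (rule ring_D)
  show "\<Theta> x x \<in> carrier D" using x by (simp add: D_simps(1) \<Theta>_End)
  fix \<omega> assume \<omega>: "positive_functional D \<omega>"
  have c: "\<Theta> x (ys k) \<in> carrier D" "\<Theta> (ys k) x \<in> carrier D" if "k \<in> K" for k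
    using x K(2)[OF that] by (simp_all add: D_simps(1) \<Theta>_End)
  have "\<omega> (\<Theta> x x) = \<omega> (\<Oplus>\<^bsub>D\<^esub>k\<in>K. \<Theta> x (ys k) \<otimes>\<^bsub>D\<^esub> \<Theta> (ys k) x)"
    by (rule arg_cong[OF \<Theta>_decomposition[OF x x]])
  also have "\<dots> = (\<Sum>k\<in>K. \<omega> (\<Theta> x (ys k) \<otimes>\<^bsub>D\<^esub> \<Theta> (ys k) x))"
    by (rule additive_finsum_type[OF abelian_group_D _ K(1)])
       (use \<omega> c in \<open>auto simp: positive_functional_def\<close>)
  also have "\<dots> = (\<Sum>k\<in>K. \<omega> (involution D (\<Theta> (ys k) x) \<otimes>\<^bsub>D\<^esub> \<Theta> (ys k) x))"
    using x K(2) by (intro sum.cong) (auto simp: involution_\<Theta>)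
  finally show "fps_nonneg (\<omega> (\<Theta> x x))"
    using \<omega> c by (auto simp: positive_functional_def intro!: fps_nonneg_sum)
qed

abbreviation F' where "F' \<equiv> conjugate_bimodule D C F"

lemma F'_simps [simp]:
  "carrier F' = carrier X" "zero F' = zero X" "add F' = add X"
  "c \<odot>\<^bsub>F'\<^esub> x = fps_cnj c \<odot>\<^bsub>X\<^esub> x" "right_act F' x T = involution D T x" "right_ip F' = \<Theta>"
  by (simp_all add: conjugate_bimodule_def)

lemma module_F': "Module.module complex_series F'"
proof (rule moduleI[OF cring_ring_of_type])
  show "abelian_group F'"
    by (rule abelian_groupI)
       (use X.M.add.inv_closed X.M.l_neg in \<open>auto simp: X.M.a_ac\<close>)
  fix c d :: "complex fps" and x y
  assume "x \<in> carrier F'"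
  then have x: "x \<in> carrier X" by simp
  show "(c \<oplus>\<^bsub>complex_series\<^esub> d) \<odot>\<^bsub>F'\<^esub> x = c \<odot>\<^bsub>F'\<^esub> x \<oplus>\<^bsub>F'\<^esub> d \<odot>\<^bsub>F'\<^esub> x"
    using X.smult_l_distr[of "fps_cnj c" "fps_cnj d" x] x by simp
  show "(c \<otimes>\<^bsub>complex_series\<^esub> d) \<odot>\<^bsub>F'\<^esub> x = c \<odot>\<^bsub>F'\<^esub> (d \<odot>\<^bsub>F'\<^esub> x)"
    using X.smult_assoc1[of "fps_cnj c" "fps_cnj d" x] x by simp
  show "\<one>\<^bsub>complex_series\<^esub> \<odot>\<^bsub>F'\<^esub> x = x" using X.smult_one[of x] x by simp
  assume "y \<in> carrier F'"
  then show "c \<odot>\<^bsub>F'\<^esub> (x \<oplus>\<^bsub>F'\<^esub> y) = c \<odot>\<^bsub>F'\<^esub> x \<oplus>\<^bsub>F'\<^esub> c \<odot>\<^bsub>F'\<^esub> y"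
    using X.smult_r_distr[of "fps_cnj c" x y] x by simp
qed auto

lemma star_D_rules:
  assumes "S \<in> End" "T \<in> End"
  shows "involution D (S \<oplus>\<^bsub>D\<^esub> T) = involution D S \<oplus>\<^bsub>D\<^esub> involution D T"
    and "involution D (S \<otimes>\<^bsub>D\<^esub> T) = involution D T \<otimes>\<^bsub>D\<^esub> involution D S"
    and "involution D (c \<odot>\<^bsub>D\<^esub> T) = fps_cnj c \<odot>\<^bsub>D\<^esub> involution D T"
  using star_D assms unfolding unital_star_algebra_def D_simps(1) by blast+

text \<open>On the conjugate bimodule T acts from the right as its adjoint, and the right inner
  product is \<Theta>. With the y_k as intermediate vectors, the criterion used for (P)
  applies.\<close>

lemma property_Q: "property_P T D F'"
proof (rule property_PI[OF star_D _ _ K(1), where zs = ys])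
  show "right_module D F' (right_act F')"
    unfolding right_module_def bilinear_map_def linear_map_def
    by (auto simp: module_F' star_D_rules End_add End_smult D_simps(1) simp del: D_simps(2-))
       (auto simp: D_simps(2,5,6) compose_def)
  show "right_inner_product D F' (right_act F') (right_ip F')"
    unfolding right_inner_product_def linear_map_def
    by (auto simp: \<Theta>_add \<Theta>_smult \<Theta>_End involution_\<Theta> \<Theta>_right \<Theta>_positive D_simps(1))
  show "right_ip F' x y = (\<Oplus>\<^bsub>D\<^esub>k\<in>K. right_ip F' x (ys k) \<otimes>\<^bsub>D\<^esub> right_ip F' (ys k) y)"
    if "x \<in> carrier F'" "y \<in> carrier F'" for x y
    using that \<Theta>_decomposition by simp
qed (use K in auto)

lemma right_F: "right_module C F (right_act F)"
  using right module_F by (simp add: right_module_def bilinear_map_def linear_map_def)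

lemma inner_F: "right_inner_product C F (right_act F) (right_ip F)"
  using inner by (simp add: right_inner_product_def linear_map_def)

text \<open>The element is absorbed into the second argument: a is the sum of <y_k, y_k> a, hence of
  <y_k, y_k a>.\<close>

lemma full_C: "lin_span complex_series C {ip x y | x y. x \<in> carrier X \<and> y \<in> carrier X} = carrier C"
proof (rule lin_span_eq_carrier[OF CM.module_axioms])
  fix a assume a: "a \<in> carrier C"
  have "a = (\<Oplus>\<^bsub>C\<^esub>k\<in>K. ip (ys k) (ys k)) \<otimes>\<^bsub>C\<^esub> a" using a by (simp add: unit_sum)
  also have "\<dots> = (\<Oplus>\<^bsub>C\<^esub>k\<in>K. ip (ys k) (act (ys k) a))"
    using a K by (subst C.finsum_ldistr) (auto simp: ip_act_right intro!: C.finsum_cong')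
  finally have "a = (\<Oplus>\<^bsub>C\<^esub>k\<in>K. ip (ys k) (act (ys k) a))" .
  moreover have "(\<lambda>k. ip (ys k) (act (ys k) a)) ` K \<subseteq> {ip x y | x y. x \<in> carrier X \<and> y \<in> carrier X}"
    using a K(2) act_closed by blast
  ultimately show "\<exists>I g. finite I \<and> g ` I \<subseteq> {ip x y | x y. x \<in> carrier X \<and> y \<in> carrier X} \<and>
      a = finsum C (g :: nat \<Rightarrow> _) I"
    using K(1) by (intro exI[of _ K] exI[of _ "\<lambda>k. ip (ys k) (act (ys k) a)"] conjI)
qed auto

text \<open>T z is T applied to the frame expansion of z, so T is the sum of the operators
  \<Theta>(T x_j, x_j).\<close>

lemma full_D: "lin_span complex_series D {\<Theta> x y | x y. x \<in> carrier X \<and> y \<in> carrier X} = carrier D"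
proof (rule lin_span_eq_carrier[OF module_D])
  fix T assume "T \<in> carrier D"
  then have T: "T \<in> End" by (simp add: D_simps)
  have c: "T (xs j) \<in> carrier X" "xs j \<in> carrier X" if "j \<in> J" for j using that T J by auto
  have "T = (\<Oplus>\<^bsub>D\<^esub>j\<in>J. \<Theta> (T (xs j)) (xs j))"
  proof (rule End_eqI[OF T finsum_D_closed])
    fix z assume z: "z \<in> carrier X"
    have "(\<Oplus>\<^bsub>D\<^esub>j\<in>J. \<Theta> (T (xs j)) (xs j)) z = (\<Oplus>\<^bsub>X\<^esub>j\<in>J. \<Theta> (T (xs j)) (xs j) z)"
      by (rule finsum_D_apply[OF J(1) _ z]) (use c in \<open>auto simp: \<Theta>_End\<close>)
    also have "\<dots> = (\<Oplus>\<^bsub>X\<^esub>j\<in>J. T (act (xs j) (ip (xs j) z)))"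
      using c T z by (intro X.M.finsum_cong') (auto simp: \<Theta>_apply End_act)
    also have "\<dots> = T (\<Oplus>\<^bsub>X\<^esub>j\<in>J. act (xs j) (ip (xs j) z))"
      using c z by (subst End_finsum[OF T J(1)]) auto
    also have "\<dots> = T z" using parseval z by simp
    finally show "T z = (\<Oplus>\<^bsub>D\<^esub>j\<in>J. \<Theta> (T (xs j)) (xs j)) z" ..
  qed (use c in \<open>auto simp: \<Theta>_End\<close>)
  moreover have "(\<lambda>j. \<Theta> (T (xs j)) (xs j)) ` J \<subseteq> {\<Theta> x y | x y. x \<in> carrier X \<and> y \<in> carrier X}"
    using c by blast
  ultimately show "\<exists>I g. finite I \<and> g ` I \<subseteq> {\<Theta> x y | x y. x \<in> carrier X \<and> y \<in> carrier X} \<and>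
      T = finsum D (g :: nat \<Rightarrow> _) I"
    using J(1) by (intro exI[of _ J] exI[of _ "\<lambda>j. \<Theta> (T (xs j)) (xs j)"] conjI)
qed (auto simp: D_simps(1) \<Theta>_End)

theorem equivalence: "equivalence_bimodule T D C F"
  unfolding equivalence_bimodule_def
proof (intro conjI ballI)
  show "unital_star_algebra D" by (rule star_D)
  show "unital_star_algebra C" by (rule star)
  show "left_module D F (left_act F)"
    unfolding left_module_def bilinear_map_def linear_map_def
    by (auto simp: module_F End_add End_smult D_simps compose_def)
  show "right_module C F (right_act F)" by (rule right_F)
  show "right_act F (left_act F d x) c = left_act F d (right_act F x c)"
    if "d \<in> carrier D" "x \<in> carrier F" "c \<in> carrier C" for d x c
    using that by (simp add: D_simps(1) End_act)
  show "right_inner_product C F (right_act F) (right_ip F)" by (rule inner_F)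
  show "left_inner_product D F (left_act F) (left_ip F)"
    unfolding left_inner_product_def linear_map_def
    by (auto simp: \<Theta>_add \<Theta>_smult \<Theta>_End involution_\<Theta> \<Theta>_left \<Theta>_positive D_simps(1))
  show "lin_span complex_series C {right_ip F x y |x y. x \<in> carrier F \<and> y \<in> carrier F} = carrier C"
    using full_C by simp
  show "lin_span complex_series D {left_ip F x y |x y. x \<in> carrier F \<and> y \<in> carrier F} = carrier D"
    using full_D by simp
  show "right_ip F x (left_act F d y) = right_ip F (left_act F (involution D d) x) y"
    if "x \<in> carrier F" "y \<in> carrier F" "d \<in> carrier D" for x y d
    using that by (simp add: D_simps(1) involution_adj)
  show "left_ip F x (right_act F y c) = left_ip F (right_act F x (involution C c)) y"
    if "x \<in> carrier F" "y \<in> carrier F" "c \<in> carrier C" for x y c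
    using that by (auto simp: \<Theta>_def fun_eq_iff ip_act_left act_mult)
  show "left_act F (left_ip F x y) z = right_act F x (right_ip F y z)"
    if "x \<in> carrier F" "y \<in> carrier F" "z \<in> carrier F" for x y z
    using that by (simp add: \<Theta>_apply)
  show "property_P T C F"
    by (rule property_PI[OF star right_F inner_F J(1), where zs = xs])
       (use J ip_decomposition in auto)
  show "property_P T D (conjugate_bimodule D C F)" by (rule property_Q)
qed

end

section \<open>Formal power series modules\<close>

text \<open>Equality modulo \<lambda>^n: no condition for n = 0, equality of the zeroth orders for n
  = 1.\<close>

definition agree :: "nat \<Rightarrow> 'x fps \<Rightarrow> 'x fps \<Rightarrow> bool" where
  "agree n x y \<longleftrightarrow> (\<forall>j<n. fps_nth x j = fps_nth y j)"

lemma agree_trans: "agree n x y \<Longrightarrow> agree n y z \<Longrightarrow> agree n x z"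
  by (simp add: agree_def)

lemma agree_sym: "agree n x y \<Longrightarrow> agree n y x"
  by (simp add: agree_def)

lemma agree_refl [simp]: "agree n x x"
  by (simp add: agree_def)

lemma agree_all_eqI: "(\<And>n. agree (Suc n) x y) \<Longrightarrow> x = y"
  by (rule fps_ext) (auto simp: agree_def)

text \<open>Functionals \<open>ev i\<close> separating points turn identities in a formal series module into
  identities between complex power series.\<close>

locale separated_space =
  fixes V :: "(complex, 'x, 'z) module_scheme" and ev :: "'i \<Rightarrow> 'x \<Rightarrow> complex"
  assumes complex_module: "Module.module complex_field V"
    and ev_add: "x \<in> carrier V \<Longrightarrow> y \<in> carrier V \<Longrightarrow> ev i (x \<oplus>\<^bsub>V\<^esub> y) = ev i x + ev i y"
    and ev_smult: "x \<in> carrier V \<Longrightarrow> ev i (c \<odot>\<^bsub>V\<^esub> x) = c * ev i x"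
    and ev_sep: "x \<in> carrier V \<Longrightarrow> y \<in> carrier V \<Longrightarrow> (\<And>i. ev i x = ev i y) \<Longrightarrow> x = y"
begin

sublocale V: Module.module complex_field V by (rule complex_module)

abbreviation FV where "FV \<equiv> formal_module V"

definition fev :: "'i \<Rightarrow> 'x fps \<Rightarrow> complex fps" where
  "fev i x = Abs_fps (\<lambda>n. ev i (fps_nth x n))"

lemma fev_nth [simp]: "fps_nth (fev i x) n = ev i (fps_nth x n)"
  by (simp add: fev_def)

lemma FV_carrier: "x \<in> carrier FV \<longleftrightarrow> (\<forall>n. fps_nth x n \<in> carrier V)"
  by (simp add: formal_module_def)

lemma FV_nth: "x \<in> carrier FV \<Longrightarrow> fps_nth x n \<in> carrier V"
  by (simp add: FV_carrier)

lemma FV_add_nth [simp]: "fps_nth (x \<oplus>\<^bsub>FV\<^esub> y) n = fps_nth x n \<oplus>\<^bsub>V\<^esub> fps_nth y n"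
  by (simp add: formal_module_def)

lemma FV_zero_nth [simp]: "fps_nth \<zero>\<^bsub>FV\<^esub> n = \<zero>\<^bsub>V\<^esub>"
  by (simp add: formal_module_def)

lemma FV_smult_nth:
  "fps_nth (c \<odot>\<^bsub>FV\<^esub> x) n = (\<Oplus>\<^bsub>V\<^esub>k\<in>{..n}. fps_nth c k \<odot>\<^bsub>V\<^esub> fps_nth x (n - k))"
  by (simp add: formal_module_def)

lemma V_smult_closed [simp]: "x \<in> carrier V \<Longrightarrow> c \<odot>\<^bsub>V\<^esub> x \<in> carrier V"
  using V.smult_closed[of c x] by simp

lemma FV_add_closed [simp]: "x \<in> carrier FV \<Longrightarrow> y \<in> carrier FV \<Longrightarrow> x \<oplus>\<^bsub>FV\<^esub> y \<in> carrier FV"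
  by (simp add: FV_carrier)

lemma FV_zero_closed [simp]: "\<zero>\<^bsub>FV\<^esub> \<in> carrier FV"
  by (simp add: FV_carrier)

lemma FV_smult_closed [simp]: "x \<in> carrier FV \<Longrightarrow> c \<odot>\<^bsub>FV\<^esub> x \<in> carrier FV"
  by (auto simp: FV_carrier FV_smult_nth intro!: V.M.finsum_closed)

declare FV_nth [simp]

lemma ev_finsum:
  "finite I \<Longrightarrow> (\<And>j. j \<in> I \<Longrightarrow> g j \<in> carrier V) \<Longrightarrow> ev i (finsum V g I) = (\<Sum>j\<in>I. ev i (g j))"
  by (rule additive_finsum_type[OF V.M.abelian_group_axioms]) (auto simp: ev_add)

lemma ev_zero: "ev i \<zero>\<^bsub>V\<^esub> = 0"
  using ev_finsum[of "{}"] by simp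

lemma fev_add: "x \<in> carrier FV \<Longrightarrow> y \<in> carrier FV \<Longrightarrow> fev i (x \<oplus>\<^bsub>FV\<^esub> y) = fev i x + fev i y"
  by (rule fps_ext) (simp add: ev_add)

lemma fev_zero: "fev i \<zero>\<^bsub>FV\<^esub> = 0"
  by (rule fps_ext) (simp add: ev_zero)

lemma fev_smult: "x \<in> carrier FV \<Longrightarrow> fev i (c \<odot>\<^bsub>FV\<^esub> x) = c * fev i x"
  by (rule fps_ext)
     (simp add: FV_smult_nth ev_finsum ev_smult fps_mult_nth atLeast0AtMost)

lemma fev_eqI: "x \<in> carrier FV \<Longrightarrow> y \<in> carrier FV \<Longrightarrow> (\<And>i. fev i x = fev i y) \<Longrightarrow> x = y"
  by (rule fps_ext, rule ev_sep) (auto simp: fps_eq_iff)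

lemma agree_fev:
  "x \<in> carrier FV \<Longrightarrow> y \<in> carrier FV \<Longrightarrow>
    agree n x y \<longleftrightarrow> (\<forall>i. \<forall>j<n. fps_nth (fev i x) j = fps_nth (fev i y) j)"
  unfolding agree_def fev_nth using ev_sep[OF FV_nth FV_nth] by metis

lemma FV_module: "Module.module complex_series FV"
proof (rule moduleI[OF cring_ring_of_type])
  show "abelian_group FV"
  proof (rule abelian_groupI)
    fix x assume x: "x \<in> carrier FV"
    show "\<exists>y\<in>carrier FV. y \<oplus>\<^bsub>FV\<^esub> x = \<zero>\<^bsub>FV\<^esub>"
      by (rule bexI[of _ "(- 1) \<odot>\<^bsub>FV\<^esub> x"], rule fev_eqI)
         (use x in \<open>auto simp: fev_add fev_smult fev_zero\<close>)
  qed (auto intro!: fev_eqI simp: fev_add fev_zero)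
qed (auto intro!: fev_eqI simp: fev_add fev_smult algebra_simps)

section \<open>Newton iteration towards the identity operator\<close>

lemma agree_decompose:
  assumes "x \<in> carrier FV" "y \<in> carrier FV" "agree n x y"
  obtains w where "w \<in> carrier FV" "\<And>i. fev i y = fev i x + fps_X ^ n * fev i w"
proof -
  \<comment> \<open>The difference y - x, divided by \<lambda>^n.\<close>
  define w where "w = Abs_fps (\<lambda>j. fps_nth y (j + n) \<oplus>\<^bsub>V\<^esub> (- 1) \<odot>\<^bsub>V\<^esub> fps_nth x (j + n))"
  have "w \<in> carrier FV" unfolding FV_carrier w_def using assms by simp
  moreover have "fev i y = fev i x + fps_X ^ n * fev i w" for i
    using assms by (intro fps_ext)
      (auto simp: w_def fps_X_power_mult_nth ev_add ev_smult agree_def)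
  ultimately show thesis by (rule that)
qed

definition linear_endo :: "('x fps \<Rightarrow> 'x fps) \<Rightarrow> bool" where
  "linear_endo L \<longleftrightarrow> (\<forall>x\<in>carrier FV. L x \<in> carrier FV) \<and>
     (\<forall>x\<in>carrier FV. \<forall>y\<in>carrier FV. L (x \<oplus>\<^bsub>FV\<^esub> y) = L x \<oplus>\<^bsub>FV\<^esub> L y) \<and>
     (\<forall>c. \<forall>x\<in>carrier FV. L (c \<odot>\<^bsub>FV\<^esub> x) = c \<odot>\<^bsub>FV\<^esub> L x)"

text \<open>The relation is known through the functionals \<open>fev i\<close>, but L acts on the
  module, so it is first lifted to the module by separation of points.\<close>

lemma linear_endo_decompose:
  assumes L: "linear_endo L" and xw: "x \<in> carrier FV" "y \<in> carrier FV" "w \<in> carrier FV"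
    and eq: "\<And>i. fev i y = fev i x + c * fev i w"
  shows "fev i (L y) = fev i (L x) + c * fev i (L w)"
proof -
  have "y = x \<oplus>\<^bsub>FV\<^esub> c \<odot>\<^bsub>FV\<^esub> w"
    by (rule fev_eqI) (use xw in \<open>auto simp: fev_add fev_smult eq\<close>)
  then show ?thesis using L xw by (simp add: linear_endo_def fev_add fev_smult)
qed

text \<open>The correction \<open>Q = (3 - L) / 2\<close> is the linearisation of \<open>L\<^sup>-\<^sup>1\<^sup>/\<^sup>2\<close> at \<open>L = 1\<close>; with
  \<open>L = 1 + \<delta>\<close> one has \<open>Q L Q = 1 - (3/4) \<delta>\<^sup>2 + (1/4) \<delta>\<^sup>3\<close>.\<close>

definition correction :: "('x fps \<Rightarrow> 'x fps) \<Rightarrow> 'x fps \<Rightarrow> 'x fps" where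
  "correction L x = fps_const (3 / 2) \<odot>\<^bsub>FV\<^esub> x \<oplus>\<^bsub>FV\<^esub> fps_const (- 1 / 2) \<odot>\<^bsub>FV\<^esub> L x"

lemma correction_closed [simp]: "linear_endo L \<Longrightarrow> x \<in> carrier FV \<Longrightarrow> correction L x \<in> carrier FV"
  by (simp add: correction_def linear_endo_def)

lemma fev_correction:
  "linear_endo L \<Longrightarrow> x \<in> carrier FV \<Longrightarrow>
    fev i (correction L x) = fps_const (3 / 2) * fev i x + fps_const (- 1 / 2) * fev i (L x)"
  by (simp add: correction_def linear_endo_def fev_add fev_smult)

lemma linear_endo_correction:
  assumes L: "linear_endo L" shows "linear_endo (correction L)"
  unfolding linear_endo_def
proof (intro conjI ballI allI)
  have c: "L x \<in> carrier FV" if "x \<in> carrier FV" for x using L that by (simp add: linear_endo_def)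
  show "correction L (x \<oplus>\<^bsub>FV\<^esub> y) = correction L x \<oplus>\<^bsub>FV\<^esub> correction L y"
    if "x \<in> carrier FV" "y \<in> carrier FV" for x y
    using that L c by (intro fev_eqI) (auto simp: fev_correction[OF L] fev_add algebra_simps linear_endo_def)
  show "correction L (a \<odot>\<^bsub>FV\<^esub> x) = a \<odot>\<^bsub>FV\<^esub> correction L x" if "x \<in> carrier FV" for x a
    using that L c by (intro fev_eqI) (auto simp: fev_correction[OF L] fev_smult algebra_simps linear_endo_def)
qed (use L in auto)

lemma agree_correction:
  assumes L: "linear_endo L" and x: "x \<in> carrier FV" and "agree n (L x) x"
  shows "agree n (correction L x) x"
proof -
  have "L x \<in> carrier FV" using L x by (simp add: linear_endo_def)
  then have "ev i (fps_nth (L x) j) = ev i (fps_nth x j)" if "j < n" for i j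
    using assms that by (simp add: agree_def)
  then have "fps_nth (fev i (correction L x)) j = fps_nth (fev i x) j" if "j < n" for i j
    using that by (simp add: fev_correction[OF L x] del: fev_nth) (simp add: field_simps)
  then show ?thesis using agree_fev[of "correction L x" x n] L x by simp
qed

text \<open>Write L = 1 + \<delta>. The vectors w and v are \<delta> x and \<delta>^2 x, divided by
  \<lambda>^n and \<lambda>^(2n). Hence Q L Q x differs from x by (1/4) \<delta>^2 (L - 4) x, which
  is divisible by \<lambda>^(2n); as n is at least 1, this covers \<lambda>^(n+1).\<close>

lemma newton_order:
  assumes L: "linear_endo L" and agree: "\<And>x. x \<in> carrier FV \<Longrightarrow> agree n (L x) x" and n: "n \<ge> 1"
    and x: "x \<in> carrier FV"
  shows "agree (Suc n) (correction L (L (correction L x))) x"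
proof -
  have c [simp]: "L x \<in> carrier FV" if "x \<in> carrier FV" for x using L that by (simp add: linear_endo_def)
  let ?X = "fps_X ^ n :: complex fps"
  obtain w where w: "w \<in> carrier FV" "\<And>i. fev i (L x) = fev i x + ?X * fev i w"
    using agree_decompose[OF x c[OF x] agree_sym[OF agree[OF x]]] by metis
  obtain v where v: "v \<in> carrier FV" "\<And>i. fev i (L w) = fev i w + ?X * fev i v"
    using agree_decompose[OF w(1) c[OF w(1)] agree_sym[OF agree[OF w(1)]]] by metis
  note y2 = linear_endo_decompose[OF L x c[OF x] w]
  note w2 = linear_endo_decompose[OF L w(1) c[OF w(1)] v]
  have y3: "fev i (L (L (L x))) = fev i (L (L x)) + ?X * fev i (L (L w))" for i
    by (rule linear_endo_decompose[OF L _ _ _ y2]) (use x w in auto)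
  have Q: "linear_endo (correction L)" by (rule linear_endo_correction[OF L])
  have LQ: "fev i (L (correction L y)) = fps_const (3 / 2) * fev i (L y) + fps_const (- 1 / 2) * fev i (L (L y))"
    if "y \<in> carrier FV" for y i
    using L that by (simp add: correction_def linear_endo_def fev_add fev_smult)
  have LLQ: "fev i (L (L (correction L y))) = fps_const (3 / 2) * fev i (L (L y)) + fps_const (- 1 / 2) * fev i (L (L (L y)))"
    if "y \<in> carrier FV" for y i
    using L that by (simp add: correction_def linear_endo_def fev_add fev_smult)
  have "fev i (correction L (L (correction L x))) =
      fev i x + ?X * (?X * (fps_const (1 / 4) * (fev i (L v) - fps_const 4 * fev i v)))" for i
  proof -
    have k: "fps_const (3 / 2 :: complex) = fps_const (1 / 4) * 6" "fps_const (- 1 / 2 :: complex) = fps_const (1 / 4) * (- 2)"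
      "fps_const (1 / 4 :: complex) * 4 = 1" "fps_const (4 :: complex) = 4"
      by (simp_all add: numeral_fps_const fps_const_neg[symmetric] del: fps_const_neg)
    \<comment> \<open>Denominators are cleared: with q = 1/4 as a series, Q is 6q - 2q L, and the
      factor 16 cancels q^2, so the rest can be treated with integer coefficients.\<close>
    have "16 * fev i (correction L (L (correction L x))) =
        16 * (fev i x + ?X * (?X * (fps_const (1 / 4) * (fev i (L v) - fps_const 4 * fev i v))))"
    proof -
      define q :: "complex fps" where "q = fps_const (1 / 4)"
      have q: "4 * q = 1" using k(3) by (simp add: q_def mult.commute)
      have "fev i (correction L (L (correction L x))) =
          q * 6 * (q * 6 * fev i (L x) + q * (- 2) * fev i (L (L x))) +
          q * (- 2) * (q * 6 * fev i (L (L x)) + q * (- 2) * fev i (L (L (L x))))"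
        using x by (simp only: fev_correction[OF L c[OF correction_closed[OF L x]]] LQ[OF x] LLQ[OF x] k(1,2) q_def)
      also have "16 * \<dots> = (4 * q) * (4 * q) * (36 * fev i (L x) - 24 * fev i (L (L x)) + 4 * fev i (L (L (L x))))"
        by (simp add: algebra_simps)
      also have "\<dots> = 16 * fev i x + 4 * (?X * (?X * (fev i (L v) - 4 * fev i v)))"
        unfolding q y3 w2 y2 v w by (simp add: algebra_simps)
      also have "\<dots> = 16 * fev i x + 4 * (4 * q) * (?X * (?X * (fev i (L v) - 4 * fev i v)))"
        unfolding q by simp
      also have "\<dots> = 16 * (fev i x + ?X * (?X * (q * (fev i (L v) - 4 * fev i v))))"
        by (simp add: algebra_simps)
      finally show ?thesis by (simp only: q_def k(4))
    qed
    moreover have "(16 :: complex fps) \<noteq> 0" by simp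
    ultimately show ?thesis using mult_left_cancel[of "16 :: complex fps"] by blast
  qed
  then have eq: "fev i (correction L (L (correction L x))) = fev i x +
      fps_X ^ (n + n) * (fps_const (1 / 4) * (fev i (L v) - fps_const 4 * fev i v))" for i
    by (simp add: power_add mult.assoc)
  have "fps_nth (fev i (correction L (L (correction L x)))) j = fps_nth (fev i x) j" if "j < Suc n" for i j
    using that n unfolding eq by (simp add: fps_X_power_mult_nth)
  then show ?thesis
    using agree_fev[of "correction L (L (correction L x))" x "Suc n"] x L by simp
qed

text \<open>The unknowns are families z, but the error is measured by the operator
  \<open>\<Phi> z\<close>. A step has to transform the operator by the Newton map and to move z only
  in the orders where \<open>\<Phi> z\<close> may still differ from the identity. Then the families
  converge coefficientwise, and continuity of \<Phi> passes to the limit. Families and operators may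
  live in different spaces, as they do in \<open>deformed_unit_sum\<close>.\<close>

lemma newton_limit:
  fixes \<Phi> :: "('j \<Rightarrow> 'f fps) \<Rightarrow> 'x fps \<Rightarrow> 'x fps" and J :: "'j set" and S :: "'f set"
  defines "Z \<equiv> {z. \<forall>j\<in>J. \<forall>n. fps_nth (z j) n \<in> S}"
  assumes lin: "\<And>z. z \<in> Z \<Longrightarrow> linear_endo (\<Phi> z)"
    and cont: "\<And>z z' n x. z \<in> Z \<Longrightarrow> z' \<in> Z \<Longrightarrow> (\<And>j. j \<in> J \<Longrightarrow> agree n (z j) (z' j)) \<Longrightarrow>
      x \<in> carrier FV \<Longrightarrow> agree n (\<Phi> z x) (\<Phi> z' x)"
    and step: "\<And>z. z \<in> Z \<Longrightarrow> \<exists>z'\<in>Z.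
      (\<forall>x\<in>carrier FV. \<Phi> z' x = correction (\<Phi> z) (\<Phi> z (correction (\<Phi> z) x))) \<and>
      (\<forall>n. (\<forall>x\<in>carrier FV. agree n (\<Phi> z x) x) \<longrightarrow> (\<forall>j\<in>J. agree n (z' j) (z j)))"
    and start: "z0 \<in> Z" "\<And>x. x \<in> carrier FV \<Longrightarrow> agree 1 (\<Phi> z0 x) x"
  obtains z where "z \<in> Z" "\<And>x. x \<in> carrier FV \<Longrightarrow> \<Phi> z x = x"
proof -
  \<comment> \<open>Stage n is correct in the orders 0 to n, hence \<open>Suc n\<close>. A gain of
    one order per step is enough.\<close>
  define P where "P n z \<longleftrightarrow> z \<in> Z \<and> (\<forall>x\<in>carrier FV. agree (Suc n) (\<Phi> z x) x)" for n z
  have "\<exists>f. \<forall>n. P n (f n) \<and> (\<forall>j\<in>J. agree (Suc n) (f (Suc n) j) (f n j))"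
  proof (rule dependent_nat_choice)
    show "\<exists>z. P 0 z" using start by (auto simp: P_def)
    fix z n assume "P n z"
    then have z: "z \<in> Z" "\<And>x. x \<in> carrier FV \<Longrightarrow> agree (Suc n) (\<Phi> z x) x" by (auto simp: P_def)
    obtain z' where z': "z' \<in> Z"
      "\<And>x. x \<in> carrier FV \<Longrightarrow> \<Phi> z' x = correction (\<Phi> z) (\<Phi> z (correction (\<Phi> z) x))"
      "\<And>n. (\<And>x. x \<in> carrier FV \<Longrightarrow> agree n (\<Phi> z x) x) \<Longrightarrow> \<forall>j\<in>J. agree n (z' j) (z j)"
      using step[OF z(1)] by blast
    have "P (Suc n) z'"
      using z'(1,2) newton_order[OF lin[OF z(1)] z(2)] by (simp add: P_def)
    then show "\<exists>z'. P (Suc n) z' \<and> (\<forall>j\<in>J. agree (Suc n) (z' j) (z j))"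
      using z'(3)[of "Suc n"] z(2) by blast
  qed
  then obtain f where f: "\<And>n. P n (f n)" "\<And>n j. j \<in> J \<Longrightarrow> agree (Suc n) (f (Suc n) j) (f n j)" by blast
  \<comment> \<open>The coefficient of \<lambda>^m is final from stage m on, so the diagonal gives
    the limit.\<close>
  define z where "z j = Abs_fps (\<lambda>m. fps_nth (f m j) m)" for j
  have coeff: "fps_nth (f n j) m = fps_nth (f m j) m" if "m \<le> n" "j \<in> J" for m n j
    using that(1)
  proof (induction n rule: dec_induct)
    case (step n)
    then show ?case using f(2)[OF that(2), of n] by (simp add: agree_def)
  qed simp
  have zf: "agree (Suc n) (z j) (f n j)" if "j \<in> J" for n j
    unfolding agree_def z_def
  proof (intro allI impI)
    fix m assume "m < Suc n"
    then show "fps_nth (Abs_fps (\<lambda>m. fps_nth (f m j) m)) m = fps_nth (f n j) m"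
      using coeff[of m n j] that by simp
  qed
  have fZ: "f n \<in> Z" for n using f(1) by (simp add: P_def)
  have z: "z \<in> Z" using fZ by (auto simp: Z_def z_def)
  have "\<Phi> z x = x" if x: "x \<in> carrier FV" for x
  proof (rule agree_all_eqI)
    fix n
    have "agree (Suc n) (\<Phi> z x) (\<Phi> (f n) x)" by (rule cont[OF z fZ zf x])
    then show "agree (Suc n) (\<Phi> z x) x"
      using f(1)[of n] x by (auto simp: P_def intro: agree_trans)
  qed
  with z show thesis by (rule that)
qed

text \<open>If x = L x + \<lambda>^n w, applying L gives L w = 0 by idempotence; hence w vanishes in
  order zero, and L x agrees with x to one more order. This makes the unit act as the identity on a
  deformed module.\<close>

lemma idempotent_agree_eq:
  assumes L: "linear_endo L" and agree: "\<And>x. x \<in> carrier FV \<Longrightarrow> agree 1 (L x) x"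
    and idem: "\<And>x. x \<in> carrier FV \<Longrightarrow> L (L x) = L x" and x: "x \<in> carrier FV"
  shows "L x = x"
proof -
  have c [simp]: "L x \<in> carrier FV" if "x \<in> carrier FV" for x using L that by (simp add: linear_endo_def)
  have "agree n (L x) x" for n
  proof (induction n)
    case (Suc n)
    obtain w where w: "w \<in> carrier FV" "\<And>i. fev i x = fev i (L x) + fps_X ^ n * fev i w"
      using agree_decompose[OF c[OF x] x Suc] by metis
    have "fev i (L x) = fev i (L (L x)) + fps_X ^ n * fev i (L w)" for i
      by (rule linear_endo_decompose[OF L c[OF x] x w])
    then have "fev i (L w) = 0" for i by (simp add: idem x)
    then have "ev i (fps_nth (L w) 0) = 0" for i by (metis fev_nth fps_zero_nth)
    then have w0: "ev i (fps_nth w 0) = 0" for i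
      using agree[OF w(1)] by (simp add: agree_def)
    have "fps_nth (fev i (L x)) j = fps_nth (fev i x) j" if "j < Suc n" for i j
      using that w0[of i] unfolding w(2)[of i] by (auto simp: fps_X_power_mult_nth less_Suc_eq)
    then show ?case using agree_fev[of "L x" x "Suc n"] x by simp
  qed (simp add: agree_def)
  then show ?thesis by (rule agree_all_eqI)
qed

lemma agree_finsum:
  assumes "finite I" "\<And>i. i \<in> I \<Longrightarrow> f i \<in> carrier FV" "\<And>i. i \<in> I \<Longrightarrow> g i \<in> carrier FV"
    "\<And>i. i \<in> I \<Longrightarrow> agree n (f i) (g i)"
  shows "agree n (finsum FV f I) (finsum FV g I)"
  unfolding agree_def
proof (intro allI impI)
  interpret FV: Module.module complex_series FV by (rule FV_module)
  fix j assume j: "j < n"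
  have *: "fps_nth (finsum FV h I) j = (\<Oplus>\<^bsub>V\<^esub>i\<in>I. fps_nth (h i) j)"
    if "\<And>i. i \<in> I \<Longrightarrow> h i \<in> carrier FV" for h
    by (rule additive_finsum[where f = "\<lambda>x. fps_nth x j", OF FV.M.abelian_group_axioms V.M.abelian_group_axioms])
       (use that assms(1) in auto)
  have "fps_nth (finsum FV f I) j = (\<Oplus>\<^bsub>V\<^esub>i\<in>I. fps_nth (f i) j)" by (rule *) (rule assms(2))
  also have "\<dots> = (\<Oplus>\<^bsub>V\<^esub>i\<in>I. fps_nth (g i) j)"
    by (rule V.M.finsum_cong') (use assms j in \<open>auto simp: agree_def\<close>)
  also have "\<dots> = fps_nth (finsum FV g I) j" by (rule *[symmetric]) (rule assms(3))
  finally show "fps_nth (finsum FV f I) j = fps_nth (finsum FV g I) j" .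
qed

section \<open>Coefficientwise extension of bilinear maps\<close>

context
  fixes b :: "nat \<Rightarrow> 'a \<Rightarrow> 'b \<Rightarrow> 'x" and S1 :: "'a set" and S2 :: "'b set"
  assumes b: "\<And>r s t. s \<in> S1 \<Longrightarrow> t \<in> S2 \<Longrightarrow> b r s t \<in> carrier V"
begin

lemma formal_extension_nth:
  "fps_nth (formal_extension V b x y) n =
    (\<Oplus>\<^bsub>V\<^esub>r\<in>{..n}. \<Oplus>\<^bsub>V\<^esub>s\<in>{..n - r}. b r (fps_nth x s) (fps_nth y (n - r - s)))"
  by (simp add: formal_extension_def)

lemma formal_extension_closed:
  assumes "\<And>n. fps_nth x n \<in> S1" "\<And>n. fps_nth y n \<in> S2"
  shows "formal_extension V b x y \<in> carrier FV"
  unfolding FV_carrier formal_extension_nth using assms b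
  by (auto intro!: V.M.finsum_closed)

lemma fev_formal_extension_nth:
  assumes "\<And>n. fps_nth x n \<in> S1" "\<And>n. fps_nth y n \<in> S2"
  shows "fps_nth (fev i (formal_extension V b x y)) n =
    (\<Sum>r\<le>n. \<Sum>s\<le>n - r. ev i (b r (fps_nth x s) (fps_nth y (n - r - s))))"
proof -
  have "ev i (\<Oplus>\<^bsub>V\<^esub>s\<in>{..n - r}. b r (fps_nth x s) (fps_nth y (n - r - s))) =
      (\<Sum>s\<le>n - r. ev i (b r (fps_nth x s) (fps_nth y (n - r - s))))" for r
    by (rule ev_finsum) (use assms b in auto)
  moreover have "ev i (\<Oplus>\<^bsub>V\<^esub>r\<in>{..n}. \<Oplus>\<^bsub>V\<^esub>s\<in>{..n - r}. b r (fps_nth x s) (fps_nth y (n - r - s))) =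
      (\<Sum>r\<le>n. ev i (\<Oplus>\<^bsub>V\<^esub>s\<in>{..n - r}. b r (fps_nth x s) (fps_nth y (n - r - s))))"
    by (rule ev_finsum) (use assms b in \<open>auto intro!: V.M.finsum_closed\<close>)
  ultimately show ?thesis by (simp add: formal_extension_nth)
qed

text \<open>Truncation is respected because the coefficient of \<lambda>^j only involves
  coefficients of the arguments of index at most j.\<close>

lemma formal_extension_agree:
  assumes "\<And>n. fps_nth x n \<in> S1" "\<And>n. fps_nth y n \<in> S2"
    and "\<And>n. fps_nth x' n \<in> S1" "\<And>n. fps_nth y' n \<in> S2"
    and "agree n x x'" "agree n y y'"
  shows "agree n (formal_extension V b x y) (formal_extension V b x' y')"
proof -
  have "fps_nth (fev i (formal_extension V b x y)) j = fps_nth (fev i (formal_extension V b x' y')) j"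
    if "j < n" for i j
    unfolding fev_formal_extension_nth[OF assms(1,2)] fev_formal_extension_nth[OF assms(3,4)]
    using assms(5,6) that by (intro sum.cong refl) (auto simp: agree_def)
  then show ?thesis
    using agree_fev[OF formal_extension_closed[OF assms(1,2)] formal_extension_closed[OF assms(3,4)]] by blast
qed

end

text \<open>Summing \<open>X\<^sup>r\<^sup>+\<^sup>s\<close> times the series \<open>\<Sum>\<^sub>t b\<^sub>r(x\<^sub>s, y\<^sub>t) X\<^sup>t\<close> makes linearity over the formal
  series visible.\<close>

lemma fev_formal_extension_sum:
  assumes b: "\<And>r s t. s \<in> S1 \<Longrightarrow> t \<in> S2 \<Longrightarrow> b r s t \<in> carrier V"
    and xy: "\<And>n. fps_nth x n \<in> S1" "\<And>n. fps_nth y n \<in> S2" and n: "n \<le> N"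
  shows "fps_nth (fev i (formal_extension V b x y)) n =
    fps_nth (\<Sum>r\<le>N. \<Sum>s\<le>N. fps_X ^ (r + s) * Abs_fps (\<lambda>t. ev i (b r (fps_nth x s) (fps_nth y t)))) n"
proof -
  have "(\<Sum>s\<le>N. if n < r + s then 0 else ev i (b r (fps_nth x s) (fps_nth y (n - (r + s))))) =
      (if r \<le> n then \<Sum>s\<le>n - r. ev i (b r (fps_nth x s) (fps_nth y (n - r - s))) else 0)" for r
  proof (cases "r \<le> n")
    case True
    have "(\<Sum>s\<le>N. if n < r + s then 0 else ev i (b r (fps_nth x s) (fps_nth y (n - (r + s))))) =
      (\<Sum>s\<le>n - r. if n < r + s then 0 else ev i (b r (fps_nth x s) (fps_nth y (n - (r + s)))))"
      by (rule sum.mono_neutral_right) (use n in auto)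
    also have "\<dots> = (\<Sum>s\<le>n - r. ev i (b r (fps_nth x s) (fps_nth y (n - r - s))))"
      using True by (intro sum.cong) auto
    finally show ?thesis using True by simp
  qed (auto intro!: sum.neutral)
  then have "fps_nth (\<Sum>r\<le>N. \<Sum>s\<le>N. fps_X ^ (r + s) * Abs_fps (\<lambda>t. ev i (b r (fps_nth x s) (fps_nth y t)))) n =
      (\<Sum>r\<le>N. if r \<le> n then \<Sum>s\<le>n - r. ev i (b r (fps_nth x s) (fps_nth y (n - r - s))) else 0)"
    by (simp add: fps_sum_nth fps_X_power_mult_nth cong: if_cong)
  also have "\<dots> = (\<Sum>r\<le>n. if r \<le> n then \<Sum>s\<le>n - r. ev i (b r (fps_nth x s) (fps_nth y (n - r - s))) else 0)"
    by (rule sum.mono_neutral_right) (use n in auto)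
  also have "\<dots> = fps_nth (fev i (formal_extension V b x y)) n"
    by (simp add: fev_formal_extension_nth[OF b xy] del: fev_nth)
  finally show ?thesis by simp
qed

end

context separated_space
begin

text \<open>Only the second argument carries a module structure; the first merely has coefficients
  in a set S1. For fixed r and s the series in t is linear over the formal series, and
  multiplication by X^(r+s) and summation preserve this.\<close>

lemma linear_formal_extension:
  assumes Y: "Module.module complex_field Y" and b: "\<And>r s. s \<in> S1 \<Longrightarrow> linear_map complex_field Y V (b r s)"
    and x: "\<And>n. fps_nth x n \<in> S1"
  shows "linear_map complex_series (formal_module Y) FV (formal_extension V b x)"
proof -
  interpret Y: Module.module complex_field Y by fact
  have bc: "b r s t \<in> carrier V" if "s \<in> S1" "t \<in> carrier Y" for r s t
    using b that by (simp add: linear_map_def)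
  have ba: "b r s (t \<oplus>\<^bsub>Y\<^esub> t') = b r s t \<oplus>\<^bsub>V\<^esub> b r s t'"
    if "s \<in> S1" "t \<in> carrier Y" "t' \<in> carrier Y" for r s t t'
    using b that by (simp add: linear_map_def)
  have bs: "b r s (c \<odot>\<^bsub>Y\<^esub> t) = c \<odot>\<^bsub>V\<^esub> b r s t" if "s \<in> S1" "t \<in> carrier Y" for r s t c
    using b that by (simp add: linear_map_def)
  have Y_nth: "fps_nth y n \<in> carrier Y" if "y \<in> carrier (formal_module Y)" for y n
    using that by (simp add: formal_module_def)
  have Y_add: "fps_nth (y \<oplus>\<^bsub>formal_module Y\<^esub> y') n = fps_nth y n \<oplus>\<^bsub>Y\<^esub> fps_nth y' n" for y y' n
    by (simp add: formal_module_def)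
  have Y_smult: "fps_nth (c \<odot>\<^bsub>formal_module Y\<^esub> y) n = (\<Oplus>\<^bsub>Y\<^esub>k\<in>{..n}. fps_nth c k \<odot>\<^bsub>Y\<^esub> fps_nth y (n - k))"
    for c y n by (simp add: formal_module_def)
  have Y_sc: "a \<odot>\<^bsub>Y\<^esub> t \<in> carrier Y" if "t \<in> carrier Y" for a t
    using Y.smult_closed[of a t] that by simp
  have Y_smult_closed: "fps_nth (c \<odot>\<^bsub>formal_module Y\<^esub> y) n \<in> carrier Y"
    if "y \<in> carrier (formal_module Y)" for c y n
    unfolding Y_smult using Y_nth[OF that] by (auto intro!: Y.M.finsum_closed Y_sc)
  let ?G = "\<lambda>i r s y. Abs_fps (\<lambda>t. ev i (b r (fps_nth x s) (fps_nth y t)))"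
  have G_smult: "?G i r s (c \<odot>\<^bsub>formal_module Y\<^esub> y) = c * ?G i r s y"
    if y: "y \<in> carrier (formal_module Y)" for i r s c y
  proof (rule fps_ext)
    fix t
    have "ev i (b r (fps_nth x s) (fps_nth (c \<odot>\<^bsub>formal_module Y\<^esub> y) t)) =
        (\<Sum>k\<le>t. ev i (b r (fps_nth x s) (fps_nth c k \<odot>\<^bsub>Y\<^esub> fps_nth y (t - k))))"
      unfolding Y_smult
      by (rule additive_finsum_type[where f = "\<lambda>u. ev i (b r (fps_nth x s) u)", OF Y.M.abelian_group_axioms])
         (use x Y_nth[OF y] in \<open>auto simp: ba bc ev_add intro!: Y_sc\<close>)
    also have "\<dots> = (\<Sum>k\<le>t. fps_nth c k * ev i (b r (fps_nth x s) (fps_nth y (t - k))))"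
      using x Y_nth[OF y] by (simp add: bs bc ev_smult)
    finally show "fps_nth (?G i r s (c \<odot>\<^bsub>formal_module Y\<^esub> y)) t = fps_nth (c * ?G i r s y) t"
      by (simp add: fps_mult_nth atLeast0AtMost)
  qed
  have sum: "fps_nth (fev i (formal_extension V b x y)) n =
      fps_nth (\<Sum>r\<le>N. \<Sum>s\<le>N. fps_X ^ (r + s) * ?G i r s y) n"
    if "\<And>n. fps_nth y n \<in> carrier Y" "n \<le> N" for y i n N
    by (rule fev_formal_extension_sum[where ?S1.0 = S1 and ?S2.0 = "carrier Y"]) (use bc x that in auto)
  have closed: "formal_extension V b x y \<in> carrier FV" if "\<And>n. fps_nth y n \<in> carrier Y" for y
    by (rule formal_extension_closed[where ?S1.0 = S1 and ?S2.0 = "carrier Y"]) (use bc x that in auto)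
  have nth: "fps_nth (fev i (formal_extension V b x y)) n =
      (\<Sum>r\<le>n. \<Sum>s\<le>n - r. ev i (b r (fps_nth x s) (fps_nth y (n - r - s))))"
    if "\<And>n. fps_nth y n \<in> carrier Y" for y i n
    by (rule fev_formal_extension_nth[where ?S1.0 = S1 and ?S2.0 = "carrier Y"]) (use bc x that in auto)
  show ?thesis
    unfolding linear_map_def
  proof (intro conjI ballI)
    fix y y' c assume y: "y \<in> carrier (formal_module Y)"
    show cl: "formal_extension V b x y \<in> carrier FV" by (rule closed) (rule Y_nth[OF y])
    have cl2: "formal_extension V b x (c \<odot>\<^bsub>formal_module Y\<^esub> y) \<in> carrier FV"
      by (rule closed) (rule Y_smult_closed[OF y])
    show "formal_extension V b x (c \<odot>\<^bsub>formal_module Y\<^esub> y) = c \<odot>\<^bsub>FV\<^esub> formal_extension V b x y"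
    proof (rule fev_eqI[OF cl2 FV_smult_closed[OF cl]], rule fps_ext)
      fix i n
      \<comment> \<open>Truncating at n serves all coefficients up to n at once, so the factor c can
        be pulled out of one finite sum before coefficients are compared.\<close>
      let ?S = "\<Sum>r\<le>n. \<Sum>s\<le>n. fps_X ^ (r + s) * ?G i r s y"
      have "fps_nth (fev i (formal_extension V b x (c \<odot>\<^bsub>formal_module Y\<^esub> y))) n =
          fps_nth (\<Sum>r\<le>n. \<Sum>s\<le>n. fps_X ^ (r + s) * ?G i r s (c \<odot>\<^bsub>formal_module Y\<^esub> y)) n"
        by (rule sum) (use Y_smult_closed[OF y] in auto)
      also have "\<dots> = fps_nth (c * ?S) n"
        unfolding G_smult[OF y] by (simp add: sum_distrib_left mult.left_commute)
      also have "\<dots> = (\<Sum>k\<le>n. fps_nth c k * fps_nth ?S (n - k))"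
        by (simp only: fps_mult_nth atLeast0AtMost)
      also have "\<dots> = (\<Sum>k\<le>n. fps_nth c k * fps_nth (fev i (formal_extension V b x y)) (n - k))"
      proof (intro sum.cong refl arg_cong2[where f = "(*)"])
        fix k assume "k \<in> {..n}"
        show "fps_nth ?S (n - k) = fps_nth (fev i (formal_extension V b x y)) (n - k)"
          by (rule sum[symmetric]) (use Y_nth[OF y] in auto)
      qed
      also have "\<dots> = fps_nth (c * fev i (formal_extension V b x y)) n"
        by (simp only: fps_mult_nth atLeast0AtMost)
      finally show "fps_nth (fev i (formal_extension V b x (c \<odot>\<^bsub>formal_module Y\<^esub> y))) n =
          fps_nth (fev i (c \<odot>\<^bsub>FV\<^esub> formal_extension V b x y)) n"
        by (simp only: fev_smult[OF cl])
    qed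
    assume y': "y' \<in> carrier (formal_module Y)"
    have cl': "formal_extension V b x y' \<in> carrier FV" by (rule closed) (rule Y_nth[OF y'])
    have yy: "fps_nth (y \<oplus>\<^bsub>formal_module Y\<^esub> y') n \<in> carrier Y" for n
      unfolding Y_add using Y_nth[OF y] Y_nth[OF y'] by simp
    have cl3: "formal_extension V b x (y \<oplus>\<^bsub>formal_module Y\<^esub> y') \<in> carrier FV"
      by (rule closed) (rule yy)
    show "formal_extension V b x (y \<oplus>\<^bsub>formal_module Y\<^esub> y') =
        formal_extension V b x y \<oplus>\<^bsub>FV\<^esub> formal_extension V b x y'"
    proof (rule fev_eqI[OF cl3 FV_add_closed[OF cl cl']], rule fps_ext)
      fix i n
      have "fps_nth (fev i (formal_extension V b x (y \<oplus>\<^bsub>formal_module Y\<^esub> y'))) n =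
          fps_nth (fev i (formal_extension V b x y)) n + fps_nth (fev i (formal_extension V b x y')) n"
        unfolding nth[OF yy] nth[OF Y_nth[OF y]] nth[OF Y_nth[OF y']] Y_add
        by (simp add: ba bc x Y_nth[OF y] Y_nth[OF y'] ev_add sum.distrib)
      then show "fps_nth (fev i (formal_extension V b x (y \<oplus>\<^bsub>formal_module Y\<^esub> y'))) n =
          fps_nth (fev i (formal_extension V b x y \<oplus>\<^bsub>FV\<^esub> formal_extension V b x y')) n"
        by (simp only: fev_add[OF cl cl'] fps_add_nth)
    qed
  qed
qed

text \<open>Reflecting s to n - r - s exchanges the arguments, so linearity in the first one is an
  instance of linearity in the second.\<close>

lemma formal_extension_swap:
  assumes b: "\<And>r s t. s \<in> S1 \<Longrightarrow> t \<in> S2 \<Longrightarrow> b r s t \<in> carrier V"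
    and xy: "\<And>n. fps_nth x n \<in> S1" "\<And>n. fps_nth y n \<in> S2"
  shows "formal_extension V b x y = formal_extension V (\<lambda>r t s. b r s t) y x"
proof (rule fev_eqI)
  show "formal_extension V b x y \<in> carrier FV"
    by (rule formal_extension_closed[where ?S1.0 = S1 and ?S2.0 = S2]) (use b xy in auto)
  show "formal_extension V (\<lambda>r t s. b r s t) y x \<in> carrier FV"
    by (rule formal_extension_closed[where ?S1.0 = S2 and ?S2.0 = S1]) (use b xy in auto)
  fix i
  show "fev i (formal_extension V b x y) = fev i (formal_extension V (\<lambda>r t s. b r s t) y x)"
  proof (rule fps_ext)
    fix n
    have 1: "fps_nth (fev i (formal_extension V b x y)) n =
        (\<Sum>r\<le>n. \<Sum>s\<le>n - r. ev i (b r (fps_nth x s) (fps_nth y (n - r - s))))"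
      by (rule fev_formal_extension_nth[where ?S1.0 = S1 and ?S2.0 = S2]) (use b xy in auto)
    have 2: "fps_nth (fev i (formal_extension V (\<lambda>r t s. b r s t) y x)) n =
        (\<Sum>r\<le>n. \<Sum>s\<le>n - r. ev i (b r (fps_nth x (n - r - s)) (fps_nth y s)))"
      by (rule fev_formal_extension_nth[where ?S1.0 = S2 and ?S2.0 = S1]) (use b xy in auto)
    show "fps_nth (fev i (formal_extension V b x y)) n =
        fps_nth (fev i (formal_extension V (\<lambda>r t s. b r s t) y x)) n"
      unfolding 1 2
    proof (rule sum.cong[OF refl])
      fix r
      have "(\<Sum>s\<le>m. g s (m - s)) = (\<Sum>s\<le>m. g (m - s) s)" for m and g :: "nat \<Rightarrow> nat \<Rightarrow> complex"
        by (rule sum.reindex_bij_witness[of _ "\<lambda>s. m - s" "\<lambda>s. m - s"]) auto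
      from this[of "\<lambda>s t. ev i (b r (fps_nth x s) (fps_nth y t))" "n - r"]
      show "(\<Sum>s\<le>n - r. ev i (b r (fps_nth x s) (fps_nth y (n - r - s)))) =
          (\<Sum>s\<le>n - r. ev i (b r (fps_nth x (n - r - s)) (fps_nth y s)))"
        .
    qed
  qed
qed

lemma bilinear_formal_extension:
  assumes Y: "Module.module complex_field Y" and Y': "Module.module complex_field Y'"
    and b: "\<And>r. bilinear_map complex_field Y Y' V (b r)"
  shows "bilinear_map complex_series (formal_module Y) (formal_module Y') FV (formal_extension V b)"
  unfolding bilinear_map_def
proof (intro conjI ballI)
  have nth: "fps_nth y n \<in> carrier Z" if "y \<in> carrier (formal_module Z)" for y n and Z :: "(complex, 'w, 'u) module_scheme"
    using that by (simp add: formal_module_def)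
  fix x assume x: "x \<in> carrier (formal_module Y)"
  show "linear_map complex_series (formal_module Y') FV (formal_extension V b x)"
    by (rule linear_formal_extension[OF Y', where ?S1.0 = "carrier Y"])
       (use b nth[OF x] in \<open>auto simp: bilinear_map_def\<close>)
next
  have nth: "fps_nth y n \<in> carrier Z" if "y \<in> carrier (formal_module Z)" for y n and Z :: "(complex, 'w, 'u) module_scheme"
    using that by (simp add: formal_module_def)
  fix y assume y: "y \<in> carrier (formal_module Y')"
  have "linear_map complex_series (formal_module Y) FV (formal_extension V (\<lambda>r t s. b r s t) y)"
    by (rule linear_formal_extension[OF Y, where ?S1.0 = "carrier Y'"])
       (use b nth[OF y] in \<open>auto simp: bilinear_map_def\<close>)
  moreover have "formal_extension V b x y = formal_extension V (\<lambda>r t s. b r s t) y x"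
    if "x \<in> carrier (formal_module Y)" for x
    by (rule formal_extension_swap[where ?S1.0 = "carrier Y" and ?S2.0 = "carrier Y'"])
       (use b nth[OF y] nth[OF that] in \<open>auto simp: bilinear_map_def linear_map_def\<close>)
  moreover have "x \<oplus>\<^bsub>formal_module Y\<^esub> x' \<in> carrier (formal_module Y)" "c \<odot>\<^bsub>formal_module Y\<^esub> x \<in> carrier (formal_module Y)"
    if "x \<in> carrier (formal_module Y)" "x' \<in> carrier (formal_module Y)" for x x' c
  proof -
    interpret Y: Module.module complex_field Y by fact
    have sc: "a \<odot>\<^bsub>Y\<^esub> t \<in> carrier Y" if "t \<in> carrier Y" for a t
      using Y.smult_closed[of a t] that by simp
    show "x \<oplus>\<^bsub>formal_module Y\<^esub> x' \<in> carrier (formal_module Y)" "c \<odot>\<^bsub>formal_module Y\<^esub> x \<in> carrier (formal_module Y)"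
      using that by (auto simp: formal_module_def intro!: Y.M.finsum_closed sc)
  qed
  ultimately show "linear_map complex_series (formal_module Y) FV (\<lambda>x. formal_extension V b x y)"
    by (simp add: linear_map_def)
qed

end

section \<open>Deforming Parseval frames\<close>

text \<open>The last three assumptions say that the operations are continuous in the \<lambda>-adic
  sense, which carries the frame identities to the limit of the iteration. C is a record of its own
  that shares the module part of \<open>formal_module V1\<close>, since it also has a product and an
  involution.\<close>

locale formal_inner_module =
  inner_module_axioms C "formal_module V" act ip + V: separated_space V ev + V1: separated_space V1 ev1
  for C :: "('a fps, 'z) star_algebra_scheme" and V :: "(complex, 'x, 'y) module_scheme"
    and act :: "'x fps \<Rightarrow> 'a fps \<Rightarrow> 'x fps" and ip :: "'x fps \<Rightarrow> 'x fps \<Rightarrow> 'a fps"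
    and ev :: "'i \<Rightarrow> 'x \<Rightarrow> complex"
    and V1 :: "(complex, 'a, 'w) module_scheme" and ev1 :: "'l \<Rightarrow> 'a \<Rightarrow> complex" +
  assumes C_formal: "carrier C = carrier (formal_module V1)" "add C = add (formal_module V1)"
      "zero C = zero (formal_module V1)" "smult C = smult (formal_module V1)"
    and mult_agree: "a \<in> carrier C \<Longrightarrow> b \<in> carrier C \<Longrightarrow> a' \<in> carrier C \<Longrightarrow> b' \<in> carrier C \<Longrightarrow>
      agree n a a' \<Longrightarrow> agree n b b' \<Longrightarrow> agree n (a \<otimes>\<^bsub>C\<^esub> b) (a' \<otimes>\<^bsub>C\<^esub> b')"
    and act_agree: "x \<in> carrier (formal_module V) \<Longrightarrow> x' \<in> carrier (formal_module V) \<Longrightarrow>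
      a \<in> carrier C \<Longrightarrow> a' \<in> carrier C \<Longrightarrow> agree n x x' \<Longrightarrow> agree n a a' \<Longrightarrow> agree n (act x a) (act x' a')"
    and ip_agree: "x \<in> carrier (formal_module V) \<Longrightarrow> x' \<in> carrier (formal_module V) \<Longrightarrow>
      y \<in> carrier (formal_module V) \<Longrightarrow> y' \<in> carrier (formal_module V) \<Longrightarrow>
      agree n x x' \<Longrightarrow> agree n y y' \<Longrightarrow> agree n (ip x y) (ip x' y')"
begin

abbreviation FX where "FX \<equiv> formal_module V"

lemma finsum_C:
  assumes "finite I" "\<And>i. i \<in> I \<Longrightarrow> g i \<in> carrier C"
  shows "finsum C g I = finsum V1.FV g I"
proof -
  interpret F1: Module.module complex_series V1.FV by (rule V1.FV_module)
  show ?thesis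
    by (rule additive_finsum[where f = "\<lambda>x. x", OF C.is_abelian_group F1.M.abelian_group_axioms])
       (use assms in \<open>auto simp: C_formal\<close>)
qed

lemma inv_one: "inv' \<one>\<^bsub>C\<^esub> = \<one>\<^bsub>C\<^esub>"
proof -
  have "inv' (inv' \<one>\<^bsub>C\<^esub> \<otimes>\<^bsub>C\<^esub> \<one>\<^bsub>C\<^esub>) = inv' \<one>\<^bsub>C\<^esub> \<otimes>\<^bsub>C\<^esub> inv' (inv' \<one>\<^bsub>C\<^esub>)"
    by (rule inv_mult) simp_all
  then show ?thesis by simp
qed

lemma inv_finsum:
  "finite I \<Longrightarrow> (\<And>i. i \<in> I \<Longrightarrow> g i \<in> carrier C) \<Longrightarrow> inv' (finsum C g I) = (\<Oplus>\<^bsub>C\<^esub>i\<in>I. inv' (g i))"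
  by (rule additive_finsum[OF C.is_abelian_group C.is_abelian_group]) (auto simp: inv_add)

lemma fps_cnj_correction_constants:
  "fps_cnj (fps_const (3 / 2)) = fps_const (3 / 2)" "fps_cnj (fps_const (- 1 / 2)) = fps_const (- 1 / 2)"
  "fps_cnj (fps_const (- (1 / 2))) = fps_const (- (1 / 2))"
  by (simp_all add: fps_cnj_def fps_eq_iff)

text \<open>The operator \<Phi> of a family is right linear and symmetric for the inner product.
  Both properties pass to its correction, the latter because the constants 3/2 and -1/2 are real. So
  correcting the members of the family applies the Newton map to the operator.\<close>

lemma deformed_parseval:
  assumes J: "finite (J :: nat set)" "\<And>j. j \<in> J \<Longrightarrow> z0 j \<in> carrier FX"
    and start: "\<And>x. x \<in> carrier FX \<Longrightarrow> agree 1 (\<Oplus>\<^bsub>FX\<^esub>j\<in>J. act (z0 j) (ip (z0 j) x)) x"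
  obtains z where "\<And>j. j \<in> J \<Longrightarrow> z j \<in> carrier FX"
    "\<And>x. x \<in> carrier FX \<Longrightarrow> (\<Oplus>\<^bsub>FX\<^esub>j\<in>J. act (z j) (ip (z j) x)) = x"
proof -
  define \<Phi> where "\<Phi> z x = (\<Oplus>\<^bsub>FX\<^esub>j\<in>J. act (z j) (ip (z j) x))" for z :: "nat \<Rightarrow> 'x fps" and x
  let ?Z = "{z. \<forall>j\<in>J. \<forall>n. fps_nth (z j) n \<in> carrier V}"
  have Z: "z j \<in> carrier FX" if "z \<in> ?Z" "j \<in> J" for z j using that by (simp add: V.FV_carrier)
  have trm [simp]: "act (z j) (ip (z j) x) \<in> carrier FX" if "z \<in> ?Z" "x \<in> carrier FX" "j \<in> J" for z x j
    using Z[OF that(1,3)] that by simp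
  have lin: "V.linear_endo (\<Phi> z)" if z: "z \<in> ?Z" for z
    unfolding V.linear_endo_def
  proof (intro conjI ballI allI)
    fix x y c assume x: "x \<in> carrier FX"
    show "\<Phi> z x \<in> carrier FX" unfolding \<Phi>_def using z x by (intro X.M.finsum_closed) auto
    have "\<Phi> z (c \<odot>\<^bsub>FX\<^esub> x) = (\<Oplus>\<^bsub>FX\<^esub>j\<in>J. c \<odot>\<^bsub>FX\<^esub> act (z j) (ip (z j) x))"
      unfolding \<Phi>_def using x Z[OF z] by (intro X.M.finsum_cong') (auto simp: ip_smult_right act_smult_right)
    also have "\<dots> = c \<odot>\<^bsub>FX\<^esub> \<Phi> z x"
      unfolding \<Phi>_def by (rule X.finsum_smult_ldistr[symmetric]) (use J(1) trm[OF z x] in auto)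
    finally show "\<Phi> z (c \<odot>\<^bsub>FX\<^esub> x) = c \<odot>\<^bsub>FX\<^esub> \<Phi> z x" .
    assume y: "y \<in> carrier FX"
    have "\<Phi> z (x \<oplus>\<^bsub>FX\<^esub> y) = (\<Oplus>\<^bsub>FX\<^esub>j\<in>J. act (z j) (ip (z j) x) \<oplus>\<^bsub>FX\<^esub> act (z j) (ip (z j) y))"
      unfolding \<Phi>_def using x y Z[OF z] by (intro X.M.finsum_cong') (auto simp: ip_add_right act_add_right)
    also have "\<dots> = \<Phi> z x \<oplus>\<^bsub>FX\<^esub> \<Phi> z y"
      unfolding \<Phi>_def using trm[OF z x] trm[OF z y] by (intro X.M.finsum_addf) auto
    finally show "\<Phi> z (x \<oplus>\<^bsub>FX\<^esub> y) = \<Phi> z x \<oplus>\<^bsub>FX\<^esub> \<Phi> z y" .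
  qed
  have \<Phi>c: "\<Phi> z x \<in> carrier FX" if "z \<in> ?Z" "x \<in> carrier FX" for z x
    using lin[OF that(1)] that(2) by (simp add: V.linear_endo_def)
  have \<Phi>_act: "\<Phi> z (act x a) = act (\<Phi> z x) a" if z: "z \<in> ?Z" and x: "x \<in> carrier FX" and a: "a \<in> carrier C" for z x a
  proof -
    have "\<Phi> z (act x a) = (\<Oplus>\<^bsub>FX\<^esub>j\<in>J. act (act (z j) (ip (z j) x)) a)"
      unfolding \<Phi>_def using x a Z[OF z] by (intro X.M.finsum_cong') (auto simp: ip_act_right act_mult)
    also have "\<dots> = act (\<Phi> z x) a"
      unfolding \<Phi>_def by (rule act_finsum_left[symmetric]) (use J(1) trm[OF z x] a in auto)
    finally show ?thesis .
  qed
  have \<Phi>_sym: "ip (\<Phi> z x) y = ip x (\<Phi> z y)" if z: "z \<in> ?Z" and x: "x \<in> carrier FX" and y: "y \<in> carrier FX" for z x y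
  proof -
    have "ip (\<Phi> z x) y = (\<Oplus>\<^bsub>C\<^esub>j\<in>J. ip (act (z j) (ip (z j) x)) y)"
      unfolding \<Phi>_def by (rule ip_finsum_left) (use J(1) trm[OF z x] y in auto)
    also have "\<dots> = (\<Oplus>\<^bsub>C\<^esub>j\<in>J. ip x (act (z j) (ip (z j) y)))"
      using x y Z[OF z] by (intro C.finsum_cong') (auto simp: ip_act_left ip_act_right ip_inv)
    also have "\<dots> = ip x (\<Phi> z y)"
      unfolding \<Phi>_def by (rule ip_finsum[symmetric]) (use J(1) trm[OF z y] x in auto)
    finally show ?thesis .
  qed
  define Q where "Q z = V.correction (\<Phi> z)" for z
  have Qc: "Q z x \<in> carrier FX" if "z \<in> ?Z" "x \<in> carrier FX" for z x
    unfolding Q_def using lin[OF that(1)] that(2) by simp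
  have Q_act: "Q z (act x a) = act (Q z x) a" if "z \<in> ?Z" "x \<in> carrier FX" "a \<in> carrier C" for z x a
    using that \<Phi>c by (simp add: Q_def V.correction_def \<Phi>_act act_add_left act_smult_left)
  have Q_sym: "ip (Q z x) y = ip x (Q z y)" if "z \<in> ?Z" "x \<in> carrier FX" "y \<in> carrier FX" for z x y
    using that \<Phi>c by (simp add: Q_def V.correction_def \<Phi>_sym ip_add_left ip_add_right ip_smult_left
        ip_smult_right fps_cnj_correction_constants)
  have z0: "z0 \<in> ?Z" using J(2) by (simp add: V.FV_carrier)
  show thesis
  proof (rule V.newton_limit[where \<Phi> = \<Phi> and J = J and S = "carrier V" and ?z0.0 = z0])
    fix z z' n x
    assume z: "z \<in> ?Z" and z': "z' \<in> ?Z" and ag: "\<And>j. j \<in> J \<Longrightarrow> agree n (z j) (z' j)" and x: "x \<in> carrier FX"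
    show "agree n (\<Phi> z x) (\<Phi> z' x)"
      unfolding \<Phi>_def using Z[OF z] Z[OF z'] ag x J(1)
      by (intro V.agree_finsum act_agree ip_agree) auto
  next
    fix z assume z: "z \<in> ?Z"
    show "\<exists>z'\<in>?Z. (\<forall>x\<in>carrier FX. \<Phi> z' x = V.correction (\<Phi> z) (\<Phi> z (V.correction (\<Phi> z) x))) \<and>
      (\<forall>n. (\<forall>x\<in>carrier FX. agree n (\<Phi> z x) x) \<longrightarrow> (\<forall>j\<in>J. agree n (z' j) (z j)))"
    proof (intro bexI[of _ "\<lambda>j. Q z (z j)"] conjI ballI allI impI)
      fix x assume x: "x \<in> carrier FX"
      \<comment> \<open>Right linearity and symmetry of Q give Q z_j <Q z_j, x> = Q (z_j <z_j, Q
        x>).\<close>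
      have "\<Phi> (\<lambda>j. Q z (z j)) x = (\<Oplus>\<^bsub>FX\<^esub>j\<in>J. Q z (act (z j) (ip (z j) (Q z x))))"
        unfolding \<Phi>_def using x Z[OF z] Qc[OF z] z by (intro X.M.finsum_cong') (auto simp: Q_sym Q_act)
      also have "\<dots> = Q z (\<Phi> z (Q z x))"
        unfolding \<Phi>_def
        by (rule additive_finsum[symmetric, OF X.M.abelian_group_axioms X.M.abelian_group_axioms _ _ J(1)])
           (use Qc[OF z] x z V.linear_endo_correction[OF lin[OF z]] in \<open>auto simp: Q_def V.linear_endo_def\<close>)
      finally show "\<Phi> (\<lambda>j. Q z (z j)) x = V.correction (\<Phi> z) (\<Phi> z (V.correction (\<Phi> z) x))"
        by (simp only: Q_def)
    next
      fix n j assume "\<forall>x\<in>carrier FX. agree n (\<Phi> z x) x" "j \<in> J"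
      then show "agree n (Q z (z j)) (z j)"
        unfolding Q_def using Z[OF z] by (intro V.agree_correction lin z) auto
    qed (use Qc[OF z] Z[OF z] in auto)
  next
    fix z assume "z \<in> ?Z" "\<And>x. x \<in> carrier FX \<Longrightarrow> \<Phi> z x = x"
    then show thesis using Z by (intro that[of z]) (auto simp: \<Phi>_def)
  qed (use lin z0 start in \<open>auto simp: \<Phi>_def\<close>)
qed

text \<open>Here the operator is left multiplication by B, the sum of the <z_j, z_j>. Its correction
  is left multiplication by the self-adjoint element q = (3 - B) / 2, and replacing z_j by z_j q
  replaces B by q B q.\<close>

lemma deformed_unit_sum:
  assumes J: "finite (J :: nat set)" "\<And>j. j \<in> J \<Longrightarrow> z0 j \<in> carrier FX"
    and start: "agree 1 (\<Oplus>\<^bsub>C\<^esub>j\<in>J. ip (z0 j) (z0 j)) \<one>\<^bsub>C\<^esub>"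
  obtains z where "\<And>j. j \<in> J \<Longrightarrow> z j \<in> carrier FX" "(\<Oplus>\<^bsub>C\<^esub>j\<in>J. ip (z j) (z j)) = \<one>\<^bsub>C\<^esub>"
proof -
  define B where "B z = (\<Oplus>\<^bsub>C\<^esub>j\<in>J. ip (z j) (z j))" for z :: "nat \<Rightarrow> 'x fps"
  define \<Phi> where "\<Phi> z a = B z \<otimes>\<^bsub>C\<^esub> a" for z a
  let ?Z = "{z. \<forall>j\<in>J. \<forall>n. fps_nth (z j) n \<in> carrier V}"
  have Z: "z j \<in> carrier FX" if "z \<in> ?Z" "j \<in> J" for z j using that by (simp add: V.FV_carrier)
  have Bc: "B z \<in> carrier C" if "z \<in> ?Z" for z
    unfolding B_def using Z[OF that] by (intro C.finsum_closed) auto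
  have B_inv: "inv' (B z) = B z" if z: "z \<in> ?Z" for z
  proof -
    have "inv' (B z) = (\<Oplus>\<^bsub>C\<^esub>j\<in>J. inv' (ip (z j) (z j)))"
      unfolding B_def by (rule inv_finsum) (use J(1) Z[OF z] in auto)
    also have "\<dots> = B z" unfolding B_def using Z[OF z] by (intro C.finsum_cong') (auto simp: ip_inv)
    finally show ?thesis .
  qed
  have lin: "V1.linear_endo (\<Phi> z)" if z: "z \<in> ?Z" for z
    unfolding V1.linear_endo_def \<Phi>_def C_formal[symmetric]
    using Bc[OF z] by (auto simp: C.r_distr C_smult_mult)
  define q where "q z = fps_const (3 / 2) \<odot>\<^bsub>C\<^esub> \<one>\<^bsub>C\<^esub> \<oplus>\<^bsub>C\<^esub> fps_const (- 1 / 2) \<odot>\<^bsub>C\<^esub> B z" for z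
  have qc: "q z \<in> carrier C" if "z \<in> ?Z" for z unfolding q_def using Bc[OF that] by simp
  have q_inv: "inv' (q z) = q z" if "z \<in> ?Z" for z
    using Bc[OF that] by (simp add: q_def inv_add inv_smult inv_one B_inv[OF that] fps_cnj_correction_constants)
  have q_mult: "V1.correction (\<Phi> z) a = q z \<otimes>\<^bsub>C\<^esub> a" if "z \<in> ?Z" "a \<in> carrier C" for z a
    unfolding V1.correction_def \<Phi>_def q_def C_formal[symmetric]
    using Bc[OF that(1)] that(2) by (simp add: C.l_distr C_smult_mult)
  have z0: "z0 \<in> ?Z" using J(2) by (simp add: V.FV_carrier)
  show thesis
  proof (rule V1.newton_limit[where \<Phi> = \<Phi> and J = J and S = "carrier V" and ?z0.0 = z0, folded C_formal])
    fix z z' n a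
    assume z: "z \<in> ?Z" and z': "z' \<in> ?Z" and ag: "\<And>j. j \<in> J \<Longrightarrow> agree n (z j) (z' j)" and a: "a \<in> carrier C"
    have "agree n (B z) (B z')"
      unfolding B_def using Z[OF z] Z[OF z'] ag J(1)
      by (simp add: finsum_C, intro V1.agree_finsum ip_agree) (auto simp: C_formal(1)[symmetric])
    then show "agree n (\<Phi> z a) (\<Phi> z' a)"
      unfolding \<Phi>_def using Bc[OF z] Bc[OF z'] a by (intro mult_agree) auto
  next
    fix z assume z: "z \<in> ?Z"
    show "\<exists>z'\<in>?Z. (\<forall>a\<in>carrier C. \<Phi> z' a = V1.correction (\<Phi> z) (\<Phi> z (V1.correction (\<Phi> z) a))) \<and>
      (\<forall>n. (\<forall>a\<in>carrier C. agree n (\<Phi> z a) a) \<longrightarrow> (\<forall>j\<in>J. agree n (z' j) (z j)))"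
    proof (intro bexI[of _ "\<lambda>j. act (z j) (q z)"] conjI ballI allI impI)
      fix a assume a: "a \<in> carrier C"
      have "B (\<lambda>j. act (z j) (q z)) = (\<Oplus>\<^bsub>C\<^esub>j\<in>J. q z \<otimes>\<^bsub>C\<^esub> ip (z j) (z j) \<otimes>\<^bsub>C\<^esub> q z)"
        unfolding B_def using Z[OF z] qc[OF z]
        by (intro C.finsum_cong') (auto simp: ip_act_left ip_act_right q_inv[OF z] C.m_assoc)
      also have "\<dots> = q z \<otimes>\<^bsub>C\<^esub> B z \<otimes>\<^bsub>C\<^esub> q z"
        unfolding B_def using Z[OF z] qc[OF z] J(1)
        by (simp add: C.finsum_ldistr C.finsum_rdistr Pi_def)
      finally show "\<Phi> (\<lambda>j. act (z j) (q z)) a = V1.correction (\<Phi> z) (\<Phi> z (V1.correction (\<Phi> z) a))"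
        using a qc[OF z] Bc[OF z] by (simp add: q_mult[OF z] \<Phi>_def C.m_assoc)
    next
      fix n j assume ag: "\<forall>a\<in>carrier C. agree n (\<Phi> z a) a" and j: "j \<in> J"
      \<comment> \<open>The members of the family are multiplied by q, so the closeness of q itself
        to the unit is needed; it is read off by applying the correction to the unit.\<close>
      have "agree n (V1.correction (\<Phi> z) \<one>\<^bsub>C\<^esub>) \<one>\<^bsub>C\<^esub>"
        using ag C_formal(1) C.one_closed by (intro V1.agree_correction lin z) auto
      then have "agree n (q z) \<one>\<^bsub>C\<^esub>" using q_mult[OF z C.one_closed] qc[OF z] by simp
      then have "agree n (act (z j) (q z)) (act (z j) \<one>\<^bsub>C\<^esub>)"
        using Z[OF z j] qc[OF z] by (intro act_agree) auto
      then show "agree n (act (z j) (q z)) (z j)" using Z[OF z j] by simp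
    qed (use qc[OF z] Z[OF z] in auto)
  next
    fix a assume a: "a \<in> carrier C"
    have "agree 1 (\<Phi> z0 a) (\<one>\<^bsub>C\<^esub> \<otimes>\<^bsub>C\<^esub> a)"
      unfolding \<Phi>_def using start Bc[OF z0] a by (intro mult_agree) (auto simp: B_def)
    then show "agree 1 (\<Phi> z0 a) a" using a by simp
  next
    fix z assume z: "z \<in> ?Z" "\<And>a. a \<in> carrier C \<Longrightarrow> \<Phi> z a = a"
    then have "B z = \<one>\<^bsub>C\<^esub>" using z(2)[OF C.one_closed] Bc[OF z(1)] by (simp add: \<Phi>_def)
    then show thesis using Z[OF z(1)] by (intro that[of z]) (auto simp: B_def)
  qed (use lin z0 in auto)
qed

end

section \<open>Hermitian deformations\<close>

context separated_space
begin

lemma formal_extension_nth_0: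
  assumes "b 0 (fps_nth x 0) (fps_nth y 0) \<in> carrier V"
  shows "fps_nth (formal_extension V b x y) 0 = b 0 (fps_nth x 0) (fps_nth y 0)"
  using assms by (simp add: formal_extension_def V.M.finsum_insert)

lemma FV_finsum_nth:
  assumes "finite I" "\<And>i. i \<in> I \<Longrightarrow> h i \<in> carrier FV"
  shows "fps_nth (finsum FV h I) j = (\<Oplus>\<^bsub>V\<^esub>i\<in>I. fps_nth (h i) j)"
proof -
  interpret FV: Module.module complex_series FV by (rule FV_module)
  show ?thesis
    by (rule additive_finsum[where f = "\<lambda>x. fps_nth x j", OF FV.M.abelian_group_axioms V.M.abelian_group_axioms])
       (use assms in auto)
qed

end

section \<open>The star-product algebra of smooth functions\<close>

context smooth_mfd
begin

lemma smooth_functions_simps [simp]: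
  "carrier (smooth_functions M) = {f. smooth_map M UNIV f}"
  "f \<otimes>\<^bsub>smooth_functions M\<^esub> g = (\<lambda>p. f p * g p)" "\<one>\<^bsub>smooth_functions M\<^esub> = (\<lambda>p. 1)"
  "\<zero>\<^bsub>smooth_functions M\<^esub> = (\<lambda>p. 0)" "f \<oplus>\<^bsub>smooth_functions M\<^esub> g = (\<lambda>p. f p + g p)"
  "c \<odot>\<^bsub>smooth_functions M\<^esub> f = (\<lambda>p. c * f p)"
  by (simp_all add: smooth_functions_def)

lemma module_smooth_functions: "Module.module complex_field (smooth_functions M)"
proof (rule moduleI[OF cring_ring_of_type])
  show "abelian_group (smooth_functions M)"
  proof (rule abelian_groupI)
    fix f assume "f \<in> carrier (smooth_functions M)"
    then have "smooth_map M UNIV (\<lambda>p. - f p)"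
      by (simp add: smooth_map_linear[OF bounded_linear_minus[OF bounded_linear_ident]])
    then show "\<exists>g\<in>carrier (smooth_functions M). g \<oplus>\<^bsub>smooth_functions M\<^esub> f = \<zero>\<^bsub>smooth_functions M\<^esub>"
      by (intro bexI[of _ "\<lambda>p. - f p"]) auto
  qed (auto simp: smooth_map_add algebra_simps)
qed (auto simp: smooth_map_mult algebra_simps)

lemma separated_functions: "separated_space (smooth_functions M) (\<lambda>p f. f p)"
  by (rule separated_space.intro) (auto simp: module_smooth_functions)

context
  fixes P C assumes star_product: "hermitian_star_product M P C"
begin

interpretation S: separated_space "smooth_functions M" "\<lambda>p f. f p"
  by (rule separated_functions)

abbreviation star_alg where "star_alg \<equiv> star_product_algebra M C"

lemma star_product_bilinear:
  "bilinear_map complex_field (smooth_functions M) (smooth_functions M) (smooth_functions M) (C r)"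
  using star_product unfolding hermitian_star_product_def Let_def by (elim conjE) (rule spec)

lemma star_product_algebra_simps:
  "carrier star_alg = carrier S.FV" "add star_alg = add S.FV" "zero star_alg = zero S.FV" "smult star_alg = smult S.FV"
  "mult star_alg = formal_extension (smooth_functions M) C"
  "\<one>\<^bsub>star_alg\<^esub> = Abs_fps (\<lambda>n. if n = 0 then (\<lambda>p. 1) else (\<lambda>p. 0))"
  "involution star_alg f = Abs_fps (\<lambda>n p. cnj (fps_nth f n p))"
  by (simp_all add: star_product_algebra_def cong: if_cong)

text \<open>Associativity, the unit and the rule for the involution of a product are axioms of a
  star-product. Bilinearity over the formal series and antilinearity of the involution come from the
  coefficientwise formulas.\<close>

lemma star_product_algebra_unital: "unital_star_algebra star_alg"
proof -
  have bil: "bilinear_map complex_series S.FV S.FV S.FV (mult star_alg)"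
    unfolding star_product_algebra_simps
    by (rule S.bilinear_formal_extension[OF module_smooth_functions module_smooth_functions star_product_bilinear])
  then have bilA: "bilinear_map complex_series star_alg star_alg star_alg (mult star_alg)"
    by (simp add: bilinear_map_def linear_map_def star_product_algebra_simps(1-4))
  have modA: "Module.module complex_series star_alg"
    by (rule module_cong[OF S.FV_module]) (simp_all add: star_product_algebra_simps)
  have assoc: "\<forall>f\<in>carrier star_alg. \<forall>g\<in>carrier star_alg. \<forall>k\<in>carrier star_alg. (f \<otimes>\<^bsub>star_alg\<^esub> g) \<otimes>\<^bsub>star_alg\<^esub> k = f \<otimes>\<^bsub>star_alg\<^esub> (g \<otimes>\<^bsub>star_alg\<^esub> k)"
    and unit: "\<forall>f\<in>carrier star_alg. \<one>\<^bsub>star_alg\<^esub> \<otimes>\<^bsub>star_alg\<^esub> f = f \<and> f \<otimes>\<^bsub>star_alg\<^esub> \<one>\<^bsub>star_alg\<^esub> = f"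
    and inv: "\<forall>f\<in>carrier star_alg. \<forall>g\<in>carrier star_alg.
          involution star_alg (f \<otimes>\<^bsub>star_alg\<^esub> g) = involution star_alg g \<otimes>\<^bsub>star_alg\<^esub> involution star_alg f"
  proof -
    note sp = star_product[unfolded hermitian_star_product_def Let_def]
    show "\<forall>f\<in>carrier star_alg. \<forall>g\<in>carrier star_alg. \<forall>k\<in>carrier star_alg. (f \<otimes>\<^bsub>star_alg\<^esub> g) \<otimes>\<^bsub>star_alg\<^esub> k = f \<otimes>\<^bsub>star_alg\<^esub> (g \<otimes>\<^bsub>star_alg\<^esub> k)"
      by (rule sp[THEN conjunct2, THEN conjunct1])
    show "\<forall>f\<in>carrier star_alg. \<one>\<^bsub>star_alg\<^esub> \<otimes>\<^bsub>star_alg\<^esub> f = f \<and> f \<otimes>\<^bsub>star_alg\<^esub> \<one>\<^bsub>star_alg\<^esub> = f"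
      by (rule sp[THEN conjunct2, THEN conjunct2, THEN conjunct2, THEN conjunct1])
    show "\<forall>f\<in>carrier star_alg. \<forall>g\<in>carrier star_alg.
          involution star_alg (f \<otimes>\<^bsub>star_alg\<^esub> g) = involution star_alg g \<otimes>\<^bsub>star_alg\<^esub> involution star_alg f"
      by (rule sp[THEN conjunct2, THEN conjunct2, THEN conjunct2, THEN conjunct2, THEN conjunct2])
  qed
  have oneA: "\<one>\<^bsub>star_alg\<^esub> \<in> carrier star_alg"
    by (simp add: star_product_algebra_simps S.FV_carrier)
  have multA: "f \<otimes>\<^bsub>star_alg\<^esub> g \<in> carrier star_alg" if "f \<in> carrier star_alg" "g \<in> carrier star_alg" for f g
    using bilA that by (simp add: bilinear_map_def linear_map_def)
  have dist: "f \<otimes>\<^bsub>star_alg\<^esub> (g \<oplus>\<^bsub>star_alg\<^esub> k) = f \<otimes>\<^bsub>star_alg\<^esub> g \<oplus>\<^bsub>star_alg\<^esub> f \<otimes>\<^bsub>star_alg\<^esub> k" "(f \<oplus>\<^bsub>star_alg\<^esub> g) \<otimes>\<^bsub>star_alg\<^esub> k = f \<otimes>\<^bsub>star_alg\<^esub> k \<oplus>\<^bsub>star_alg\<^esub> g \<otimes>\<^bsub>star_alg\<^esub> k"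
    if "f \<in> carrier star_alg" "g \<in> carrier star_alg" "k \<in> carrier star_alg" for f g k
    using bilA that unfolding bilinear_map_def linear_map_def by blast+
  have ringA: "Ring.ring star_alg"
  proof (rule ringI)
    show "abelian_group star_alg" using modA by (simp add: Module.module_def)
    show "monoid star_alg" by (rule monoidI) (use assoc unit oneA multA in auto)
  qed (use dist in auto)
  have inv_smooth: "involution star_alg f \<in> carrier star_alg" if "f \<in> carrier star_alg" for f
    using that unfolding star_product_algebra_simps S.FV_carrier
    by (auto intro: smooth_map_linear[OF bounded_linear_cnj])
  have inv_smult: "involution star_alg (c \<odot>\<^bsub>star_alg\<^esub> f) = fps_cnj c \<odot>\<^bsub>star_alg\<^esub> involution star_alg f" if f: "f \<in> carrier star_alg" for c f
  proof -
    have f': "f \<in> carrier S.FV" and i': "involution star_alg f \<in> carrier S.FV"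
      using f inv_smooth[OF f] by (simp_all add: star_product_algebra_simps(1))
    have cf: "c \<odot>\<^bsub>S.FV\<^esub> f \<in> carrier star_alg" using f' by (simp add: star_product_algebra_simps(1))
    have fev_inv: "S.fev p (involution star_alg g) = fps_cnj (S.fev p g)" for p g
      by (simp add: fps_eq_iff star_product_algebra_simps(7) fps_cnj_def)
    show ?thesis
      unfolding star_product_algebra_simps(4)
    proof (rule S.fev_eqI)
      show "involution star_alg (c \<odot>\<^bsub>S.FV\<^esub> f) \<in> carrier S.FV"
        using inv_smooth[OF cf] by (simp add: star_product_algebra_simps(1))
      show "fps_cnj c \<odot>\<^bsub>S.FV\<^esub> involution star_alg f \<in> carrier S.FV" using i' by simp
      show "S.fev p (involution star_alg (c \<odot>\<^bsub>S.FV\<^esub> f)) = S.fev p (fps_cnj c \<odot>\<^bsub>S.FV\<^esub> involution star_alg f)" for p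
        by (simp add: fev_inv S.fev_smult[OF f'] S.fev_smult[OF i'])
    qed
  qed
  show ?thesis
    unfolding unital_star_algebra_def
  proof (intro conjI ballI allI)
    fix f g assume "f \<in> carrier star_alg"
    show "involution star_alg (involution star_alg f) = f" by (simp add: star_product_algebra_simps(7) fps_eq_iff)
    assume "g \<in> carrier star_alg"
    show "involution star_alg (f \<oplus>\<^bsub>star_alg\<^esub> g) = involution star_alg f \<oplus>\<^bsub>star_alg\<^esub> involution star_alg g"
      by (rule fps_ext) (simp add: star_product_algebra_simps(2,7))
    show "involution star_alg (f \<otimes>\<^bsub>star_alg\<^esub> g) = involution star_alg g \<otimes>\<^bsub>star_alg\<^esub> involution star_alg f"
      using inv \<open>f \<in> carrier star_alg\<close> \<open>g \<in> carrier star_alg\<close> by blast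
  qed (use ringA modA bilA inv_smooth inv_smult in auto)
qed

end

end

section \<open>The module of smooth sections\<close>

context hermitian_bundle
begin

abbreviation \<Gamma> where "\<Gamma> \<equiv> smooth_sections M E"

lemma \<Gamma>_simps [simp]:
  "\<zero>\<^bsub>\<Gamma>\<^esub> = (\<lambda>p. \<zero>\<^bsub>fibre E p\<^esub>)" "s \<oplus>\<^bsub>\<Gamma>\<^esub> t = (\<lambda>p. s p \<oplus>\<^bsub>fibre E p\<^esub> t p)"
  "c \<odot>\<^bsub>\<Gamma>\<^esub> s = (\<lambda>p. c \<odot>\<^bsub>fibre E p\<^esub> s p)"
  by (simp_all add: smooth_sections_def)

lemma \<Gamma>_carrier:
  "s \<in> carrier \<Gamma> \<longleftrightarrow> (\<forall>p. s p \<in> carrier (fibre E p)) \<and> smooth_section UNIV (\<lambda>p. coord p (s p))"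
  by (auto simp: smooth_sections_def smooth_section_def)

lemma \<Gamma>_fibre: "s \<in> carrier \<Gamma> \<Longrightarrow> s p \<in> carrier (fibre E p)"
  by (simp add: \<Gamma>_carrier)

lemma lift_section: "smooth_section UNIV \<sigma> \<Longrightarrow> (\<lambda>p. lift p (\<sigma> p)) \<in> carrier \<Gamma>"
  by (simp add: \<Gamma>_carrier)

lemma \<Gamma>_eqI: "s \<in> carrier \<Gamma> \<Longrightarrow> t \<in> carrier \<Gamma> \<Longrightarrow> (\<And>p. coord p (s p) = coord p (t p)) \<Longrightarrow> s = t"
  by (rule ext, rule coord_inj) (auto simp: \<Gamma>_fibre)

lemma module_\<Gamma>: "Module.module complex_field \<Gamma>"
proof (rule moduleI[OF cring_ring_of_type])
  have add: "s \<oplus>\<^bsub>\<Gamma>\<^esub> t \<in> carrier \<Gamma>" if "s \<in> carrier \<Gamma>" "t \<in> carrier \<Gamma>" for s t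
    using that by (simp add: \<Gamma>_carrier fibre_add_closed coord_add smooth_section_add)
  have scale: "c \<odot>\<^bsub>\<Gamma>\<^esub> s \<in> carrier \<Gamma>" if "s \<in> carrier \<Gamma>" for c s
    using that by (simp add: \<Gamma>_carrier fibre_scale_closed coord_scale smooth_section_scale)
  have zero: "\<zero>\<^bsub>\<Gamma>\<^esub> \<in> carrier \<Gamma>"
    by (simp add: \<Gamma>_carrier fibre_zero_closed coord_zero smooth_section_0)
  note cs = coord_add coord_scale coord_zero \<Gamma>_fibre fibre_add_closed fibre_scale_closed fibre_zero_closed
  show "abelian_group \<Gamma>"
  proof (rule abelian_groupI)
    fix s t u assume s: "s \<in> carrier \<Gamma>"
    show "\<exists>t\<in>carrier \<Gamma>. t \<oplus>\<^bsub>\<Gamma>\<^esub> s = \<zero>\<^bsub>\<Gamma>\<^esub>"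
      by (intro bexI[of _ "(- 1) \<odot>\<^bsub>\<Gamma>\<^esub> s"] \<Gamma>_eqI add scale zero s)
         (use s in \<open>simp add: cs\<close>)
    show "\<zero>\<^bsub>\<Gamma>\<^esub> \<oplus>\<^bsub>\<Gamma>\<^esub> s = s" by (intro \<Gamma>_eqI add zero s) (use s in \<open>simp add: cs\<close>)
    assume t: "t \<in> carrier \<Gamma>"
    show "s \<oplus>\<^bsub>\<Gamma>\<^esub> t = t \<oplus>\<^bsub>\<Gamma>\<^esub> s" by (intro \<Gamma>_eqI add s t) (use s t in \<open>simp add: cs\<close>)
    assume u: "u \<in> carrier \<Gamma>"
    show "s \<oplus>\<^bsub>\<Gamma>\<^esub> t \<oplus>\<^bsub>\<Gamma>\<^esub> u = s \<oplus>\<^bsub>\<Gamma>\<^esub> (t \<oplus>\<^bsub>\<Gamma>\<^esub> u)"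
      by (intro \<Gamma>_eqI add s t u) (use s t u in \<open>simp add: cs\<close>)
  qed (use add zero in auto)
  fix a c :: complex and s t assume s: "s \<in> carrier \<Gamma>"
  show "a \<odot>\<^bsub>\<Gamma>\<^esub> s \<in> carrier \<Gamma>" by (rule scale[OF s])
  show "(a \<oplus>\<^bsub>complex_field\<^esub> c) \<odot>\<^bsub>\<Gamma>\<^esub> s = a \<odot>\<^bsub>\<Gamma>\<^esub> s \<oplus>\<^bsub>\<Gamma>\<^esub> c \<odot>\<^bsub>\<Gamma>\<^esub> s"
    by (intro \<Gamma>_eqI add scale s) (use s in \<open>simp add: cs vec.scale_left_distrib\<close>)
  show "(a \<otimes>\<^bsub>complex_field\<^esub> c) \<odot>\<^bsub>\<Gamma>\<^esub> s = a \<odot>\<^bsub>\<Gamma>\<^esub> (c \<odot>\<^bsub>\<Gamma>\<^esub> s)"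
    by (intro \<Gamma>_eqI scale s) (use s in \<open>simp add: cs vec.scale_scale\<close>)
  show "\<one>\<^bsub>complex_field\<^esub> \<odot>\<^bsub>\<Gamma>\<^esub> s = s"
    by (intro \<Gamma>_eqI scale s) (use s in \<open>simp add: cs\<close>)
  assume t: "t \<in> carrier \<Gamma>"
  show "a \<odot>\<^bsub>\<Gamma>\<^esub> (s \<oplus>\<^bsub>\<Gamma>\<^esub> t) = a \<odot>\<^bsub>\<Gamma>\<^esub> s \<oplus>\<^bsub>\<Gamma>\<^esub> a \<odot>\<^bsub>\<Gamma>\<^esub> t"
    by (intro \<Gamma>_eqI add scale s t) (use s t in \<open>simp add: cs vec.scale_right_distrib\<close>)
qed

lemma separated_sections: "separated_space \<Gamma> (\<lambda>(p, a) s. coord p (s p) $ a)"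
proof (rule separated_space.intro)
  fix x y assume "x \<in> carrier \<Gamma>" "y \<in> carrier \<Gamma>"
    and eq: "\<And>i. (case i of (p, a) \<Rightarrow> \<lambda>s. coord p (s p) $ a) x = (case i of (p, a) \<Rightarrow> \<lambda>s. coord p (s p) $ a) y"
  then show "x = y"
    using eq[of "(p, a)" for p a] by (intro \<Gamma>_eqI) (auto simp: vec_eq_iff)
qed (auto simp: module_\<Gamma> \<Gamma>_fibre coord_add coord_scale split: prod.splits)

end

section \<open>Deformations and their zeroth order\<close>

locale hermitian_deformation_setting = hermitian_bundle M E h0
  for M :: "('m::{t2_space, second_countable_topology}, 'e::euclidean_space) smooth_structure"
    and E :: "('m, 'v, 'k::finite) bundle_data" and h0 +
  fixes P :: "('m \<Rightarrow> complex) \<Rightarrow> ('m \<Rightarrow> complex) \<Rightarrow> 'm \<Rightarrow> complex"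
    and C :: "nat \<Rightarrow> ('m \<Rightarrow> complex) \<Rightarrow> ('m \<Rightarrow> complex) \<Rightarrow> 'm \<Rightarrow> complex"
    and R :: "nat \<Rightarrow> ('m \<Rightarrow> 'v) \<Rightarrow> ('m \<Rightarrow> complex) \<Rightarrow> 'm \<Rightarrow> 'v"
    and h :: "nat \<Rightarrow> ('m \<Rightarrow> 'v) \<Rightarrow> ('m \<Rightarrow> 'v) \<Rightarrow> 'm \<Rightarrow> complex"
  assumes star_product: "hermitian_star_product M P C"
    and deformation: "hermitian_deformation M C E h0 R h"
begin

sublocale V: separated_space \<Gamma> "\<lambda>(p, a) s. coord p (s p) $ a"
  by (rule separated_sections)

sublocale V1: separated_space "smooth_functions M" "\<lambda>p f. f p"
  by (rule separated_functions)

abbreviation A where "A \<equiv> star_product_algebra M C"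
abbreviation act where "act \<equiv> deformed_act M E R"
abbreviation ip where "ip \<equiv> deformed_ip M h"

lemmas star_algebra_simps = star_product_algebra_simps[OF star_product]

lemma deformation_axioms:
  "\<forall>r. bilinear_map complex_field \<Gamma> (smooth_functions M) \<Gamma> (R r)"
  "\<forall>s\<in>carrier \<Gamma>. \<forall>f\<in>carrier (smooth_functions M). R 0 s f = (\<lambda>p. f p \<odot>\<^bsub>fibre E p\<^esub> s p)"
  "right_module A V.FV act"
  "\<forall>r. \<forall>s\<in>carrier \<Gamma>. \<forall>t\<in>carrier \<Gamma>.
          linear_map complex_field \<Gamma> (smooth_functions M) (h r s) \<and>
          (\<forall>s'\<in>carrier \<Gamma>. h r (s \<oplus>\<^bsub>\<Gamma>\<^esub> s') t = h r s t \<oplus>\<^bsub>smooth_functions M\<^esub> h r s' t) \<and>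
          (\<forall>c. h r (c \<odot>\<^bsub>\<Gamma>\<^esub> s) t = cnj c \<odot>\<^bsub>smooth_functions M\<^esub> h r s t)"
  "\<forall>s\<in>carrier \<Gamma>. \<forall>t\<in>carrier \<Gamma>. h 0 s t = (\<lambda>p. h0 p (s p) (t p))"
  "right_inner_product A V.FV act ip"
proof -
  note d = deformation[unfolded hermitian_deformation_def Let_def formal_sections_def]
  note d2 = d[THEN conjunct2] note d3 = d2[THEN conjunct2] note d4 = d3[THEN conjunct2]
  note d5 = d4[THEN conjunct2] note d6 = d5[THEN conjunct2]
  show "\<forall>r. bilinear_map complex_field \<Gamma> (smooth_functions M) \<Gamma> (R r)" by (rule d[THEN conjunct1])
  show "\<forall>s\<in>carrier \<Gamma>. \<forall>f\<in>carrier (smooth_functions M). R 0 s f = (\<lambda>p. f p \<odot>\<^bsub>fibre E p\<^esub> s p)"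
    by (rule d2[THEN conjunct1])
  show "right_module A V.FV act" by (rule d3[THEN conjunct1])
  show "\<forall>r. \<forall>s\<in>carrier \<Gamma>. \<forall>t\<in>carrier \<Gamma>.
          linear_map complex_field \<Gamma> (smooth_functions M) (h r s) \<and>
          (\<forall>s'\<in>carrier \<Gamma>. h r (s \<oplus>\<^bsub>\<Gamma>\<^esub> s') t = h r s t \<oplus>\<^bsub>smooth_functions M\<^esub> h r s' t) \<and>
          (\<forall>c. h r (c \<odot>\<^bsub>\<Gamma>\<^esub> s) t = cnj c \<odot>\<^bsub>smooth_functions M\<^esub> h r s t)"
    by (rule d4[THEN conjunct1])
  show "\<forall>s\<in>carrier \<Gamma>. \<forall>t\<in>carrier \<Gamma>. h 0 s t = (\<lambda>p. h0 p (s p) (t p))" by (rule d5[THEN conjunct1])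
  show "right_inner_product A V.FV act ip" by (rule d6[THEN conjunct1])
qed

lemma R_closed: "s \<in> carrier \<Gamma> \<Longrightarrow> f \<in> carrier (smooth_functions M) \<Longrightarrow> R r s f \<in> carrier \<Gamma>"
  using deformation_axioms(1) unfolding bilinear_map_def linear_map_def by blast

lemma h_closed: "s \<in> carrier \<Gamma> \<Longrightarrow> t \<in> carrier \<Gamma> \<Longrightarrow> h r s t \<in> carrier (smooth_functions M)"
  using deformation_axioms(4) unfolding linear_map_def by blast

lemma C_closed:
  "f \<in> carrier (smooth_functions M) \<Longrightarrow> g \<in> carrier (smooth_functions M) \<Longrightarrow> C r f g \<in> carrier (smooth_functions M)"
  using star_product_bilinear[OF star_product, of r] unfolding bilinear_map_def linear_map_def by blast

lemma A_carrier: "carrier A = carrier V1.FV"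
  by (simp add: star_algebra_simps)

lemma A_nth: "a \<in> carrier A \<Longrightarrow> fps_nth a n \<in> carrier (smooth_functions M)"
  unfolding A_carrier by (rule V1.FV_nth)

lemma act_nth_0:
  assumes "x \<in> carrier V.FV" "a \<in> carrier A"
  shows "fps_nth (act x a) 0 = (\<lambda>p. fps_nth a 0 p \<odot>\<^bsub>fibre E p\<^esub> fps_nth x 0 p)"
proof -
  have *: "fps_nth x 0 \<in> carrier \<Gamma>" "fps_nth a 0 \<in> carrier (smooth_functions M)"
    using V.FV_nth[OF assms(1)] V1.FV_nth[of a 0] assms(2) unfolding A_carrier by blast+
  have "fps_nth (act x a) 0 = R 0 (fps_nth x 0) (fps_nth a 0)"
    unfolding deformed_act_def by (rule V.formal_extension_nth_0) (rule R_closed[OF *])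
  then show ?thesis using deformation_axioms(2) * by simp
qed

lemma ip_nth_0:
  assumes "x \<in> carrier V.FV" "y \<in> carrier V.FV"
  shows "fps_nth (ip x y) 0 = (\<lambda>p. h0 p (fps_nth x 0 p) (fps_nth y 0 p))"
proof -
  note * = V.FV_nth[OF assms(1), of 0] V.FV_nth[OF assms(2), of 0]
  have "fps_nth (ip x y) 0 = h 0 (fps_nth x 0) (fps_nth y 0)"
    unfolding deformed_ip_def by (rule V1.formal_extension_nth_0) (rule h_closed[OF *])
  then show ?thesis using deformation_axioms(5) * by simp
qed

text \<open>The action of the unit is idempotent by the module law, and in order zero it is
  pointwise multiplication by 1; an idempotent that is the identity in order zero is the
  identity.\<close>

lemma act_one:
  assumes x: "x \<in> carrier V.FV" shows "act x \<one>\<^bsub>A\<^esub> = x"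
proof (rule V.idempotent_agree_eq[where L = "\<lambda>x. act x \<one>\<^bsub>A\<^esub>"])
  interpret A: Ring.ring A
    using star_product_algebra_unital[OF star_product] by (simp add: unital_star_algebra_def)
  have rm: "right_module A V.FV act" by (rule deformation_axioms(3))
  show "V.linear_endo (\<lambda>x. act x \<one>\<^bsub>A\<^esub>)"
    using rm by (simp add: V.linear_endo_def right_module_def bilinear_map_def linear_map_def)
  fix x assume x: "x \<in> carrier V.FV"
  have "act x (\<one>\<^bsub>A\<^esub> \<otimes>\<^bsub>A\<^esub> \<one>\<^bsub>A\<^esub>) = act (act x \<one>\<^bsub>A\<^esub>) \<one>\<^bsub>A\<^esub>"
    using rm x A.one_closed unfolding right_module_def by blast
  then show "act (act x \<one>\<^bsub>A\<^esub>) \<one>\<^bsub>A\<^esub> = act x \<one>\<^bsub>A\<^esub>" by simp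
  have x0: "fps_nth x 0 \<in> carrier \<Gamma>" using x by simp
  have "1 \<odot>\<^bsub>fibre E p\<^esub> fps_nth x 0 p = fps_nth x 0 p" for p
    by (rule coord_inj[of _ p]) (simp_all add: fibre_scale_closed coord_scale \<Gamma>_fibre[OF x0])
  then show "agree 1 (act x \<one>\<^bsub>A\<^esub>) x"
    unfolding agree_def using act_nth_0[OF x A.one_closed] by (simp add: star_algebra_simps(6))
qed (rule x)

sublocale F: formal_inner_module A \<Gamma> act ip "\<lambda>(p, a) s. coord p (s p) $ a" "smooth_functions M" "\<lambda>p f. f p"
proof unfold_locales
  show "unital_star_algebra A" by (rule star_product_algebra_unital[OF star_product])
  show "right_module A V.FV act" "right_inner_product A V.FV act ip" by (rule deformation_axioms)+
  show "act x \<one>\<^bsub>A\<^esub> = x" if "x \<in> carrier V.FV" for x by (rule act_one[OF that])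
  show "carrier A = carrier V1.FV" "add A = add V1.FV" "zero A = zero V1.FV" "smult A = smult V1.FV"
    by (simp_all add: star_algebra_simps)
  show "agree n (a \<otimes>\<^bsub>A\<^esub> b) (a' \<otimes>\<^bsub>A\<^esub> b')"
    if "a \<in> carrier A" "b \<in> carrier A" "a' \<in> carrier A" "b' \<in> carrier A" "agree n a a'" "agree n b b'"
    for a b a' b' n
    unfolding star_algebra_simps(5)
    by (rule V1.formal_extension_agree[OF C_closed]) (use that A_nth in blast)+
  show "agree n (act x a) (act x' a')"
    if "x \<in> carrier V.FV" "x' \<in> carrier V.FV" "a \<in> carrier A" "a' \<in> carrier A" "agree n x x'" "agree n a a'"
    for x x' a a' n
    unfolding deformed_act_def
    by (rule V.formal_extension_agree[OF R_closed]) (use that V.FV_nth A_nth in blast)+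
  show "agree n (ip x y) (ip x' y')"
    if "x \<in> carrier V.FV" "x' \<in> carrier V.FV" "y \<in> carrier V.FV" "y' \<in> carrier V.FV" "agree n x x'" "agree n y y'"
    for x x' y y' n
    unfolding deformed_ip_def
    by (rule V1.formal_extension_agree[OF h_closed]) (use that V.FV_nth in blast)+
qed

definition const_section :: "('m \<Rightarrow> complex ^ 'k) \<Rightarrow> ('m \<Rightarrow> 'v) fps" where
  "const_section \<sigma> = Abs_fps (\<lambda>n. if n = 0 then (\<lambda>p. lift p (\<sigma> p)) else \<zero>\<^bsub>\<Gamma>\<^esub>)"

lemma const_section_closed: "smooth_section UNIV \<sigma> \<Longrightarrow> const_section \<sigma> \<in> carrier V.FV"
  unfolding V.FV_carrier const_section_def using lift_section V.V.M.zero_closed by auto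

text \<open>In order zero the action is pointwise scaling and the inner product is h0. So the
  classical frame and a multiple of it, viewed as constant series, satisfy the starting conditions
  of the two iterations.\<close>

lemma exists_parseval_module: "\<exists>J K xs ys. parseval_module A V.FV act ip J K xs ys"
proof -
  obtain n and x :: "nat \<Rightarrow> 'm \<Rightarrow> complex ^ 'k" where x:
    "\<And>i. i < n \<Longrightarrow> smooth_section UNIV (x i)"
    "\<And>p z. (\<Sum>i<n. form p (x i p) z *s x i p) = z"
    "\<And>p. (\<Sum>i<n. form p (x i p) (x i p)) = of_nat CARD('k)"
    by (rule parseval_frame, rule that)
  \<comment> \<open>The sum of form p (x_i, x_i) is \<open>CARD('k)\<close> by the third property of
    the frame, and this is positive because a type is nonempty.\<close>
  define r where "r = 1 / sqrt (real CARD('k))"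
  have r: "r * r * real CARD('k) = 1" by (simp add: r_def)
  define y where "y i p = complex_of_real r *s x i p" for i p
  have y: "smooth_section UNIV (y i)" if "i < n" for i
    unfolding y_def by (intro smooth_section_scale x that) auto
  have y_sum: "(\<Sum>i<n. form p (y i p) (y i p)) = 1" for p
  proof -
    have "(\<Sum>i<n. form p (y i p) (y i p)) =
        complex_of_real (r * r) * (\<Sum>i<n. form p (x i p) (x i p))"
      by (simp add: y_def form_scale_left form_scale_right sum_distrib_left mult.assoc)
    also have "\<dots> = complex_of_real (r * r * real CARD('k))" unfolding x(3) by simp
    also have "\<dots> = 1" unfolding r by simp
    finally show ?thesis .
  qed
  let ?z = "\<lambda>i. const_section (x i)" and ?y = "\<lambda>i. const_section (y i)"
  have z: "?z j \<in> carrier V.FV" if "j \<in> {..<n}" for j using x(1) that by (simp add: const_section_closed)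
  have yc: "?y j \<in> carrier V.FV" if "j \<in> {..<n}" for j using y that by (simp add: const_section_closed)
  have start: "agree 1 (\<Oplus>\<^bsub>V.FV\<^esub>j\<in>{..<n}. act (?z j) (ip (?z j) w)) w" if w: "w \<in> carrier V.FV" for w
  proof -
    have w0: "fps_nth w 0 \<in> carrier \<Gamma>" using w by simp
    have zw: "act (?z j) (ip (?z j) w) \<in> carrier V.FV" if "j \<in> {..<n}" for j using z[OF that] w by simp
    have "fps_nth (\<Oplus>\<^bsub>V.FV\<^esub>j\<in>{..<n}. act (?z j) (ip (?z j) w)) 0 =
        (\<Oplus>\<^bsub>\<Gamma>\<^esub>j\<in>{..<n}. fps_nth (act (?z j) (ip (?z j) w)) 0)"
      by (rule V.FV_finsum_nth) (use zw in auto)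
    also have "\<dots> = fps_nth w 0"
    proof (rule V.ev_sep)
      show "(\<Oplus>\<^bsub>\<Gamma>\<^esub>j\<in>{..<n}. fps_nth (act (?z j) (ip (?z j) w)) 0) \<in> carrier \<Gamma>"
        using zw by (intro V.V.M.finsum_closed) auto
      fix i :: "'m \<times> 'k"
      obtain p a where i: "i = (p, a)" by (rule prod.exhaust)
      have nth: "fps_nth (act (?z j) (ip (?z j) w)) 0 p =
          form p (x j p) (coord p (fps_nth w 0 p)) \<odot>\<^bsub>fibre E p\<^esub> lift p (x j p)" if "j \<in> {..<n}" for j
        using z[OF that] w \<Gamma>_fibre[OF w0]
        by (simp add: act_nth_0 ip_nth_0 const_section_def form_def)
      have "(case i of (p, a) \<Rightarrow> \<lambda>s. coord p (s p) $ a) (\<Oplus>\<^bsub>\<Gamma>\<^esub>j\<in>{..<n}. fps_nth (act (?z j) (ip (?z j) w)) 0) =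
          (\<Sum>j<n. (case i of (p, a) \<Rightarrow> \<lambda>s. coord p (s p) $ a) (fps_nth (act (?z j) (ip (?z j) w)) 0))"
        by (rule V.ev_finsum) (use zw in auto)
      also have "\<dots> = (\<Sum>j<n. form p (x j p) (coord p (fps_nth w 0 p)) *s x j p) $ a"
        using nth by (simp add: i coord_scale)
      also have "\<dots> = (case i of (p, a) \<Rightarrow> \<lambda>s. coord p (s p) $ a) (fps_nth w 0)"
        unfolding x(2) by (simp add: i)
      finally show "(case i of (p, a) \<Rightarrow> \<lambda>s. coord p (s p) $ a) (\<Oplus>\<^bsub>\<Gamma>\<^esub>j\<in>{..<n}. fps_nth (act (?z j) (ip (?z j) w)) 0) =
          (case i of (p, a) \<Rightarrow> \<lambda>s. coord p (s p) $ a) (fps_nth w 0)" .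
    qed (rule w0)
    finally show ?thesis by (simp add: agree_def)
  qed
  obtain xs where xs: "\<And>j. j \<in> {..<n} \<Longrightarrow> xs j \<in> carrier V.FV"
    "\<And>w. w \<in> carrier V.FV \<Longrightarrow> (\<Oplus>\<^bsub>V.FV\<^esub>j\<in>{..<n}. act (xs j) (ip (xs j) w)) = w"
    by (rule F.deformed_parseval[of "{..<n}" ?z], simp, erule z, erule start, rule that)
  have unit_start: "agree 1 (\<Oplus>\<^bsub>A\<^esub>j\<in>{..<n}. ip (?y j) (?y j)) \<one>\<^bsub>A\<^esub>"
  proof -
    have yy: "ip (?y j) (?y j) \<in> carrier V1.FV" if "j \<in> {..<n}" for j
      using F.ip_closed[OF yc[OF that] yc[OF that]] by (simp only: A_carrier)
    have "fps_nth (\<Oplus>\<^bsub>A\<^esub>j\<in>{..<n}. ip (?y j) (?y j)) 0 p = 1" for p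
    proof -
      have "(\<Oplus>\<^bsub>A\<^esub>j\<in>{..<n}. ip (?y j) (?y j)) = (\<Oplus>\<^bsub>V1.FV\<^esub>j\<in>{..<n}. ip (?y j) (?y j))"
        by (rule F.finsum_C) (use yc in auto)
      then have "fps_nth (\<Oplus>\<^bsub>A\<^esub>j\<in>{..<n}. ip (?y j) (?y j)) 0 p =
          (\<Oplus>\<^bsub>smooth_functions M\<^esub>j\<in>{..<n}. fps_nth (ip (?y j) (?y j)) 0) p"
        using V1.FV_finsum_nth[of "{..<n}" "\<lambda>j. ip (?y j) (?y j)" 0] yy by simp
      also have "\<dots> = (\<Sum>j<n. fps_nth (ip (?y j) (?y j)) 0 p)"
        by (rule V1.ev_finsum) (use V1.FV_nth[OF yy] in blast)+
      also have "\<dots> = (\<Sum>j<n. form p (y j p) (y j p))"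
        using yc by (intro sum.cong) (auto simp: ip_nth_0 const_section_def form_def)
      finally show ?thesis by (simp only: y_sum)
    qed
    then show ?thesis by (simp add: agree_def star_algebra_simps(6) fun_eq_iff)
  qed
  obtain ys where ys: "\<And>j. j \<in> {..<n} \<Longrightarrow> ys j \<in> carrier V.FV"
    "(\<Oplus>\<^bsub>A\<^esub>j\<in>{..<n}. ip (ys j) (ys j)) = \<one>\<^bsub>A\<^esub>"
    by (rule F.deformed_unit_sum[of "{..<n}" ?y], simp, erule yc, rule unit_start, rule that)
  have "parseval_module A V.FV act ip {..<n} {..<n} xs ys"
    by unfold_locales (use xs ys in auto)
  then show ?thesis by blast
qed

end

theorem theorem4p4:
  fixes M :: "('m::{t2_space, second_countable_topology}, 'e::euclidean_space) smooth_structure"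
    and P :: "('m \<Rightarrow> complex) \<Rightarrow> ('m \<Rightarrow> complex) \<Rightarrow> 'm \<Rightarrow> complex"
    and C :: "nat \<Rightarrow> ('m \<Rightarrow> complex) \<Rightarrow> ('m \<Rightarrow> complex) \<Rightarrow> 'm \<Rightarrow> complex"
    and E :: "('m, 'v, 'k::finite) bundle_data"
    and h0 :: "'m \<Rightarrow> 'v \<Rightarrow> 'v \<Rightarrow> complex"
    and R :: "nat \<Rightarrow> ('m \<Rightarrow> 'v) \<Rightarrow> ('m \<Rightarrow> complex) \<Rightarrow> 'm \<Rightarrow> 'v"
    and h :: "nat \<Rightarrow> ('m \<Rightarrow> 'v) \<Rightarrow> ('m \<Rightarrow> 'v) \<Rightarrow> 'm \<Rightarrow> complex"
  assumes "poisson_manifold M P"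
    and "hermitian_star_product M P C"
    and "hermitian_vector_bundle M E h0"
    and "hermitian_deformation M C E h0 R h"
  shows "equivalence_bimodule TYPE('h)
           (deformed_endomorphisms M C E R h) (star_product_algebra M C) (deformed_bimodule M E R h)
       \<and> nondegenerate_bimodule
           (deformed_endomorphisms M C E R h) (star_product_algebra M C) (deformed_bimodule M E R h)
       \<and> formally_Morita_equivalent TYPE(('m \<Rightarrow> 'v) fps) TYPE('h)
           (deformed_endomorphisms M C E R h) (star_product_algebra M C)"
proof -
  have "smooth_manifold M" using assms(1) unfolding poisson_manifold_def by (elim conjE)
  then interpret hermitian_deformation_setting M E h0 P C R h
    using assms by unfold_locales
  obtain J K xs ys where "parseval_module A V.FV act ip J K xs ys"
    using exists_parseval_module by blast
  then interpret PM: parseval_module A V.FV act ip J K xs ys .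
  have D: "deformed_endomorphisms M C E R h = PM.D"
    by (simp add: deformed_endomorphisms_def PM.D_def formal_sections_def)
  have "PM.\<Theta> = (\<lambda>x y. \<lambda>z\<in>carrier V.FV. act x (ip y z))"
    by (simp add: PM.\<Theta>_def fun_eq_iff)
  then have F: "deformed_bimodule M E R h = PM.F"
    by (simp add: deformed_bimodule_def PM.F_def formal_sections_def Let_def)
  have "nondegenerate_bimodule PM.D A PM.F"
    by (simp add: nondegenerate_bimodule_def PM.D_simps)
  then show ?thesis
    unfolding D F formally_Morita_equivalent_def using PM.equivalence by blast
qed

end
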